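(* Let $M$ be a real smooth, of class $C^1$, differentiable manifold. A linear connection $\nabla$ on $M$ is curvature free if and only if there exists a basis $\{E_i\}$ in which its components are zeros.
   Context: A linear connection on $M$ is a map $\nabla:V\mapsto\nabla_V$ on vector fields such that $\nabla_V$ maps $C^1$ tensor fields to tensor fields of the same type, is additive, commutes with contractions, obeys the Leibniz rule for $\otimes$, satisfies $\nabla_Vf=V(f)$ on $C^1$ functions, and $\nabla_{V+W}=\nabla_V+\nabla_W$, $\nabla_{fV}A=f\,\nabla_VA$. A basis here means a field of (local) bases $\{E_i\}$ in the tangent bundle, not required to be holonomic (i.e. not required to be of the form $\{\partial/\partial x^i\}$ for local coordinates $\{x^i\}$). The components $\Gamma^{j}{}_{ki}$ of $\nabla$ in $\{E_i\}$ are defined by $\nabla_{E_i}E_k=\Gamma^{j}{}_{ki}E_j$ (summation over repeated indices). The connection is curvature free if its curvature operator $R(A,B):=\nabla_A\circ\nabla_B-\nabla_B\circ\nabla_A-\nabla_{[A,B]}$ ($A,B$ vector fields, $[A,B]:=A\circ B-B\circ A$) vanishes.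
   Formalization: "Of class C^1" is replaced by a C^3 manifold (Hausdorff, dimension at least 1) and the connection is assumed to have C^1 coefficients, since on a C^1 manifold C^1 tensor fields, [A,B] and the curvature operator are not defined; the basis is a field of local C^1 bases. *)

theory Defs
  imports "HOL-Analysis.Analysis"
begin

section \<open>Manifolds\<close>

text \<open>Only meaningful for open \<open>S\<close>: the derivatives are taken at interior points.\<close>

primrec Ck_on :: "nat \<Rightarrow> ('a::euclidean_space \<Rightarrow> 'b::euclidean_space) \<Rightarrow> 'a set \<Rightarrow> bool" where
  "Ck_on 0 f S \<longleftrightarrow> continuous_on S f"
| "Ck_on (Suc k) f S \<longleftrightarrow>
     (\<forall>x\<in>S. f differentiable (at x)) \<and> (\<forall>v. Ck_on k (\<lambda>x. frechet_derivative f (at x) v) S)"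

definition partial_deriv :: "'n::finite \<Rightarrow> (real^'n \<Rightarrow> 'b::real_normed_vector) \<Rightarrow> real^'n \<Rightarrow> 'b" where
  "partial_deriv i f x = frechet_derivative f (at x) (axis i 1)"

type_synonym ('m, 'n) chart = "'m set \<times> ('m \<Rightarrow> real^'n)"

abbreviation chart_dom :: "('m, 'n::finite) chart \<Rightarrow> 'm set" where
  "chart_dom c \<equiv> fst c"

abbreviation chart_map :: "('m, 'n::finite) chart \<Rightarrow> 'm \<Rightarrow> real^'n" where
  "chart_map c \<equiv> snd c"

abbreviation chart_inv :: "('m, 'n::finite) chart \<Rightarrow> real^'n \<Rightarrow> 'm" where
  "chart_inv c \<equiv> inv_into (chart_dom c) (chart_map c)"

definition is_chart :: "'m topology \<Rightarrow> ('m, 'n::finite) chart \<Rightarrow> bool" where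
  "is_chart M c \<longleftrightarrow>
     openin M (chart_dom c) \<and> open (chart_map c ` chart_dom c) \<and>
     homeomorphic_map (subtopology M (chart_dom c)) (top_of_set (chart_map c ` chart_dom c)) (chart_map c)"

definition transition :: "('m, 'n::finite) chart \<Rightarrow> ('m, 'n) chart \<Rightarrow> real^'n \<Rightarrow> real^'n" where
  "transition c d = chart_map d \<circ> chart_inv c"

text \<open>The atlas need not be maximal. No countability axiom is imposed.\<close>

definition Ck_manifold :: "nat \<Rightarrow> 'm topology \<Rightarrow> ('m, 'n::finite) chart set \<Rightarrow> bool" where
  "Ck_manifold k M \<A> \<longleftrightarrow>
     Hausdorff_space M \<and>
     (\<forall>c\<in>\<A>. is_chart M c) \<and>
     topspace M = (\<Union>c\<in>\<A>. chart_dom c) \<and>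
     (\<forall>c\<in>\<A>. \<forall>d\<in>\<A>. Ck_on k (transition c d) (chart_map c ` (chart_dom c \<inter> chart_dom d)))"

section \<open>Tensor fields\<close>

text \<open>
  A tensor field of type \<open>(r, s)\<close> is given in the classical way, by its components in the charts
  of the atlas: \<open>T c p is js\<close> is the component, at the point \<open>p\<close> and with respect to the chart
  \<open>c\<close>, with the list \<open>is\<close> of upper (contravariant) and the list \<open>js\<close> of lower (covariant) indices.
  Components that make no sense (wrong number of indices, \<open>c\<close> not in the atlas, \<open>p\<close> outside the
  domain) are set to \<open>0\<close>, so that equality of tensor fields is equality in HOL and the zero tensor
  field is the same for all types.  Vector fields have type \<open>(1, 0)\<close>; functions are
  identified with tensor fields of type \<open>(0, 0)\<close>, whose single component does not depend on the chart.
\<close>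

type_synonym ('m, 'n) tfield = "('m, 'n) chart \<Rightarrow> 'm \<Rightarrow> 'n list \<Rightarrow> 'n list \<Rightarrow> real"

text \<open>\<open>jacobian c d p i k\<close> is the derivative of the \<open>i\<close>-th coordinate of \<open>d\<close> with respect to the
  \<open>k\<close>-th coordinate of \<open>c\<close>.\<close>

definition jacobian ::
  "('m, 'n::finite) chart \<Rightarrow> ('m, 'n) chart \<Rightarrow> 'm \<Rightarrow> 'n \<Rightarrow> 'n \<Rightarrow> real" where
  "jacobian c d p i k = partial_deriv k (transition c d) (chart_map c p) $ i"

definition tensor_field ::
  "('m, 'n::finite) chart set \<Rightarrow> 'm set \<Rightarrow> nat \<Rightarrow> nat \<Rightarrow> ('m, 'n) tfield \<Rightarrow> bool" where
  "tensor_field \<A> U r s T \<longleftrightarrow>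
     (\<forall>c p is js. \<not> (c \<in> \<A> \<and> p \<in> chart_dom c \<inter> U \<and> length is = r \<and> length js = s)
        \<longrightarrow> T c p is js = 0) \<and>
     (\<forall>c\<in>\<A>. \<forall>d\<in>\<A>. \<forall>p \<in> chart_dom c \<inter> chart_dom d \<inter> U. \<forall>is js.
        length is = r \<and> length js = s \<longrightarrow>
        T d p is js =
          (\<Sum>ks | length ks = r. \<Sum>ls | length ls = s.
             (\<Prod>a<r. jacobian c d p (is ! a) (ks ! a)) *
             (\<Prod>b<s. jacobian d c p (ls ! b) (js ! b)) * T c p ks ls))"

definition Ck_tensor_field ::
  "nat \<Rightarrow> ('m, 'n::finite) chart set \<Rightarrow> 'm set \<Rightarrow> nat \<Rightarrow> nat \<Rightarrow> ('m, 'n) tfield \<Rightarrow> bool" where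
  "Ck_tensor_field k \<A> U r s T \<longleftrightarrow>
     tensor_field \<A> U r s T \<and>
     (\<forall>c\<in>\<A>. \<forall>is js. Ck_on k (\<lambda>x. T c (chart_inv c x) is js) (chart_map c ` (chart_dom c \<inter> U)))"

definition tzero :: "('m, 'n) tfield" where
  "tzero = (\<lambda>c p is js. 0)"

definition tadd :: "('m, 'n) tfield \<Rightarrow> ('m, 'n) tfield \<Rightarrow> ('m, 'n) tfield" where
  "tadd S T = (\<lambda>c p is js. S c p is js + T c p is js)"

definition tdiff :: "('m, 'n) tfield \<Rightarrow> ('m, 'n) tfield \<Rightarrow> ('m, 'n) tfield" where
  "tdiff S T = (\<lambda>c p is js. S c p is js - T c p is js)"

text \<open>Here \<open>(r, s)\<close> is the type of the left factor.  \<open>tprod 0 0 f T\<close> is the product of \<open>T\<close> with the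
  function \<open>f\<close>.\<close>

definition tprod :: "nat \<Rightarrow> nat \<Rightarrow> ('m, 'n) tfield \<Rightarrow> ('m, 'n) tfield \<Rightarrow> ('m, 'n) tfield" where
  "tprod r s S T =
     (\<lambda>c p is js. S c p (take r is) (take s js) * T c p (drop r is) (drop s js))"

text \<open>Contraction of the upper index at position \<open>a\<close> with the lower index at position \<open>b\<close>
  (counted from \<open>0\<close>).\<close>

definition contract :: "nat \<Rightarrow> nat \<Rightarrow> ('m, 'n::finite) tfield \<Rightarrow> ('m, 'n) tfield" where
  "contract a b T =
     (\<lambda>c p is js. \<Sum>k\<in>UNIV. T c p (take a is @ k # drop a is) (take b js @ k # drop b js))"

text \<open>The function \<open>V(f)\<close>, as a tensor field of type \<open>(0, 0)\<close>.\<close>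

definition vf_apply :: "('m, 'n::finite) tfield \<Rightarrow> ('m, 'n) tfield \<Rightarrow> ('m, 'n) tfield" where
  "vf_apply V f =
     (\<lambda>c p is js. if is = [] \<and> js = []
        then \<Sum>i\<in>UNIV. V c p [i] [] * partial_deriv i (\<lambda>x. f c (chart_inv c x) [] []) (chart_map c p)
        else 0)"

definition lie_bracket ::
  "'m topology \<Rightarrow> ('m, 'n::finite) chart set \<Rightarrow> ('m, 'n) tfield \<Rightarrow> ('m, 'n) tfield \<Rightarrow> ('m, 'n) tfield" where
  "lie_bracket M \<A> A B =
     (THE Z. tensor_field \<A> (topspace M) 1 0 Z \<and>
        (\<forall>f. Ck_tensor_field 2 \<A> (topspace M) 0 0 f \<longrightarrow>
           vf_apply Z f = tdiff (vf_apply A (vf_apply B f)) (vf_apply B (vf_apply A f))))"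

section \<open>Linear connections\<close>

type_synonym ('m, 'n) connection = "('m, 'n) tfield \<Rightarrow> ('m, 'n) tfield \<Rightarrow> ('m, 'n) tfield"

definition linear_connection ::
  "'m topology \<Rightarrow> ('m, 'n::finite) chart set \<Rightarrow> ('m, 'n) connection \<Rightarrow> bool" where
  "linear_connection M \<A> D \<longleftrightarrow>
     (\<forall>V. tensor_field \<A> (topspace M) 1 0 V \<longrightarrow>
        (\<forall>r s T. Ck_tensor_field 1 \<A> (topspace M) r s T \<longrightarrow>
           tensor_field \<A> (topspace M) r s (D V T)) \<and>
        (\<forall>r s S T. Ck_tensor_field 1 \<A> (topspace M) r s S \<and> Ck_tensor_field 1 \<A> (topspace M) r s T \<longrightarrow>
           D V (tadd S T) = tadd (D V S) (D V T)) \<and>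
        (\<forall>r s a b T. Ck_tensor_field 1 \<A> (topspace M) (Suc r) (Suc s) T \<and> a \<le> r \<and> b \<le> s \<longrightarrow>
           D V (contract a b T) = contract a b (D V T)) \<and>
        (\<forall>r s r' s' S T. Ck_tensor_field 1 \<A> (topspace M) r s S \<and> Ck_tensor_field 1 \<A> (topspace M) r' s' T \<longrightarrow>
           D V (tprod r s S T) = tadd (tprod r s (D V S) T) (tprod r s S (D V T))) \<and>
        (\<forall>f. Ck_tensor_field 1 \<A> (topspace M) 0 0 f \<longrightarrow> D V f = vf_apply V f)) \<and>
     (\<forall>V W r s T. tensor_field \<A> (topspace M) 1 0 V \<and> tensor_field \<A> (topspace M) 1 0 W \<and>
        Ck_tensor_field 1 \<A> (topspace M) r s T \<longrightarrow>
           D (tadd V W) T = tadd (D V T) (D W T)) \<and>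
     (\<forall>f V r s T. tensor_field \<A> (topspace M) 0 0 f \<and> tensor_field \<A> (topspace M) 1 0 V \<and>
        Ck_tensor_field 1 \<A> (topspace M) r s T \<longrightarrow>
           D (tprod 0 0 f V) T = tprod 0 0 f (D V T))"

definition Ck_connection ::
  "nat \<Rightarrow> 'm topology \<Rightarrow> ('m, 'n::finite) chart set \<Rightarrow> ('m, 'n) connection \<Rightarrow> bool" where
  "Ck_connection k M \<A> D \<longleftrightarrow>
     (\<forall>V r s T. Ck_tensor_field k \<A> (topspace M) 1 0 V \<and> Ck_tensor_field (Suc k) \<A> (topspace M) r s T \<longrightarrow>
        Ck_tensor_field k \<A> (topspace M) r s (D V T))"

definition curvature ::
  "'m topology \<Rightarrow> ('m, 'n::finite) chart set \<Rightarrow> ('m, 'n) connection \<Rightarrow>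
   ('m, 'n) tfield \<Rightarrow> ('m, 'n) tfield \<Rightarrow> ('m, 'n) tfield \<Rightarrow> ('m, 'n) tfield" where
  "curvature M \<A> D A B T =
     tdiff (tdiff (D A (D B T)) (D B (D A T))) (D (lie_bracket M \<A> A B) T)"

text \<open>The fields are of the classes for which all the terms of the curvature operator of a
  connection of class \<open>C\<^sup>1\<close> on a manifold of class \<open>C\<^sup>3\<close> are defined: then \<open>D B T\<close> is
  of class \<open>C\<^sup>1\<close>, so that \<open>D A\<close> can be applied to it, and the bracket of \<open>A\<close> and \<open>B\<close> exists.\<close>

definition curvature_free ::
  "'m topology \<Rightarrow> ('m, 'n::finite) chart set \<Rightarrow> ('m, 'n) connection \<Rightarrow> bool" where
  "curvature_free M \<A> D \<longleftrightarrow>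
     (\<forall>A B r s T. Ck_tensor_field 1 \<A> (topspace M) 1 0 A \<and> Ck_tensor_field 1 \<A> (topspace M) 1 0 B \<and>
        Ck_tensor_field 2 \<A> (topspace M) r s T \<longrightarrow> curvature M \<A> D A B T = tzero)"

section \<open>Local bases and components\<close>

definition local_basis ::
  "'m topology \<Rightarrow> ('m, 'n::finite) chart set \<Rightarrow> 'm set \<Rightarrow> ('n \<Rightarrow> ('m, 'n) tfield) \<Rightarrow> bool" where
  "local_basis M \<A> U E \<longleftrightarrow>
     openin M U \<and>
     (\<forall>i. Ck_tensor_field 1 \<A> U 1 0 (E i)) \<and>
     (\<forall>c\<in>\<A>. \<forall>p \<in> chart_dom c \<inter> U.
        let e = (\<lambda>i. \<chi> j. E i c p [j] []) :: 'n \<Rightarrow> real^'n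
        in inj e \<and> independent (range e) \<and> span (range e) = UNIV)"

text \<open>A connection acts on fields defined on all of \<open>M\<close>.  It is a local operator, so it
  acts on a field \<open>T\<close> given only on an open set \<open>U\<close> as well: at \<open>p\<close>, replace \<open>T\<close> by any
  field on \<open>M\<close> that agrees with \<open>T\<close> near \<open>p\<close>.\<close>

definition extends_germ ::
  "'m topology \<Rightarrow> ('m, 'n::finite) chart set \<Rightarrow> nat \<Rightarrow> nat \<Rightarrow> 'm \<Rightarrow> ('m, 'n) tfield \<Rightarrow> ('m, 'n) tfield \<Rightarrow> bool"
where
  "extends_germ M \<A> r s p T T' \<longleftrightarrow>
     Ck_tensor_field 1 \<A> (topspace M) r s T' \<and>
     (\<exists>W. openin M W \<and> p \<in> W \<and> (\<forall>c. \<forall>q\<in>W. T' c q = T c q))"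

definition local_cov_deriv ::
  "'m topology \<Rightarrow> ('m, 'n::finite) chart set \<Rightarrow> ('m, 'n) connection \<Rightarrow> nat \<Rightarrow> nat \<Rightarrow>
   'm set \<Rightarrow> ('m, 'n) tfield \<Rightarrow> ('m, 'n) tfield \<Rightarrow> ('m, 'n) tfield" where
  "local_cov_deriv M \<A> D r s U V T =
     (\<lambda>c p. if p \<in> U
        then D (SOME V'. extends_germ M \<A> 1 0 p V V') (SOME T'. extends_germ M \<A> r s p T T') c p
        else (\<lambda>is js. 0))"

text \<open>\<open>\<Gamma> j k i p\<close> is the component with upper index \<open>j\<close> and lower indices \<open>k\<close>, \<open>i\<close>, the last one
  being the direction of differentiation.\<close>

definition has_components ::
  "'m topology \<Rightarrow> ('m, 'n::finite) chart set \<Rightarrow> ('m, 'n) connection \<Rightarrow> 'm set \<Rightarrow>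
   ('n \<Rightarrow> ('m, 'n) tfield) \<Rightarrow> ('n \<Rightarrow> 'n \<Rightarrow> 'n \<Rightarrow> 'm \<Rightarrow> real) \<Rightarrow> bool" where
  "has_components M \<A> D U E \<Gamma> \<longleftrightarrow>
     (\<forall>i k. \<forall>p\<in>U. \<forall>c is js.
        local_cov_deriv M \<A> D 1 0 U (E i) (E k) c p is js = (\<Sum>j\<in>UNIV. \<Gamma> j k i p * E j c p is js))"

end

theory Submission imports Defs begin

text \<open>
  Near a point, let \<open>X\<^sub>i\<close> and \<open>\<theta>\<^sup>l\<close> be global fields that agree with the coordinate fields
  \<open>\<partial>\<^sub>i\<close> and \<open>dx\<^sup>l\<close>.  Differentiating the function \<open>\<theta>\<^sup>l(W)\<close>, a contraction of
  \<open>\<theta>\<^sup>l \<otimes> W\<close>, shows that a \<open>C\<^sup>1\<close> vector field \<open>W\<close> is parallel iff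
  \<open>\<partial>\<^sub>i W\<^sup>l = - \<Gamma>\<^sup>l\<^sub>k\<^sub>i W\<^sup>k\<close>, where \<open>\<Gamma>\<^sup>l\<^sub>k\<^sub>i = - (D\<^sub>i \<theta>\<^sup>l)\<^sub>k\<close> is of class \<open>C\<^sup>1\<close>.
  If the curvature vanishes, this linear system satisfies the integrability conditions, and solving
  it for \<open>n\<close> independent initial values gives a parallel basis.  Conversely, a parallel basis is
  of class \<open>C\<^sup>2\<close> by the same system and is killed by the curvature operator, which is a
  derivation of the tensor algebra commuting with contractions and so vanishes on all tensors.
\<close>

section \<open>Functions of class \<open>C\<^sup>k\<close>\<close>

text \<open>Regularity shapes both directions. Transition maps of class \<open>C\<^sup>3\<close>
  have Jacobians of class \<open>C\<^sup>2\<close>, so coordinate fields and differentials, cut off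
  to all of the manifold, are of class \<open>C\<^sup>2\<close>; this is just what puts
  \<open>D (X i) (\<theta> l)\<close>, hence the coefficients of the linear system, into class
  \<open>C\<^sup>1\<close>. For such coefficients the classical check that a solution along rays
  solves the whole system would differentiate a derivative of the solution once more along the ray.
  The Picard iterates avoid this: only \<open>G v y\<close> is integrated by parts, and the failure
  of each iterate to solve the system is estimated directly. In the other direction the basis is of
  class \<open>C\<^sup>1\<close> only, whereas the curvature operator acts on fields of class
  \<open>C\<^sup>2\<close>; the gain of one derivative has to come before any use of curvature. The
  basis is also local while \<open>D\<close> acts on global fields. Locality in the second argument
  (cut-off functions and the Leibniz rule) and dependence on the first argument at the point alone
  (indicator functions) carry every passage between local and global fields.\<close>

lemma Ck_on_subset: "Ck_on k f S \<Longrightarrow> T \<subseteq> S \<Longrightarrow> Ck_on k f T"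
  by (induction k arbitrary: f) (auto intro: continuous_on_subset)

lemma Ck_on_imp_continuous_on: "Ck_on k f S \<Longrightarrow> continuous_on S f"
proof (cases k)
  case (Suc j)
  then show "Ck_on k f S \<Longrightarrow> ?thesis"
    by (auto intro!: differentiable_imp_continuous_on differentiable_at_imp_differentiable_on)
qed auto

lemma Ck_on_SucD: "Ck_on (Suc k) f S \<Longrightarrow> Ck_on k f S"
proof (induction k arbitrary: f)
  case 0 then show ?case using Ck_on_imp_continuous_on by fastforce
next
  case (Suc k)
  then show ?case by (metis Ck_on.simps(2))
qed

lemma Ck_on_mono: assumes "Ck_on k f S" "m \<le> k" shows "Ck_on m f S"
  using assms(2,1) by (induction rule: dec_induct) (auto dest: Ck_on_SucD simp del: Ck_on.simps)

text \<open>Openness of \<open>S\<close> matters: derivatives are taken in the whole space, so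
  agreement on \<open>S\<close> has to give agreement near each of its points.\<close>

lemma Ck_on_cong:
  assumes "open S" "\<And>x. x \<in> S \<Longrightarrow> f x = g x"
  shows "Ck_on k f S \<longleftrightarrow> Ck_on k g S"
  using assms
proof (induction k arbitrary: f g)
  case (Suc k)
  have d: "f differentiable at x \<longleftrightarrow> g differentiable at x" if "x \<in> S" for x
    using that Suc.prems has_derivative_transform_within_open[of f _ x UNIV S g]
      has_derivative_transform_within_open[of g _ x UNIV S f] unfolding differentiable_def by metis
  have e: "frechet_derivative f (at x) = frechet_derivative g (at x)"
    if "x \<in> S" "f differentiable at x" for x
    using frechet_derivative_transform_within_open[OF that(2) \<open>open S\<close> that(1)] Suc.prems by blast
  show ?case
  proof -
    have "Ck_on k (\<lambda>x. frechet_derivative f (at x) v) S \<longleftrightarrow> Ck_on k (\<lambda>x. frechet_derivative g (at x) v) S"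
      if "\<forall>x\<in>S. f differentiable at x" for v
      using that e by (intro Suc.IH[OF Suc.prems(1)]) simp
    then show ?thesis using d by (auto simp del: split_paired_All)
  qed
qed (auto cong: continuous_on_cong)

text \<open>Allows the derivative to be given by a formula instead of
  \<open>frechet_derivative\<close>; the inductions for sums, products and compositions all go
  through this rule.\<close>

lemma Ck_on_SucI:
  assumes "open S" "\<And>x. x \<in> S \<Longrightarrow> (f has_derivative f' x) (at x)"
    and "\<And>v. Ck_on k (\<lambda>x. f' x v) S"
  shows "Ck_on (Suc k) f S"
proof -
  have "Ck_on k (\<lambda>x. frechet_derivative f (at x) v) S" for v
    using assms(3)[of v] Ck_on_cong[OF assms(1), of "\<lambda>x. frechet_derivative f (at x) v" "\<lambda>x. f' x v" k]
      frechet_derivative_at[OF assms(2)] by metis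
  then show ?thesis using assms(2) by (auto simp: differentiable_def)
qed

lemma Ck_on_has_derivative:
  "Ck_on (Suc k) f S \<Longrightarrow> x \<in> S \<Longrightarrow> (f has_derivative frechet_derivative f (at x)) (at x)"
  by (simp add: frechet_derivative_works)

lemma Ck_on_frechet_derivative:
  "Ck_on (Suc k) f S \<Longrightarrow> Ck_on k (\<lambda>x. frechet_derivative f (at x) v) S"
  by simp

lemma Ck_on_local:
  assumes "\<And>x. x \<in> S \<Longrightarrow> \<exists>T. open T \<and> x \<in> T \<and> Ck_on k f T"
  shows "Ck_on k f S"
  using assms
proof (induction k arbitrary: f)
  case 0
  then have "continuous (at x) f" if "x \<in> S" for x
    using that by (metis Ck_on.simps(1) continuous_on_eq_continuous_at)
  then show ?case by (simp add: continuous_at_imp_continuous_on)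
next
  case (Suc k)
  have "f differentiable at x" if "x \<in> S" for x
    using Suc.prems[OF that] by auto
  moreover have "Ck_on k (\<lambda>x. frechet_derivative f (at x) v) S" for v
  proof (rule Suc.IH)
    show "\<exists>T. open T \<and> x \<in> T \<and> Ck_on k (\<lambda>x. frechet_derivative f (at x) v) T" if "x \<in> S" for x
      using Suc.prems[OF that] Ck_on_frechet_derivative by blast
  qed
  ultimately show ?case by simp
qed

text \<open>Meant for gluing: a cut-off function is smooth on the set where it was given and zero
  off its closed support, and these two open sets cover the chart.\<close>

lemma Ck_on_Un: "open S \<Longrightarrow> open T \<Longrightarrow> Ck_on k f S \<Longrightarrow> Ck_on k f T \<Longrightarrow> Ck_on k f (S \<union> T)"
  by (rule Ck_on_local) blast

lemma Ck_on_const [simp]: "Ck_on k (\<lambda>x. c) S"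
  by (induction k arbitrary: c) auto

lemma Ck_on_bounded_linear_compose:
  assumes "open S" "Ck_on k f S" "bounded_linear L"
  shows "Ck_on k (\<lambda>x. L (f x)) S"
  using assms(2)
proof (induction k arbitrary: f)
  case 0 then show ?case
    using bounded_linear.continuous_on[OF assms(3)] by auto
next
  case (Suc k)
  show ?case
  proof (rule Ck_on_SucI[OF assms(1)])
    show "((\<lambda>x. L (f x)) has_derivative (\<lambda>v. L (frechet_derivative f (at x) v))) (at x)" if "x \<in> S" for x
      using bounded_linear.has_derivative[OF assms(3) Ck_on_has_derivative[OF Suc.prems that]] .
    show "Ck_on k (\<lambda>x. L (frechet_derivative f (at x) v)) S" for v
      using Suc.IH Ck_on_frechet_derivative[OF Suc.prems] by blast
  qed
qed

lemma Ck_on_bounded_linear: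
  assumes "bounded_linear L" "open S" shows "Ck_on k L S"
proof (cases k)
  case 0 then show ?thesis using assms by (simp add: linear_continuous_on)
next
  case (Suc j)
  then show ?thesis
    using Ck_on_SucI[OF assms(2), of L "\<lambda>_. L" j] assms(1) by (simp add: bounded_linear_imp_has_derivative del: Ck_on.simps)
qed

lemma Ck_on_add:
  assumes "open S" "Ck_on k f S" "Ck_on k g S" shows "Ck_on k (\<lambda>x. f x + g x) S"
  using assms(2,3)
proof (induction k arbitrary: f g)
  case 0 then show ?case by (auto intro: continuous_intros)
next
  case (Suc k)
  note D = Ck_on_has_derivative[OF Suc.prems(1)] Ck_on_has_derivative[OF Suc.prems(2)]
  show ?case
    by (rule Ck_on_SucI[OF assms(1) has_derivative_add[OF D]], assumption+)
      (intro Suc.IH Suc.prems[THEN Ck_on_frechet_derivative])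
qed

lemma Ck_on_mult:
  fixes f g :: "'a::euclidean_space \<Rightarrow> real"
  assumes "open S" "Ck_on k f S" "Ck_on k g S" shows "Ck_on k (\<lambda>x. f x * g x) S"
  using assms(2,3)
proof (induction k arbitrary: f g)
  case 0 then show ?case by (auto intro: continuous_intros)
next
  case (Suc k)
  note D = Ck_on_has_derivative[OF Suc.prems(1)] Ck_on_has_derivative[OF Suc.prems(2)]
  show ?case
    by (rule Ck_on_SucI[OF assms(1) has_derivative_mult[OF D]], assumption+)
      (intro Ck_on_add assms(1) Suc.IH Suc.prems[THEN Ck_on_SucD] Suc.prems[THEN Ck_on_frechet_derivative])
qed

lemma Ck_on_uminus: "open S \<Longrightarrow> Ck_on k f S \<Longrightarrow> Ck_on k (\<lambda>x. - f x) S"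
  using Ck_on_bounded_linear_compose[of S k f uminus] bounded_linear_minus bounded_linear_ident by blast

lemma Ck_on_diff:
  assumes "open S" "Ck_on k f S" "Ck_on k g S" shows "Ck_on k (\<lambda>x. f x - g x) S"
  using Ck_on_add[OF assms(1,2) Ck_on_uminus[OF assms(1,3)]] by simp

lemma Ck_on_sum:
  assumes "open S" "\<And>i. i \<in> I \<Longrightarrow> Ck_on k (f i) S" shows "Ck_on k (\<lambda>x. \<Sum>i\<in>I. f i x) S"
  using assms(2) by (induction I rule: infinite_finite_induct) (auto intro: Ck_on_add[OF assms(1)])

lemma Ck_on_prod:
  fixes f :: "'i \<Rightarrow> 'a::euclidean_space \<Rightarrow> real"
  assumes "open S" "\<And>i. i \<in> I \<Longrightarrow> Ck_on k (f i) S" shows "Ck_on k (\<lambda>x. \<Prod>i\<in>I. f i x) S"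
  using assms(2) by (induction I rule: infinite_finite_induct) (auto intro: Ck_on_mult[OF assms(1)])

text \<open>Expanding the inner derivative in the basis keeps the induction within real-valued products.\<close>

lemma Ck_on_compose_real:
  fixes g :: "'b::euclidean_space \<Rightarrow> real" and f :: "'a::euclidean_space \<Rightarrow> 'b"
  assumes "open S" "open T" "Ck_on k f S" "Ck_on k g T" "f ` S \<subseteq> T"
  shows "Ck_on k (\<lambda>x. g (f x)) S"
  using assms(3,4)
proof (induction k arbitrary: g)
  case 0 then show ?case using assms(5) by (auto intro: continuous_on_compose2)
next
  case (Suc k)
  have g': "(g has_derivative frechet_derivative g (at (f x))) (at (f x))" if "x \<in> S" for x
    using Ck_on_has_derivative[OF Suc.prems(2)] that assms(5) by blast
  have eq: "frechet_derivative g (at (f x)) (frechet_derivative f (at x) v)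
    = (\<Sum>b\<in>Basis. (frechet_derivative f (at x) v \<bullet> b) * frechet_derivative g (at (f x)) b)"
    if "x \<in> S" for x v
  proof -
    interpret bounded_linear "frechet_derivative g (at (f x))"
      using g'[OF that] by (rule has_derivative_bounded_linear)
    show ?thesis
      by (subst euclidean_representation[of "frechet_derivative f (at x) v", symmetric]) (simp add: sum scale)
  qed
  show ?case
  proof (rule Ck_on_SucI[OF assms(1)])
    show "((\<lambda>x. g (f x)) has_derivative
        (\<lambda>v. frechet_derivative g (at (f x)) (frechet_derivative f (at x) v))) (at x)" if "x \<in> S" for x
      using has_derivative_compose[OF Ck_on_has_derivative[OF Suc.prems(1) that] g'[OF that]] .
    fix v
    have "Ck_on k (\<lambda>x. \<Sum>b\<in>Basis. (frechet_derivative f (at x) v \<bullet> b) * frechet_derivative g (at (f x)) b) S"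
    proof (intro Ck_on_sum Ck_on_mult assms(1))
      show "Ck_on k (\<lambda>x. frechet_derivative f (at x) v \<bullet> b) S" for b
        by (rule Ck_on_bounded_linear_compose[OF assms(1) Ck_on_frechet_derivative[OF Suc.prems(1)] bounded_linear_inner_left])
      show "Ck_on k (\<lambda>x. frechet_derivative g (at (f x)) b) S" for b
        using Suc.IH[OF Ck_on_SucD[OF Suc.prems(1)] Ck_on_frechet_derivative[OF Suc.prems(2), of b]] .
    qed
    then show "Ck_on k (\<lambda>x. frechet_derivative g (at (f x)) (frechet_derivative f (at x) v)) S"
      using eq Ck_on_cong[OF assms(1)] by (simp cong: Ck_on_cong[OF assms(1)])
  qed
qed

lemma Ck_on_vec_nth:
  fixes f :: "'a::euclidean_space \<Rightarrow> real^'n"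
  shows "open S \<Longrightarrow> Ck_on k f S \<Longrightarrow> Ck_on k (\<lambda>x. f x $ i) S"
  by (rule Ck_on_bounded_linear_compose) (auto intro: bounded_linear_vec_nth)

text \<open>The derivative of \<open>max 0 t ^ Suc (Suc k)\<close> is a multiple of
  \<open>max 0 t ^ Suc k\<close>, also at 0, where an exponent of at least 2 makes the difference
  quotient tend to 0. A power can replace the usual exponential since only finitely many derivatives
  are wanted.\<close>

lemma Ck_on_max_power: "Ck_on k (\<lambda>t::real. max 0 t ^ Suc k) UNIV"
proof (induction k)
  case 0 show ?case by (auto intro!: continuous_intros)
next
  case (Suc k)
  have *: "((\<lambda>t::real. max 0 t ^ Suc (Suc k)) has_real_derivative (real (Suc (Suc k)) * max 0 x ^ Suc k)) (at x)" for x
  proof -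
    consider "x < 0" | "x > 0" | "x = 0" by linarith
    then show ?thesis
    proof cases
      case 1
      have "((\<lambda>t::real. 0) has_real_derivative 0) (at x)" by simp
      then have "((\<lambda>t::real. max 0 t ^ Suc (Suc k)) has_real_derivative 0) (at x)"
        by (rule has_field_derivative_transform_within_open[of _ _ _ "{..<0}"]) (use 1 in auto)
      then show ?thesis using 1 by simp
    next
      case 2
      have "((\<lambda>t::real. t ^ Suc (Suc k)) has_real_derivative real (Suc (Suc k)) * x ^ Suc k) (at x)"
        by (rule derivative_eq_intros refl | simp)+
      then have "((\<lambda>t::real. max 0 t ^ Suc (Suc k)) has_real_derivative real (Suc (Suc k)) * x ^ Suc k) (at x)"
        by (rule has_field_derivative_transform_within_open[of _ _ _ "{0<..}"]) (use 2 in auto)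
      then show ?thesis using 2 by simp
    next
      case 3
      have "((\<lambda>h::real. max 0 h ^ Suc (Suc k) / h) \<longlongrightarrow> 0) (at 0)"
      proof (rule Lim_null_comparison)
        show "\<forall>\<^sub>F h in at 0. norm (max 0 h ^ Suc (Suc k) / h) \<le> \<bar>h\<bar> ^ Suc k"
          by (intro always_eventually) (auto simp: max_def mult_le_0_iff)
        show "((\<lambda>h::real. \<bar>h\<bar> ^ Suc k) \<longlongrightarrow> 0) (at 0)"
          by (rule tendsto_eq_intros refl | simp)+
      qed
      then show ?thesis using 3 by (simp add: DERIV_def)
    qed
  qed
  show ?case
  proof (rule Ck_on_SucI)
    show "((\<lambda>t::real. max 0 t ^ Suc (Suc k)) has_derivative (\<lambda>v. (real (Suc (Suc k)) * max 0 x ^ Suc k) * v)) (at x)" for x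
      using *[of x] by (simp only: has_field_derivative_def)
    show "Ck_on k (\<lambda>x. (real (Suc (Suc k)) * max 0 x ^ Suc k) * v) UNIV" for v
      by (intro Ck_on_mult Suc Ck_on_const open_UNIV)
  qed simp
qed

text \<open>With \<open>P t = (max 0 t)\<^sup>k\<^sup>+\<^sup>1\<close> and \<open>w = P (2 - |x - a|\<^sup>2 / r\<^sup>2)\<close>, the plateau function is \<open>1 - P (1 - w)\<close>.\<close>

lemma Ck_bump:
  fixes a :: "'a::euclidean_space"
  assumes "R > 0"
  obtains \<phi> :: "'a \<Rightarrow> real" and r where "r > 0" "r < R" "\<And>S. open S \<Longrightarrow> Ck_on k \<phi> S" "\<And>x. x \<in> ball a r \<Longrightarrow> \<phi> x = 1"
    "\<And>x. x \<notin> cball a R \<Longrightarrow> \<phi> x = 0"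
proof -
  define P where "P t = max 0 t ^ Suc k" for t :: real
  \<comment> \<open>The function \<open>q\<close> is at least 1 where the distance to
    \<open>a\<close> is at most \<open>r\<close>, and at most 0 once its square reaches twice that
    of \<open>r\<close>; distance \<open>2 * r = R\<close> is safely beyond.\<close>
  define r where "r = R / 2"
  have r: "r > 0" "r < R" using assms by (auto simp: r_def)
  define q where "q x = 2 - (1 / r\<^sup>2) * ((x - a) \<bullet> (x - a))" for x
  define \<phi> where "\<phi> x = 1 - P (1 - P (q x))" for x
  have P: "Ck_on k P UNIV" using Ck_on_max_power[of k] by (simp add: P_def[abs_def])
  have lin: "Ck_on k (\<lambda>x. (x - a) \<bullet> b) UNIV" for b
    using Ck_on_diff[OF open_UNIV Ck_on_bounded_linear[OF bounded_linear_inner_left open_UNIV] Ck_on_const]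
    by (simp add: inner_diff_left)
  have q: "Ck_on k q UNIV"
    unfolding q_def euclidean_inner[of "_ - a" "_ - a"]
    by (intro Ck_on_diff Ck_on_mult Ck_on_sum Ck_on_const open_UNIV lin)
  have "Ck_on k \<phi> UNIV"
    unfolding \<phi>_def
    by (intro Ck_on_diff Ck_on_const open_UNIV Ck_on_compose_real[OF open_UNIV open_UNIV _ P] q) auto
  then have 1: "Ck_on k \<phi> S" for S using Ck_on_subset by blast
  have 2: "\<phi> x = 1" if "x \<in> ball a r" for x
  proof -
    have "norm (x - a) < r" using that by (simp add: dist_norm norm_minus_commute)
    then have "(x - a) \<bullet> (x - a) \<le> r\<^sup>2" by (simp add: dot_square_norm power_mono)
    then have "q x \<ge> 1" using r by (simp add: q_def)
    then have "P (q x) \<ge> 1" unfolding P_def by (metis max.absorb2 one_le_power order_trans zero_le_one)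
    then show ?thesis by (simp add: \<phi>_def P_def max_def)
  qed
  have 3: "\<phi> x = 0" if "x \<notin> cball a R" for x
  proof -
    have "norm (x - a) > 2 * r" using that by (simp add: dist_norm norm_minus_commute r_def)
    then have "(2 * r)\<^sup>2 \<le> (norm (x - a))\<^sup>2" using r by (intro power_mono) auto
    then have "(x - a) \<bullet> (x - a) \<ge> 4 * r\<^sup>2" by (simp add: dot_square_norm power_mult_distrib)
    moreover have "r\<^sup>2 > 0" using r by simp
    ultimately have "2 * r\<^sup>2 \<le> (x - a) \<bullet> (x - a)" by linarith
    then have "q x \<le> 0" using r unfolding q_def by (simp add: field_simps)
    then have "P (q x) = 0" by (simp add: P_def)
    moreover have "P 1 = 1" by (simp add: P_def)
    ultimately show ?thesis by (simp add: \<phi>_def)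
  qed
  show thesis using that[of r \<phi>] r 1 2 3 by blast
qed

text \<open>In finite dimensions, continuity of the derivative in each fixed direction is continuity
  in operator norm, the form in which the theorem on flat systems takes the derivative of its
  coefficient.\<close>

lemma Ck_on_1_blinfun:
  fixes f :: "'a::euclidean_space \<Rightarrow> 'b::euclidean_space"
  assumes "Ck_on 1 f S"
  obtains f' where "\<And>x. x \<in> S \<Longrightarrow> (f has_derivative blinfun_apply (f' x)) (at x)" "continuous_on S f'"
proof -
  define f' where "f' x = Blinfun (frechet_derivative f (at x))" for x
  have d: "(f has_derivative frechet_derivative f (at x)) (at x)" if "x \<in> S" for x
    using Ck_on_has_derivative[of 0 f S x] assms that by simp
  have a: "blinfun_apply (f' x) = frechet_derivative f (at x)" if "x \<in> S" for x
    unfolding f'_def using bounded_linear_Blinfun_apply has_derivative_bounded_linear[OF d[OF that]] by blast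
  have "continuous_on S f'"
  proof (rule continuous_on_blinfun_componentwise)
    fix i :: 'a
    have "continuous_on S (\<lambda>x. frechet_derivative f (at x) i)" using assms by simp
    then show "continuous_on S (\<lambda>x. blinfun_apply (f' x) i)" using a by (simp cong: continuous_on_cong)
  qed
  then show thesis using that a d by metis
qed

text \<open>The second difference of \<open>f\<close> over a small parallelogram is symmetric in
  \<open>v\<close> and \<open>w\<close>. Two applications of the mean value theorem express it by
  either mixed derivative at some nearby point, and continuity transfers the equality to
  \<open>x\<close>.\<close>

lemma frechet_derivative_symmetric:
  fixes f :: "'a::euclidean_space \<Rightarrow> real"
  assumes S: "open S" "x \<in> S" and f: "Ck_on 2 f S"
  shows "frechet_derivative (\<lambda>y. frechet_derivative f (at y) v) (at x) w
       = frechet_derivative (\<lambda>y. frechet_derivative f (at y) w) (at x) v"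
proof -
  define D where "D v y = frechet_derivative f (at y) v" for v y
  define DD where "DD v w y = frechet_derivative (D v) (at y) w" for v w y
  have f2: "Ck_on (Suc (Suc 0)) f S" using f by (simp add: numeral_2_eq_2)
  have D: "Ck_on (Suc 0) (D v) S" for v using Ck_on_frechet_derivative[OF f2] by (simp add: D_def[abs_def])
  have DD: "continuous_on S (DD v w)" for v w using Ck_on_frechet_derivative[OF D] by (simp add: DD_def[abs_def])
  have df: "((\<lambda>t. f (z + t *\<^sub>R v)) has_real_derivative D v (z + t *\<^sub>R v)) (at t)" if "z + t *\<^sub>R v \<in> S" for z v t
  proof -
    have "((\<lambda>t. z + t *\<^sub>R v) has_derivative (\<lambda>h. h *\<^sub>R v)) (at t)"
      by (auto intro!: derivative_eq_intros)
    from has_derivative_compose[OF this Ck_on_has_derivative[OF f2 that]]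
    moreover have "linear (frechet_derivative f (at (z + t *\<^sub>R v)))"
      using linear_frechet_derivative f2 that by auto
    ultimately show ?thesis
      unfolding D_def by (intro has_derivative_imp_has_field_derivative) (simp_all add: linear_scale)
  qed
  have dD: "((\<lambda>t. D u (z + t *\<^sub>R v)) has_real_derivative DD u v (z + t *\<^sub>R v)) (at t)" if "z + t *\<^sub>R v \<in> S" for z v t u
  proof -
    have "((\<lambda>t. z + t *\<^sub>R v) has_derivative (\<lambda>h. h *\<^sub>R v)) (at t)"
      by (auto intro!: derivative_eq_intros)
    from has_derivative_compose[OF this Ck_on_has_derivative[OF D[of u] that]]
    moreover have "linear (frechet_derivative (D u) (at (z + t *\<^sub>R v)))"
      using linear_frechet_derivative[of "D u"] D[of u] that by auto
    ultimately show ?thesis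
      unfolding DD_def by (intro has_derivative_imp_has_field_derivative) (simp_all add: linear_scale)
  qed
  obtain \<epsilon> where \<epsilon>: "\<epsilon> > 0" "ball x \<epsilon> \<subseteq> S" using S openE by blast
  have second_difference: "\<exists>y\<in>ball x \<eta>. f (x + h *\<^sub>R v + h *\<^sub>R w) - f (x + h *\<^sub>R v) - f (x + h *\<^sub>R w) + f x = h * (h * DD v w y)"
    if h: "h > 0" "h * (norm v + norm w) < \<eta>" and "\<eta> \<le> \<epsilon>" for h \<eta> v w
  proof -
    have near: "x + s *\<^sub>R v + t *\<^sub>R w \<in> ball x \<eta>" if "0 \<le> s" "s \<le> h" "0 \<le> t" "t \<le> h" for s t
    proof -
      have "norm (s *\<^sub>R v + t *\<^sub>R w) \<le> s * norm v + t * norm w"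
        using norm_triangle_ineq[of "s *\<^sub>R v" "t *\<^sub>R w"] that by simp
      also have "\<dots> \<le> h * norm v + h * norm w" using that by (intro add_mono mult_right_mono) auto
      also have "\<dots> < \<eta>" using h(2) by (simp add: distrib_left)
      finally have "dist (x + 0) (x + (s *\<^sub>R v + t *\<^sub>R w)) < \<eta>" unfolding dist_add_cancel by simp
      then show ?thesis by (simp add: add.assoc)
    qed
    then have inS: "x + s *\<^sub>R v + t *\<^sub>R w \<in> S" if "0 \<le> s" "s \<le> h" "0 \<le> t" "t \<le> h" for s t
      using that \<epsilon>(2) \<open>\<eta> \<le> \<epsilon>\<close> by (meson subset_ball subsetD)
    \<comment> \<open>The difference in the direction \<open>w\<close> as a function of the step in
      the direction \<open>v\<close>, so that \<open>F h - F 0\<close> is the second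
      difference.\<close>
    define F where "F s = f (x + h *\<^sub>R w + s *\<^sub>R v) - f (x + s *\<^sub>R v)" for s
    have "\<exists>s>0. s < h \<and> F h - F 0 = (h - 0) * (D v (x + h *\<^sub>R w + s *\<^sub>R v) - D v (x + s *\<^sub>R v))"
      unfolding F_def
      by (rule MVT2[OF h(1)], intro DERIV_diff df)
        (use inS[of _ h] inS[of _ 0] h in \<open>auto simp: algebra_simps\<close>)
    then obtain s where s: "s > 0" "s < h" "F h - F 0 = h * (D v (x + h *\<^sub>R w + s *\<^sub>R v) - D v (x + s *\<^sub>R v))" by auto
    have "\<exists>t>0. t < h \<and> D v (x + s *\<^sub>R v + h *\<^sub>R w) - D v (x + s *\<^sub>R v + 0 *\<^sub>R w) = (h - 0) * DD v w (x + s *\<^sub>R v + t *\<^sub>R w)"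
      by (rule MVT2[OF h(1)], intro dD) (use inS[of s] s h in auto)
    then obtain t where t: "t > 0" "t < h" "D v (x + s *\<^sub>R v + h *\<^sub>R w) - D v (x + s *\<^sub>R v) = h * DD v w (x + s *\<^sub>R v + t *\<^sub>R w)"
      by auto
    have e: "x + h *\<^sub>R w + s *\<^sub>R v = x + s *\<^sub>R v + h *\<^sub>R w" "x + h *\<^sub>R w + h *\<^sub>R v = x + h *\<^sub>R v + h *\<^sub>R w" by (auto simp: algebra_simps)
    have "F h - F 0 = h * (h * DD v w (x + s *\<^sub>R v + t *\<^sub>R w))" using s(3) t(3) by (simp only: e(1))
    then show ?thesis using near[of s t] s t e(2) by (intro bexI[of _ "x + s *\<^sub>R v + t *\<^sub>R w"]) (simp_all add: F_def)
  qed
  show ?thesis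
  proof (rule ccontr)
    assume "\<not> ?thesis"
    then have ne: "DD v w x \<noteq> DD w v x" by (simp add: DD_def D_def[abs_def])
    \<comment> \<open>Half the gap: values within \<open>e\<close> of the two mixed derivatives
      cannot coincide.\<close>
    define e where "e = \<bar>DD v w x - DD w v x\<bar> / 2"
    have "e > 0" using ne by (simp add: e_def)
    have "isCont (DD v w) x" "isCont (DD w v) x" using DD S continuous_on_eq_continuous_at by blast+
    then obtain d1 d2 where d: "d1 > 0" "\<And>y. dist y x < d1 \<Longrightarrow> dist (DD v w y) (DD v w x) < e"
        "d2 > 0" "\<And>y. dist y x < d2 \<Longrightarrow> dist (DD w v y) (DD w v x) < e"
      using \<open>e > 0\<close> unfolding continuous_at_eps_delta by metis
    define \<eta> where "\<eta> = Min {\<epsilon>, d1, d2}"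
    have \<eta>: "\<eta> > 0" "\<eta> \<le> \<epsilon>" "\<eta> \<le> d1" "\<eta> \<le> d2" using \<epsilon> d by (auto simp: \<eta>_def)
    \<comment> \<open>The summand 1 keeps the denominator positive even for \<open>v = w = 0\<close>
      and makes the bound for \<open>h * (norm v + norm w)\<close> strict.\<close>
    define h where "h = \<eta> / (norm v + norm w + 1)"
    have nn: "norm v + norm w + 1 > 0" by (smt (verit) norm_ge_zero)
    have h: "h > 0" "h * (norm v + norm w) < \<eta>" "h * (norm w + norm v) < \<eta>" using \<eta>(1) nn by (auto simp: h_def field_simps)
    obtain y z where y: "y \<in> ball x \<eta>" "f (x + h *\<^sub>R v + h *\<^sub>R w) - f (x + h *\<^sub>R v) - f (x + h *\<^sub>R w) + f x = h * (h * DD v w y)"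
      and z: "z \<in> ball x \<eta>" "f (x + h *\<^sub>R w + h *\<^sub>R v) - f (x + h *\<^sub>R w) - f (x + h *\<^sub>R v) + f x = h * (h * DD w v z)"
      using second_difference[OF h(1,2) \<eta>(2)] second_difference[OF h(1,3) \<eta>(2)] by blast
    have e': "x + h *\<^sub>R w + h *\<^sub>R v = x + h *\<^sub>R v + h *\<^sub>R w" by (simp add: algebra_simps)
    have "h * (h * DD v w y) = h * (h * DD w v z)" using y(2) z(2) unfolding e' by linarith
    then have "DD v w y = DD w v z" using h by simp
    moreover have "dist (DD v w y) (DD v w x) < e" "dist (DD w v z) (DD w v x) < e"
      using d(2)[of y] d(4)[of z] y(1) z(1) \<eta> by (auto simp: dist_commute[of x])
    ultimately show False by (auto simp: dist_real_def e_def abs_if split: if_splits)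
  qed
qed

section \<open>Flat total differential equations\<close>

text \<open>Differentiation under the integral sign. Continuity is asked for each direction
  separately, which in finite dimensions is the joint norm continuity that the Leibniz rule
  requires.\<close>

lemma has_derivative_integral:
  fixes f :: "'a::euclidean_space \<Rightarrow> real \<Rightarrow> 'b::euclidean_space"
  assumes "open U" "convex U" "x \<in> U"
    and d: "\<And>x t. x \<in> U \<Longrightarrow> t \<in> {0..1} \<Longrightarrow> ((\<lambda>x. f x t) has_derivative f' x t) (at x)"
    and c: "\<And>v. continuous_on (U \<times> {0..1}) (\<lambda>(x, t). f' x t v)"
    and i: "\<And>x. x \<in> U \<Longrightarrow> continuous_on {0..1} (f x)"
  shows "((\<lambda>x. integral {0..1} (f x)) has_derivative (\<lambda>v. integral {0..1} (\<lambda>t. f' x t v))) (at x)"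
proof -
  define F where "F x t = Blinfun (f' x t)" for x t
  have F: "blinfun_apply (F x t) = f' x t" if "x \<in> U" "t \<in> {0..1}" for x t
    unfolding F_def using d[OF that] by (simp add: bounded_linear_Blinfun_apply has_derivative_bounded_linear)
  have cF: "continuous_on (U \<times> {0..1}) (\<lambda>(x, t). F x t)"
  proof (rule continuous_on_blinfun_componentwise)
    show "continuous_on (U \<times> {0..1}) (\<lambda>y. blinfun_apply (case y of (x, t) \<Rightarrow> F x t) j)" for j
      by (rule continuous_on_eq[OF c[of j]]) (auto simp: F)
  qed
  have "((\<lambda>x. integral (cbox 0 1) (f x)) has_derivative blinfun_apply (integral (cbox 0 1) (F x))) (at x within U)"
  proof (rule leibniz_rule)
    show "((\<lambda>x. f x t) has_derivative blinfun_apply (F x t)) (at x within U)" if "x \<in> U" "t \<in> cbox 0 1" for x t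
      using d[of x t] that by (simp add: F has_derivative_at_withinI)
    show "f x integrable_on cbox 0 1" if "x \<in> U" for x
      using integrable_continuous_real[OF i[OF that]] by simp
  qed (use cF assms in auto)
  moreover have "blinfun_apply (integral (cbox 0 1) (F x)) v = integral {0..1} (\<lambda>t. f' x t v)" for v
  proof -
    have "continuous_on {0..1} (\<lambda>t. (\<lambda>(x, t). F x t) (x, t))"
      by (rule continuous_on_compose2[OF cF]) (use \<open>x \<in> U\<close> in \<open>auto intro!: continuous_intros\<close>)
    then have "F x integrable_on cbox 0 1" by (simp add: integrable_continuous_real)
    then have "blinfun_apply (integral (cbox 0 1) (F x)) v = integral (cbox 0 1) (\<lambda>t. blinfun_apply (F x t) v)"
      by (rule blinfun_apply_integral)
    also have "\<dots> = integral (cbox 0 1) (\<lambda>t. f' x t v)"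
      using F \<open>x \<in> U\<close> by (intro integral_cong) auto
    finally show ?thesis by simp
  qed
  then have "blinfun_apply (integral (cbox 0 1) (F x)) = (\<lambda>v. integral {0..1} (\<lambda>t. f' x t v))" by blast
  ultimately show ?thesis using at_within_open[OF \<open>x \<in> U\<close> \<open>open U\<close>] by simp
qed

lemma continuous_on_integral_param:
  fixes f :: "'a::topological_space \<Rightarrow> real \<Rightarrow> 'b::banach"
  assumes "continuous_on (U \<times> {0..1}) (\<lambda>(x, t). f x t)"
  shows "continuous_on U (\<lambda>x. integral {0..1} (f x))"
  using integral_continuous_on_param[of U 0 1 f] assms by simp

text \<open>
  The unknown is the limit \<open>y\<close> of the Picard iteration, started at the zero function,
  \<open>y\<^bsub>n+1\<^esub>(x) = y0 - \<integral>\<^sub>0\<^sup>1 G(tx)(x) y\<^sub>n(tx) dt\<close> along rays.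
  With \<open>U\<^sub>n v = Dy\<^bsub>n+1\<^esub> v + G v y\<^sub>n\<close> and \<open>d\<^sub>n = y\<^sub>n - y\<^bsub>n-1\<^esub>\<close>, integration by parts and flatness give
  \<open>U\<^sub>n(x) v = - \<integral>\<^sub>0\<^sup>1 t (G x G v d\<^sub>n - G v G x d\<^sub>n + G x U\<^bsub>n-1\<^esub> v - G v U\<^bsub>n-1\<^esub> x) dt\<close>
  (everything under the integral at \<open>tx\<close>), so that \<open>U\<^sub>n\<close> tends to \<open>0\<close> uniformly on a small ball
  and the derivatives \<open>Dy\<^sub>n v\<close> converge to \<open>- G v y\<close>.
\<close>

theorem flat_total_differential_equation_at_0:
  fixes G :: "'a::euclidean_space \<Rightarrow> 'a \<Rightarrow>\<^sub>L 'b::euclidean_space \<Rightarrow>\<^sub>L 'b"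
  assumes R: "R > 0"
    and dG: "\<And>x. x \<in> ball 0 R \<Longrightarrow> (G has_derivative blinfun_apply (G' x)) (at x)"
    and cG': "continuous_on (ball 0 R) G'"
    and flat: "\<And>x v w z. x \<in> ball 0 R \<Longrightarrow> G' x v w z - G' x w v z + G x v (G x w z) - G x w (G x v z) = 0"
  shows "\<exists>r>0. r \<le> R \<and> (\<exists>y. y 0 = y0 \<and> (\<forall>x\<in>ball 0 r. (y has_derivative (\<lambda>v. - G x v (y x))) (at x)))"
proof -
  have contG: "continuous_on (ball 0 R) G"
    using dG by (meson continuous_at_imp_continuous_on has_derivative_continuous)
  \<comment> \<open>Continuity at 0 with tolerance 1 makes this a bound for
    \<open>norm (G x)\<close> near 0.\<close>
  define K where "K = norm (G 0) + 1"
  have "K > 0" by (simp add: K_def add_nonneg_pos)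
  have "isCont G 0" using contG R by (simp add: continuous_on_eq_continuous_at)
  then obtain r0 where r0: "r0 > 0" "\<And>x. dist x 0 < r0 \<Longrightarrow> dist (G x) (G 0) < 1"
    unfolding continuous_at_eps_delta by (metis zero_less_one)
  \<comment> \<open>Forces \<open>K * norm x \<le> 1/4\<close> on the ball, so that one Picard step
    along a ray contracts by the factor 1/4.\<close>
  define r where "r = min (min r0 R) (1 / (4 * K))"
  have r: "r > 0" "r \<le> R" "r \<le> r0"
    using \<open>K > 0\<close> R r0 by (auto simp: r_def)
  have Kr: "K * r \<le> 1/4"
    using mult_left_mono[of r "1 / (4 * K)" K] \<open>K > 0\<close> by (simp add: r_def)
  have GK: "norm (G x) \<le> K" if "x \<in> ball 0 r" for x
    using r0(2)[of x] that r norm_triangle_sub[of "G x" "G 0"] by (simp add: K_def dist_norm)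
  have GKv: "norm (G x v z) \<le> K * norm v * norm z" if "x \<in> ball 0 r" for x v z
  proof -
    have "norm (G x v z) \<le> norm (G x v) * norm z" by (rule norm_blinfun)
    also have "\<dots> \<le> (norm (G x) * norm v) * norm z" by (intro mult_right_mono norm_blinfun) auto
    also have "\<dots> \<le> K * norm v * norm z" by (intro mult_right_mono GK that) auto
    finally show ?thesis .
  qed
  have GKx: "norm (G (t *\<^sub>R x) x z) \<le> 1/4 * norm z" if "x \<in> ball 0 r" "t *\<^sub>R x \<in> ball 0 r" for t x z
  proof -
    have "norm (G (t *\<^sub>R x) x z) \<le> K * norm x * norm z" by (rule GKv[OF that(2)])
    also have "\<dots> \<le> 1/4 * norm z"
    proof (intro mult_right_mono)
      have "K * norm x \<le> K * r" using that(1) \<open>K > 0\<close> by (intro mult_left_mono) auto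
      then show "K * norm x \<le> 1/4" using Kr by linarith
    qed auto
    finally show ?thesis .
  qed
  have tx: "t *\<^sub>R x \<in> ball 0 r" if "x \<in> ball 0 r" "t \<in> {0..1}" for t and x :: 'a
    using that mult_left_le_one_le[of "norm x" "\<bar>t\<bar>"] by auto
  have contG: "continuous_on (ball 0 r) G" and contG': "continuous_on (ball 0 r) G'"
    using contG cG' r continuous_on_subset subset_ball by blast+
  have dG: "(G has_derivative blinfun_apply (G' x)) (at x)" if "x \<in> ball 0 r" for x
    using dG that r by auto

  define y where "y = rec_nat (\<lambda>_. 0) (\<lambda>n f x. y0 - integral {0..1} (\<lambda>t. G (t *\<^sub>R x) x (f (t *\<^sub>R x))))"
  have y_0: "y 0 x = 0" and y_Suc: "y (Suc n) x = y0 - integral {0..1} (\<lambda>t. G (t *\<^sub>R x) x (y n (t *\<^sub>R x)))" for n x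
    by (simp_all add: y_def)
  \<comment> \<open>The derivative in the direction \<open>v\<close> of the integrand of a Picard
    step, by the product rule: \<open>f'\<close> stands for the derivative of \<open>f\<close>, and
    the factors \<open>t\<close> come from differentiating through
    \<open>t *\<^sub>R x\<close>.\<close>
  define I where "I f f' x t v = t *\<^sub>R G' (t *\<^sub>R x) v x (f (t *\<^sub>R x)) + G (t *\<^sub>R x) v (f (t *\<^sub>R x))
      + t *\<^sub>R G (t *\<^sub>R x) x (f' (t *\<^sub>R x) v)" for f :: "'a \<Rightarrow> 'b" and f' :: "'a \<Rightarrow> 'a \<Rightarrow> 'b" and x t v
  \<comment> \<open>A recursion for the derivatives parallel to that for \<open>y\<close>;
    \<open>dy\<close> identifies the two, and the explicit integrals are what the estimates work
    on.\<close>
  define y' where "y' = rec_nat (\<lambda>_ _. 0) (\<lambda>n f' x v. - integral {0..1} (\<lambda>t. I (y n) f' x t v))"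
  have y'_0: "y' 0 x v = 0" and y'_Suc: "y' (Suc n) x v = - integral {0..1} (\<lambda>t. I (y n) (y' n) x t v)" for n x v
    by (simp_all add: y'_def)

  have comp: "continuous_on (ball 0 r \<times> {0..1}) (\<lambda>p. h (snd p *\<^sub>R fst p))" if "continuous_on (ball 0 r) h" 
    for h :: "'a \<Rightarrow> 'c::topological_space"
  proof (rule continuous_on_compose2[OF that])
    show "(\<lambda>p. snd p *\<^sub>R fst p) ` (ball 0 r \<times> {0..1}) \<subseteq> ball (0::'a) r"
      using tx by fastforce
  qed (intro continuous_intros)
  have comp1: "continuous_on {0..1} (\<lambda>t. h (t *\<^sub>R x))" if "continuous_on (ball 0 r) h" "x \<in> ball 0 r"
    for h :: "'a \<Rightarrow> 'c::topological_space" and x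
    by (rule continuous_on_compose2[OF that(1)]) (use tx[OF that(2)] in \<open>auto intro!: continuous_intros simp del: mem_ball\<close>)

  have I_cont: "continuous_on (ball 0 r \<times> {0..1}) (\<lambda>(x, t). I f f' x t v)"
    if "continuous_on (ball 0 r) f" "continuous_on (ball 0 r) (\<lambda>x. f' x v)" for f f' v
    unfolding I_def case_prod_unfold by (intro continuous_intros comp[OF that(1)] comp[OF that(2)] comp[OF contG] comp[OF contG'])
  have dy: "(\<forall>x\<in>ball 0 r. (y n has_derivative y' n x) (at x)) \<and> (\<forall>v. continuous_on (ball 0 r) (\<lambda>x. y' n x v))" for n
  proof (induction n)
    case 0
    have "y 0 = (\<lambda>_. 0)" "y' 0 = (\<lambda>_ _. 0)" by (simp_all add: fun_eq_iff y_0 y'_0)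
    then show ?case by simp
  next
    case (Suc n)
    have cy: "continuous_on (ball 0 r) (y n)"
      using Suc by (meson continuous_at_imp_continuous_on has_derivative_continuous)
    have Ic: "continuous_on (ball 0 r \<times> {0..1}) (\<lambda>(x, t). I (y n) (y' n) x t v)" for v
      using I_cont[OF cy] Suc by blast
    have "((\<lambda>x. integral {0..1} (\<lambda>t. G (t *\<^sub>R x) x (y n (t *\<^sub>R x)))) has_derivative
        (\<lambda>v. integral {0..1} (\<lambda>t. I (y n) (y' n) x t v))) (at x)" if x: "x \<in> ball 0 r" for x
    proof (rule has_derivative_integral[OF open_ball convex_ball x _ Ic])
      fix x :: 'a and t :: real assume *: "x \<in> ball 0 r" "t \<in> {0..1}"
      have s: "((\<lambda>x. t *\<^sub>R x) has_derivative (\<lambda>v. t *\<^sub>R v)) (at x)" by (auto intro!: derivative_eq_intros)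
      have g: "((\<lambda>x. G (t *\<^sub>R x)) has_derivative (\<lambda>v. G' (t *\<^sub>R x) (t *\<^sub>R v))) (at x)"
        by (rule has_derivative_compose[OF s dG[OF tx[OF *]]])
      have yy: "((\<lambda>x. y n (t *\<^sub>R x)) has_derivative (\<lambda>v. y' n (t *\<^sub>R x) (t *\<^sub>R v))) (at x)"
        by (rule has_derivative_compose[OF s]) (use Suc tx[OF *] in blast)
      have lin: "y' n (t *\<^sub>R x) (t *\<^sub>R v) = t *\<^sub>R y' n (t *\<^sub>R x) v" for v
        using Suc tx[OF *] by (meson has_derivative_linear linear_scale)
      note gx = bounded_bilinear.FDERIV[OF bounded_bilinear_blinfun_apply g has_derivative_ident]
      show "((\<lambda>x. G (t *\<^sub>R x) x (y n (t *\<^sub>R x))) has_derivative I (y n) (y' n) x t) (at x)"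
        by (rule has_derivative_eq_rhs[OF bounded_bilinear.FDERIV[OF bounded_bilinear_blinfun_apply gx yy]])
          (simp add: fun_eq_iff I_def lin blinfun.add_left blinfun.add_right blinfun.scaleR_right blinfun.scaleR_left)
    next
      show "continuous_on {0..1} (\<lambda>t. G (t *\<^sub>R x) x (y n (t *\<^sub>R x)))" if "x \<in> ball 0 r" for x
        by (intro continuous_intros comp1[OF contG that] comp1[OF cy that])
    qed
    then have "(y (Suc n) has_derivative y' (Suc n) x) (at x)" if "x \<in> ball 0 r" for x
      using that unfolding y_Suc[abs_def] y'_Suc[abs_def] by (auto intro!: derivative_eq_intros)
    moreover have "continuous_on (ball 0 r) (\<lambda>x. y' (Suc n) x v)" for v
      unfolding y'_Suc by (intro continuous_intros continuous_on_integral_param Ic)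
    ultimately show ?case by blast
  qed
  have cy: "continuous_on (ball 0 r) (y n)" for n
    using dy by (meson continuous_at_imp_continuous_on has_derivative_continuous)
  have cy': "continuous_on (ball 0 r) (\<lambda>x. y' n x v)" for n v using dy by blast
  have lin: "linear (y' n x)" if "x \<in> ball 0 r" for n x using dy that has_derivative_linear by blast

  define U where "U n x v = y' (Suc n) x v + G x v (y n x)" for n x v
  have lin_U: "U n x (c *\<^sub>R v) = c *\<^sub>R U n x v" if "x \<in> ball 0 r" for n x c v
    unfolding U_def using lin[OF that] by (simp add: linear_scale blinfun.scaleR_right blinfun.scaleR_left scaleR_add_right)

  \<comment> \<open>The integrand is the derivative in \<open>t\<close> of
    \<open>t *\<^sub>R G (t *\<^sub>R x) v (y n (t *\<^sub>R x))\<close>. The factor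
    \<open>t\<close> removes the boundary term at 0, so \<open>G x v (y n x)\<close> can be brought
    under the same integral as \<open>y'\<close>.\<close>
  have ibp: "G x v (y n x) = integral {0..1} (\<lambda>t. G (t *\<^sub>R x) v (y n (t *\<^sub>R x)) + t *\<^sub>R G' (t *\<^sub>R x) x v (y n (t *\<^sub>R x))
      + t *\<^sub>R G (t *\<^sub>R x) v (y' n (t *\<^sub>R x) x))" if x: "x \<in> ball 0 r" for n x v
  proof -
    have "((\<lambda>t. G (t *\<^sub>R x) v (y n (t *\<^sub>R x)) + t *\<^sub>R G' (t *\<^sub>R x) x v (y n (t *\<^sub>R x))
      + t *\<^sub>R G (t *\<^sub>R x) v (y' n (t *\<^sub>R x) x)) has_integral (1 *\<^sub>R G (1 *\<^sub>R x) v (y n (1 *\<^sub>R x)) - 0 *\<^sub>R G (0 *\<^sub>R x) v (y n (0 *\<^sub>R x)))) {0..1}"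
    proof (rule fundamental_theorem_of_calculus)
      fix t :: real assume t: "t \<in> {0..1}"
      have s: "((\<lambda>t. t *\<^sub>R x) has_derivative (\<lambda>h. h *\<^sub>R x)) (at t)" by (auto intro!: derivative_eq_intros)
      have g: "((\<lambda>t. G (t *\<^sub>R x)) has_derivative (\<lambda>h. G' (t *\<^sub>R x) (h *\<^sub>R x))) (at t)"
        by (rule has_derivative_compose[OF s dG[OF tx[OF x t]]])
      have yy: "((\<lambda>t. y n (t *\<^sub>R x)) has_derivative (\<lambda>h. y' n (t *\<^sub>R x) (h *\<^sub>R x))) (at t)"
        by (rule has_derivative_compose[OF s]) (use dy tx[OF x t] in blast)
      note gx = bounded_bilinear.FDERIV[OF bounded_bilinear_blinfun_apply g has_derivative_const]
      note gy = bounded_bilinear.FDERIV[OF bounded_bilinear_blinfun_apply gx yy]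
      have "((\<lambda>t. t *\<^sub>R G (t *\<^sub>R x) v (y n (t *\<^sub>R x))) has_derivative
        (\<lambda>h. h *\<^sub>R (G (t *\<^sub>R x) v (y n (t *\<^sub>R x)) + t *\<^sub>R G' (t *\<^sub>R x) x v (y n (t *\<^sub>R x))
         + t *\<^sub>R G (t *\<^sub>R x) v (y' n (t *\<^sub>R x) x)))) (at t)"
        by (rule has_derivative_eq_rhs[OF has_derivative_scaleR[OF has_derivative_ident gy]])
          (simp add: fun_eq_iff linear_scale[OF lin[OF tx[OF x t]]] blinfun.scaleR_right blinfun.scaleR_left algebra_simps)
      then show "((\<lambda>t. t *\<^sub>R G (t *\<^sub>R x) v (y n (t *\<^sub>R x))) has_vector_derivative
        (G (t *\<^sub>R x) v (y n (t *\<^sub>R x)) + t *\<^sub>R G' (t *\<^sub>R x) x v (y n (t *\<^sub>R x))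
         + t *\<^sub>R G (t *\<^sub>R x) v (y' n (t *\<^sub>R x) x))) (at t within {0..1})"
        unfolding has_vector_derivative_def by (rule has_derivative_at_withinI)
    qed simp
    then show ?thesis by (simp add: integral_unique)
  qed
  define d where "d n x = y (Suc n) x - y n x" for n x
  have U_rec: "U (Suc n) x v = - integral {0..1} (\<lambda>t. t *\<^sub>R (G (t *\<^sub>R x) x (G (t *\<^sub>R x) v (d n (t *\<^sub>R x)))
      - G (t *\<^sub>R x) v (G (t *\<^sub>R x) x (d n (t *\<^sub>R x))) + G (t *\<^sub>R x) x (U n (t *\<^sub>R x) v) - G (t *\<^sub>R x) v (U n (t *\<^sub>R x) x)))"
    (is "_ = - integral _ ?J") if x: "x \<in> ball 0 r" for n x v
  proof -
    let ?m = "Suc n"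
    let ?B = "\<lambda>t. G (t *\<^sub>R x) v (y ?m (t *\<^sub>R x)) + t *\<^sub>R G' (t *\<^sub>R x) x v (y ?m (t *\<^sub>R x))
      + t *\<^sub>R G (t *\<^sub>R x) v (y' ?m (t *\<^sub>R x) x)"
    \<comment> \<open>Flatness trades the derivative of \<open>G\<close> with arguments
      \<open>v, x\<close> for the one with arguments \<open>x, v\<close>. These then cancel, and
      writing \<open>y'\<close> as \<open>U\<close> minus \<open>G y\<close> leaves only
      \<open>d\<close> and \<open>U\<close>, without any derivative of \<open>G\<close>.\<close>
    have eq: "I (y ?m) (y' ?m) x t v - ?B t = ?J t" if t: "t \<in> {0..1}" for t
    proof -
      have "t *\<^sub>R x \<in> ball 0 R" using tx[OF x t] r by auto
      then have f: "G' (t *\<^sub>R x) v x z = G' (t *\<^sub>R x) x v z - G (t *\<^sub>R x) v (G (t *\<^sub>R x) x z) + G (t *\<^sub>R x) x (G (t *\<^sub>R x) v z)" for z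
        using flat[of "t *\<^sub>R x" v x z] by (simp add: algebra_simps)
      have e: "y' ?m (t *\<^sub>R x) w = U n (t *\<^sub>R x) w - G (t *\<^sub>R x) w (y n (t *\<^sub>R x))" for w
        by (simp add: U_def)
      show ?thesis
        unfolding I_def f e d_def by (simp add: blinfun.diff_right algebra_simps)
    qed
    have ci: "(\<lambda>t. I (y ?m) (y' ?m) x t v) integrable_on {0..1}"
      unfolding I_def by (intro integrable_continuous_real continuous_intros comp1[OF contG x] comp1[OF contG' x] comp1[OF cy x] comp1[OF cy' x])
    have cB: "?B integrable_on {0..1}"
      by (intro integrable_continuous_real continuous_intros comp1[OF contG x] comp1[OF contG' x] comp1[OF cy x] comp1[OF cy' x])
    have "U ?m x v = - (integral {0..1} (\<lambda>t. I (y ?m) (y' ?m) x t v) - integral {0..1} ?B)"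
      unfolding U_def y'_Suc[of ?m] ibp[OF x] by simp
    also have "integral {0..1} (\<lambda>t. I (y ?m) (y' ?m) x t v) - integral {0..1} ?B = integral {0..1} (\<lambda>t. I (y ?m) (y' ?m) x t v - ?B t)"
      using integral_diff[OF ci cB] by simp
    also have "\<dots> = integral {0..1} ?J" by (rule integral_cong) (rule eq)
    finally show ?thesis .
  qed
  have integral_le: "norm (integral {0..1} f) \<le> C" if "continuous_on {0..1} f" "\<And>t. t \<in> {0..1} \<Longrightarrow> norm (f t) \<le> C"
    for f :: "real \<Rightarrow> 'b" and C
    using integral_bound[of 0 1 f C] that by auto
  \<comment> \<open>The induction starts with \<open>d 0 x = y0\<close>, since the iteration starts
    at zero; each step gains the factor 1/4 from \<open>GKx\<close>.\<close>
  have d_bound: "norm (d n x) \<le> norm y0 * (1/4)^n" if "x \<in> ball 0 r" for n x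
    using that
  proof (induction n arbitrary: x)
    case 0 then show ?case by (simp add: d_def y_0 y_Suc)
  next
    case (Suc n)
    have ii: "(\<lambda>t. G (t *\<^sub>R x) x (y m (t *\<^sub>R x))) integrable_on {0..1}" for m
      by (intro integrable_continuous_real continuous_intros comp1[OF contG Suc.prems] comp1[OF cy Suc.prems])
    have "d (Suc n) x = - (integral {0..1} (\<lambda>t. G (t *\<^sub>R x) x (y (Suc n) (t *\<^sub>R x))) - integral {0..1} (\<lambda>t. G (t *\<^sub>R x) x (y n (t *\<^sub>R x))))"
      unfolding d_def y_Suc[of "Suc n" x] y_Suc[of n x] by simp
    also have "\<dots> = - integral {0..1} (\<lambda>t. G (t *\<^sub>R x) x (d n (t *\<^sub>R x)))"
      unfolding integral_diff[OF ii ii, symmetric] by (simp add: d_def blinfun.diff_right)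
    finally have "norm (d (Suc n) x) = norm (integral {0..1} (\<lambda>t. G (t *\<^sub>R x) x (d n (t *\<^sub>R x))))" by simp
    also have "\<dots> \<le> norm y0 * (1/4)^Suc n"
    proof (rule integral_le)
      show "continuous_on {0..1} (\<lambda>t. G (t *\<^sub>R x) x (d n (t *\<^sub>R x)))"
        unfolding d_def by (intro continuous_intros comp1[OF contG Suc.prems] comp1[OF cy Suc.prems])
      show "norm (G (t *\<^sub>R x) x (d n (t *\<^sub>R x))) \<le> norm y0 * (1/4)^Suc n" if "t \<in> {0..1}" for t
        using GKx[OF Suc.prems tx[OF Suc.prems that], of "d n (t *\<^sub>R x)"] Suc.IH[OF tx[OF Suc.prems that]] by simp
    qed
    finally show ?case .
  qed
  \<comment> \<open>The factor 3 makes the source term coming from \<open>d\<close> at most a third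
    of the bound for \<open>U n\<close>. Both parts enter the recursion with factor 1/2, and 1/2 *
    1/3 + 1/2 = 2/3 stays below the ratio 3/4.\<close>
  define B where "B = 3 * K * norm y0"
  have "B \<ge> 0" using \<open>K > 0\<close> by (simp add: B_def)
  have U_bound: "norm (U n x v) \<le> B * (3/4)^n * norm v" if "x \<in> ball 0 r" for n x v
    using that
  proof (induction n arbitrary: x v)
    case 0
    have "U 0 x v = 0" by (simp add: U_def y_0 y'_0 y'_Suc I_def)
    then show ?case using \<open>B \<ge> 0\<close> by simp
  next
    case (Suc n)
    note x = Suc.prems
    have "norm (U (Suc n) x v) = norm (integral {0..1} (\<lambda>t. t *\<^sub>R (G (t *\<^sub>R x) x (G (t *\<^sub>R x) v (d n (t *\<^sub>R x)))
      - G (t *\<^sub>R x) v (G (t *\<^sub>R x) x (d n (t *\<^sub>R x))) + G (t *\<^sub>R x) x (U n (t *\<^sub>R x) v) - G (t *\<^sub>R x) v (U n (t *\<^sub>R x) x))))"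
      unfolding U_rec[OF x] by simp
    also have "\<dots> \<le> B * (3/4)^Suc n * norm v"
    proof (rule integral_le)
      show "continuous_on {0..1} (\<lambda>t. t *\<^sub>R (G (t *\<^sub>R x) x (G (t *\<^sub>R x) v (d n (t *\<^sub>R x)))
      - G (t *\<^sub>R x) v (G (t *\<^sub>R x) x (d n (t *\<^sub>R x))) + G (t *\<^sub>R x) x (U n (t *\<^sub>R x) v) - G (t *\<^sub>R x) v (U n (t *\<^sub>R x) x)))"
        unfolding d_def U_def
        by (intro continuous_intros comp1[OF contG x] comp1[OF cy x] comp1[OF cy' x])
      fix t :: real assume t: "t \<in> {0..1}"
      define p where "p = t *\<^sub>R x"
      have p: "p \<in> ball 0 r" unfolding p_def by (rule tx[OF x t])
      define q where "q = norm y0 * (1/4)^n"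
      have q: "norm (d n p) \<le> q" "q \<ge> 0" using d_bound[OF p] by (auto simp: q_def)
      have gx: "norm (G p x z) \<le> 1/4 * norm z" for z using GKx[OF x tx[OF x t]] by (simp add: p_def)
      have n1: "norm (G p x (G p v (d n p))) \<le> 1/4 * (K * norm v * q)"
      proof -
        have "K * norm v * norm (d n p) \<le> K * norm v * q" using q \<open>K > 0\<close> by (intro mult_left_mono) auto
        then show ?thesis using gx[of "G p v (d n p)"] GKv[OF p, of v "d n p"] by linarith
      qed
      have n2: "norm (G p v (G p x (d n p))) \<le> 1/4 * (K * norm v * q)"
      proof -
        have "norm (G p v (G p x (d n p))) \<le> K * norm v * norm (G p x (d n p))" by (rule GKv[OF p])
        also have "\<dots> \<le> K * norm v * (1/4 * q)"
          using gx[of "d n p"] q \<open>K > 0\<close> by (intro mult_left_mono) auto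
        finally show ?thesis by simp
      qed
      have n3: "norm (G p x (U n p v)) \<le> 1/4 * (B * (3/4)^n * norm v)"
        using gx[of "U n p v"] Suc.IH[OF p, of v] by simp
      have n4: "norm (G p v (U n p x)) \<le> 1/4 * (B * (3/4)^n * norm v)"
      proof -
        have "norm (G p v (U n p x)) \<le> K * norm v * norm (U n p x)" by (rule GKv[OF p])
        also have "\<dots> \<le> K * norm v * (B * (3/4)^n * r)"
          using Suc.IH[OF p, of x] x \<open>K > 0\<close> \<open>B \<ge> 0\<close>
            mult_left_mono[of "norm x" r "B * (3/4)^n"] by (intro mult_left_mono) auto
        also have "\<dots> = (K * r) * (B * (3/4)^n * norm v)" by simp
        also have "\<dots> \<le> 1/4 * (B * (3/4)^n * norm v)" using Kr \<open>B \<ge> 0\<close> by (intro mult_right_mono) auto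
        finally show ?thesis .
      qed
      let ?S = "G p x (G p v (d n p)) - G p v (G p x (d n p)) + G p x (U n p v) - G p v (U n p x)"
      have "norm (t *\<^sub>R ?S) \<le> norm ?S" using t mult_left_le_one_le[of "norm ?S" "\<bar>t\<bar>"] by simp
      also have "\<dots> \<le> norm (G p x (G p v (d n p))) + norm (G p v (G p x (d n p))) + norm (G p x (U n p v)) + norm (G p v (U n p x))"
        by (smt (verit) norm_triangle_ineq norm_triangle_ineq4)
      also have "\<dots> \<le> 1/2 * (K * norm v * q) + 1/2 * (B * (3/4)^n * norm v)" using n1 n2 n3 n4 by linarith
      also have "K * norm v * q \<le> 1/3 * (B * (3/4)^n * norm v)"
      proof -
        have "K * norm v * q = 1/3 * (B * (1/4)^n * norm v)" by (simp add: B_def q_def)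
        also have "\<dots> \<le> 1/3 * (B * (3/4)^n * norm v)"
          using \<open>B \<ge> 0\<close> by (intro mult_left_mono mult_right_mono power_mono) auto
        finally show ?thesis .
      qed
      also have "1/2 * (1/3 * (B * (3/4)^n * norm v)) + 1/2 * (B * (3/4)^n * norm v) \<le> B * (3/4)^Suc n * norm v"
        using \<open>B \<ge> 0\<close> by (simp add: field_simps)
      finally show "norm (t *\<^sub>R (G (t *\<^sub>R x) x (G (t *\<^sub>R x) v (d n (t *\<^sub>R x)))
      - G (t *\<^sub>R x) v (G (t *\<^sub>R x) x (d n (t *\<^sub>R x))) + G (t *\<^sub>R x) x (U n (t *\<^sub>R x) v) - G (t *\<^sub>R x) v (U n (t *\<^sub>R x) x))) \<le> B * (3/4)^Suc n * norm v"
        unfolding p_def by simp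
    qed
    finally show ?case .
  qed
  define Y where "Y x = (\<Sum>n. d n x)" for x
  have d_sum: "summable (\<lambda>n. d n x)" if "x \<in> ball 0 r" for x
    by (rule summable_comparison_test'[of "\<lambda>n. norm y0 * (1/4)^n" 0]) (use d_bound[OF that] in \<open>auto intro!: summable_mult summable_geometric\<close>)
  have y_sum: "y n x = (\<Sum>k<n. d k x)" for n x
    by (induction n) (auto simp: y_0 d_def)
  have y_lim: "(\<lambda>n. y n x) \<longlonglongrightarrow> Y x" if "x \<in> ball 0 r" for x
    unfolding y_sum Y_def using summable_LIMSEQ[OF d_sum[OF that]] .
  have Y_bound: "norm (Y x - y n x) \<le> 2 * norm y0 * (1/4)^n" if "x \<in> ball 0 r" for x n
  proof -
    have s: "summable (\<lambda>k. norm y0 * (1/4)^(k + n))"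
      by (auto simp: power_add intro!: summable_mult summable_mult2 summable_geometric)
    have "Y x - y n x = (\<Sum>k. d (k + n) x)"
      unfolding Y_def y_sum using suminf_minus_initial_segment[OF d_sum[OF that]] by simp
    also have "norm \<dots> \<le> (\<Sum>k. norm y0 * (1/4)^(k + n))"
      by (rule norm_suminf_le[OF _ s]) (rule d_bound[OF that])
    also have "\<dots> = norm y0 * (1/4)^n * (\<Sum>k. (1/4)^k)"
      by (subst suminf_mult[symmetric]) (auto simp: power_add mult_ac intro!: summable_geometric)
    also have "(\<Sum>k. (1/4::real)^k) = 4/3" by (subst suminf_geometric) auto
    finally have "norm (Y x - y n x) \<le> norm y0 * (1/4)^n * (4/3)" .
    also have "\<dots> \<le> 2 * norm y0 * (1/4)^n" by simp
    finally show ?thesis .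
  qed
  \<comment> \<open>Uniform convergence of the derivatives makes the limit differentiable. The
    sequence is shifted by one because \<open>U n\<close> compares \<open>G\<close> applied to
    \<open>y n\<close> with the derivative of the next iterate.\<close>
  have "\<exists>g. \<forall>x\<in>ball 0 r. (\<lambda>n. y (Suc n) x) \<longlonglongrightarrow> g x \<and> (g has_derivative (\<lambda>v. - G x v (Y x))) (at x within ball 0 r)"
  proof (rule has_derivative_sequence[where f' = "\<lambda>n. y' (Suc n)"])
    show "convex (ball (0::'a) r)" "(0::'a) \<in> ball 0 r" using r by auto
    show "(\<lambda>n. y (Suc n) 0) \<longlonglongrightarrow> Y 0" using LIMSEQ_Suc[OF y_lim[of 0]] r by simp
    show "(y (Suc n) has_derivative y' (Suc n) x) (at x within ball 0 r)" if "x \<in> ball 0 r" for n x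
      using dy that has_derivative_at_withinI by blast
    fix e :: real assume "e > 0"
    define C where "C n = B * (3/4)^n + K * (2 * norm y0 * (1/4)^n)" for n
    have "C \<longlonglongrightarrow> B * 0 + K * (2 * norm y0 * 0)"
      unfolding C_def by (intro tendsto_intros LIMSEQ_power_zero) auto
    then have "\<forall>\<^sub>F n in sequentially. C n < e" using \<open>e > 0\<close> by (simp add: order_tendstoD)
    then show "\<forall>\<^sub>F n in sequentially. \<forall>x\<in>ball 0 r. \<forall>v. norm (y' (Suc n) x v - - G x v (Y x)) \<le> e * norm v"
    proof (rule eventually_mono, intro ballI allI)
      fix n and x v :: 'a assume C: "C n < e" and x: "x \<in> ball 0 r"
      have "y' (Suc n) x v - - G x v (Y x) = U n x v + G x v (Y x - y n x)"
        by (simp add: U_def blinfun.diff_right)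
      then have "norm (y' (Suc n) x v - - G x v (Y x)) \<le> norm (U n x v) + norm (G x v (Y x - y n x))"
        using norm_triangle_ineq by simp
      also have "\<dots> \<le> B * (3/4)^n * norm v + K * norm v * (2 * norm y0 * (1/4)^n)"
      proof (rule add_mono[OF U_bound[OF x] order_trans[OF GKv[OF x]]])
        show "K * norm v * norm (Y x - y n x) \<le> K * norm v * (2 * norm y0 * (1/4)^n)"
          using \<open>K > 0\<close> by (intro mult_left_mono Y_bound x) auto
      qed
      also have "\<dots> = C n * norm v" by (simp add: C_def algebra_simps)
      also have "\<dots> \<le> e * norm v" using C by (intro mult_right_mono) auto
      finally show "norm (y' (Suc n) x v - - G x v (Y x)) \<le> e * norm v" .
    qed
  qed
  then obtain g where g: "\<And>x. x \<in> ball 0 r \<Longrightarrow> (\<lambda>n. y (Suc n) x) \<longlonglongrightarrow> g x"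
      "\<And>x. x \<in> ball 0 r \<Longrightarrow> (g has_derivative (\<lambda>v. - G x v (Y x))) (at x within ball 0 r)" by blast
  have gY: "g x = Y x" if "x \<in> ball 0 r" for x
    using LIMSEQ_unique[OF g(1)[OF that] LIMSEQ_Suc[OF y_lim[OF that]]] .
  have g0: "g 0 = y0"
  proof -
    have "(\<lambda>n. y (Suc n) 0) \<longlonglongrightarrow> y0" by (simp add: y_Suc)
    then show ?thesis using g(1)[of 0] r LIMSEQ_unique by fastforce
  qed
  have "(g has_derivative (\<lambda>v. - G x v (g x))) (at x)" if "x \<in> ball 0 r" for x
    using g(2)[OF that] that gY[OF that] at_within_open[OF that open_ball] by simp
  then show ?thesis using r g0 by blast
qed

text \<open>The case of a general centre \<open>a\<close>, by translation.\<close>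

theorem flat_total_differential_equation:
  fixes G :: "'a::euclidean_space \<Rightarrow> 'a \<Rightarrow>\<^sub>L 'b::euclidean_space \<Rightarrow>\<^sub>L 'b"
  assumes "open S" "a \<in> S"
    and dG: "\<And>x. x \<in> S \<Longrightarrow> (G has_derivative blinfun_apply (G' x)) (at x)"
    and cG': "continuous_on S G'"
    and flat: "\<And>x v w z. x \<in> S \<Longrightarrow> G' x v w z - G' x w v z + G x v (G x w z) - G x w (G x v z) = 0"
  obtains r y where "r > 0" "ball a r \<subseteq> S" "y a = y0"
    "\<And>x. x \<in> ball a r \<Longrightarrow> (y has_derivative (\<lambda>v. - G x v (y x))) (at x)"
proof -
  obtain R where R: "R > 0" "ball a R \<subseteq> S" using assms(1,2) openE by blast
  have S: "a + x \<in> S" if "x \<in> ball 0 R" for x using that subsetD[OF R(2), of "a + x"] by (simp add: dist_norm)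
  have "\<exists>r>0. r \<le> R \<and> (\<exists>y. y 0 = y0 \<and> (\<forall>x\<in>ball 0 r. (y has_derivative (\<lambda>v. - G (a + x) v (y x))) (at x)))"
  proof (rule flat_total_differential_equation_at_0[OF R(1), where G' = "\<lambda>x. G' (a + x)"])
    show "((\<lambda>x. G (a + x)) has_derivative blinfun_apply (G' (a + x))) (at x)" if "x \<in> ball 0 R" for x
    proof -
      have "((\<lambda>x. a + x) has_derivative (\<lambda>v. v)) (at x)" by (auto intro!: derivative_eq_intros)
      from has_derivative_compose[OF this dG[OF S[OF that]]] show ?thesis .
    qed
    show "continuous_on (ball 0 R) (\<lambda>x. G' (a + x))"
      by (rule continuous_on_compose2[OF cG']) (use R(2) in \<open>auto intro!: continuous_intros\<close>)
  qed (use flat S in blast)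
  then obtain r y where y: "r > 0" "r \<le> R" "y 0 = y0"
    "\<And>x. x \<in> ball 0 r \<Longrightarrow> (y has_derivative (\<lambda>v. - G (a + x) v (y x))) (at x)" by blast
  show thesis
  proof (rule that[of r "\<lambda>x. y (x - a)"])
    show "((\<lambda>x. y (x - a)) has_derivative (\<lambda>v. - G x v (y (x - a)))) (at x)" if "x \<in> ball a r" for x
    proof -
      have "((\<lambda>x. x - a) has_derivative (\<lambda>v. v)) (at x)" by (auto intro!: derivative_eq_intros)
      moreover from that have "x - a \<in> ball 0 r" by (simp add: dist_norm norm_minus_commute)
      then have "(y has_derivative (\<lambda>v. - G x v (y (x - a)))) (at (x - a))" using y(4) by fastforce
      ultimately show ?thesis by (rule has_derivative_compose)
    qed
    show "ball a r \<subseteq> S" using subset_ball[OF y(2)] R(2) by blast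
  qed (use y in auto)
qed

section \<open>Partial derivatives\<close>

lemma frechet_derivative_cong:
  assumes "open S" "x \<in> S" "\<And>y. y \<in> S \<Longrightarrow> f y = g y"
  shows "frechet_derivative f (at x) = frechet_derivative g (at x)"
proof -
  have "(f has_derivative f') (at x) \<longleftrightarrow> (g has_derivative f') (at x)" for f'
    using assms has_derivative_transform_within_open[of f f' x UNIV S g]
      has_derivative_transform_within_open[of g f' x UNIV S f] by auto
  then show ?thesis by (simp add: frechet_derivative_def)
qed

lemma partial_deriv_cong:
  assumes "open S" "x \<in> S" "\<And>y. y \<in> S \<Longrightarrow> f y = g y"
  shows "partial_deriv i f x = partial_deriv i g x"
  unfolding partial_deriv_def using frechet_derivative_cong[OF assms] by simp

lemma partial_deriv_eq: "(f has_derivative f') (at x) \<Longrightarrow> partial_deriv i f x = f' (axis i 1)"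
  by (simp add: partial_deriv_def frechet_derivative_at[symmetric])

lemma partial_deriv_vec_nth:
  "f differentiable (at x) \<Longrightarrow> partial_deriv i (\<lambda>x. f x $ j) x = partial_deriv i f x $ j"
  unfolding partial_deriv_def frechet_derivative_works
  by (subst frechet_derivative_at[symmetric, OF bounded_linear.has_derivative[OF bounded_linear_vec_nth]]) auto

lemma linear_axis_expansion:
  fixes f :: "real^'n \<Rightarrow> 'b::real_vector"
  assumes "linear f" shows "f v = (\<Sum>i\<in>UNIV. v $ i *\<^sub>R f (axis i 1))"
proof -
  have "v = (\<Sum>i\<in>UNIV. v $ i *\<^sub>R axis i 1)" using basis_expansion[of v] by (simp add: scalar_mult_eq_scaleR)
  then have "f v = f (\<Sum>i\<in>UNIV. v $ i *\<^sub>R axis i 1)" by simp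
  then show ?thesis using assms by (simp add: linear_sum linear_scale)
qed

lemma frechet_derivative_partial_deriv:
  "f differentiable (at x) \<Longrightarrow> frechet_derivative f (at x) v = (\<Sum>i\<in>UNIV. v $ i *\<^sub>R partial_deriv i f x)"
  unfolding partial_deriv_def by (rule linear_axis_expansion[OF linear_frechet_derivative])

lemma Ck_on_partial_deriv: "Ck_on (Suc k) f S \<Longrightarrow> Ck_on k (partial_deriv i f) S"
  unfolding partial_deriv_def[abs_def] by (rule Ck_on_frechet_derivative)

section \<open>Sums over index lists\<close>

lemma finite_lists_length [simp]: "finite {ks :: 'n::finite list. length ks = n}"
  using finite_lists_length_eq[of "UNIV :: 'n set" n] by simp

lemma sum_lists_Suc:
  fixes f :: "'n::finite list \<Rightarrow> 'a::comm_monoid_add"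
  shows "(\<Sum>ks | length ks = Suc n. f ks) = (\<Sum>k\<in>UNIV. \<Sum>ks | length ks = n. f (k # ks))"
proof -
  have "(\<Sum>k\<in>UNIV. \<Sum>ks | length ks = n. f (k # ks)) = (\<Sum>(k, ks)\<in>UNIV \<times> {ks. length ks = n}. f (k # ks))"
    by (simp add: sum.cartesian_product)
  also have "\<dots> = (\<Sum>ks | length ks = Suc n. f ks)"
    by (rule sum.reindex_bij_witness[of _ "\<lambda>ks. (hd ks, tl ks)" "\<lambda>(k, ks). k # ks"]) (auto simp: length_Suc_conv)
  finally show ?thesis by simp
qed

text \<open>Splits the multi-index of a tensor product into those of its factors, so that the
  transformation law factors as well.\<close>

lemma sum_lists_append:
  fixes f :: "'n::finite list \<Rightarrow> 'a::comm_monoid_add"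
  shows "(\<Sum>ks | length ks = m + n. f ks) = (\<Sum>ks | length ks = m. \<Sum>ls | length ls = n. f (ks @ ls))"
  by (induction m arbitrary: f) (simp_all add: sum_lists_Suc)

section \<open>Tensor fields\<close>

text \<open>The coefficient of the tensor transformation law as a function of whole index lists, so
  that recursion on lists replaces products over positions.\<close>

definition jprod :: "('n \<Rightarrow> 'n \<Rightarrow> real) \<Rightarrow> 'n list \<Rightarrow> 'n list \<Rightarrow> real" where
  "jprod J is ks = (\<Prod>a<length is. J (is ! a) (ks ! a))"

lemma jprod_Nil [simp]: "jprod J [] ks = 1"
  by (simp add: jprod_def)

lemma jprod_Cons [simp]: "jprod J (i # is) (k # ks) = J i k * jprod J is ks"
  unfolding jprod_def length_Cons prod.lessThan_Suc_shift by simp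

lemma jprod_append: "length is = length ks \<Longrightarrow> jprod J (is @ is') (ks @ ks') = jprod J is ks * jprod J is' ks'"
  by (induction "is" ks rule: list_induct2) auto

lemma tensor_field_iff:
  "tensor_field \<A> U r s T \<longleftrightarrow>
     (\<forall>c p is js. \<not> (c \<in> \<A> \<and> p \<in> chart_dom c \<inter> U \<and> length is = r \<and> length js = s)
        \<longrightarrow> T c p is js = 0) \<and>
     (\<forall>c\<in>\<A>. \<forall>d\<in>\<A>. \<forall>p \<in> chart_dom c \<inter> chart_dom d \<inter> U. \<forall>is js.
        length is = r \<and> length js = s \<longrightarrow>
        T d p is js = (\<Sum>ks | length ks = r. \<Sum>ls | length ls = s.
             jprod (jacobian c d p) is ks * jprod (jacobian d c p) ls js * T c p ks ls))"
  unfolding tensor_field_def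
  by (intro conj_cong refl ball_cong all_cong imp_cong arg_cong2[where f = "(=)"] sum.cong) (auto simp: jprod_def)

lemma tensor_field_eq_0:
  "tensor_field \<A> U r s T \<Longrightarrow> \<not> (c \<in> \<A> \<and> p \<in> chart_dom c \<inter> U \<and> length is = r \<and> length js = s) \<Longrightarrow> T c p is js = 0"
  unfolding tensor_field_def by blast

lemma tensor_field_transform:
  "tensor_field \<A> U r s T \<Longrightarrow> c \<in> \<A> \<Longrightarrow> d \<in> \<A> \<Longrightarrow> p \<in> chart_dom c \<inter> chart_dom d \<inter> U \<Longrightarrow> length is = r \<Longrightarrow> length js = s \<Longrightarrow>
   T d p is js = (\<Sum>ks | length ks = r. \<Sum>ls | length ls = s.
             jprod (jacobian c d p) is ks * jprod (jacobian d c p) ls js * T c p ks ls)"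
  unfolding tensor_field_iff by blast

lemma tensor_fieldI:
  assumes "\<And>c p is js. \<not> (c \<in> \<A> \<and> p \<in> chart_dom c \<inter> U \<and> length is = r \<and> length js = s) \<Longrightarrow> T c p is js = 0"
    and "\<And>c d p is js. c \<in> \<A> \<Longrightarrow> d \<in> \<A> \<Longrightarrow> p \<in> chart_dom c \<Longrightarrow> p \<in> chart_dom d \<Longrightarrow> p \<in> U \<Longrightarrow> length is = r \<Longrightarrow> length js = s \<Longrightarrow>
      T d p is js = (\<Sum>ks | length ks = r. \<Sum>ls | length ls = s.
             jprod (jacobian c d p) is ks * jprod (jacobian d c p) ls js * T c p ks ls)"
  shows "tensor_field \<A> U r s T"
  unfolding tensor_field_iff using assms by blast

text \<open>The transformation law is linear and components outside its scope are 0 by convention;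
  hence the vanishing of a tensor at a point can be tested in a single chart.\<close>

lemma tensor_field_zero_transfer:
  assumes T: "tensor_field \<A> U r s T" and c: "c \<in> \<A>" "p \<in> chart_dom c" and z: "\<And>is js. T c p is js = 0"
  shows "T d p is js = 0"
proof (cases "d \<in> \<A> \<and> p \<in> chart_dom d \<inter> U \<and> length is = r \<and> length js = s")
  case True
  then show ?thesis using tensor_field_transform[OF T c(1), of d p "is" js] c z by simp
next
  case False
  then show ?thesis using tensor_field_eq_0[OF T] by blast
qed

text \<open>Components off \<open>U\<close> are 0 by convention, so a field on \<open>U\<close>
  already is its own extension by zero. Only its smoothness may be lost.\<close>

lemma tensor_field_superset:
  fixes T :: "('m, 'n::finite) tfield"
  assumes T: "tensor_field \<A> U r s T" and "U \<subseteq> U'"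
  shows "tensor_field \<A> U' r s T"
proof (rule tensor_fieldI)
  show "T c p is js = 0" if "\<not> (c \<in> \<A> \<and> p \<in> chart_dom c \<inter> U' \<and> length is = r \<and> length js = s)" for c p "is" js
    using tensor_field_eq_0[OF T] that assms(2) by blast
  fix c d p and "is" js :: "'n list"
  assume *: "c \<in> \<A>" "d \<in> \<A>" "p \<in> chart_dom c" "p \<in> chart_dom d" "p \<in> U'" "length is = r" "length js = s"
  show "T d p is js = (\<Sum>ks | length ks = r. \<Sum>ls | length ls = s.
             jprod (jacobian c d p) is ks * jprod (jacobian d c p) ls js * T c p ks ls)"
  proof (cases "p \<in> U")
    case True then show ?thesis using tensor_field_transform[OF T *(1,2)] * by blast
  next
    case False
    then have "T e p ks ls = 0" for e ks ls using tensor_field_eq_0[OF T] by blast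
    then show ?thesis by simp
  qed
qed

lemma tensor_field_tdiff:
  fixes S T :: "('m, 'n::finite) tfield"
  assumes "tensor_field \<A> U r s S" "tensor_field \<A> U r s T"
  shows "tensor_field \<A> U r s (tdiff S T)"
proof (rule tensor_fieldI)
  show "tdiff S T c p is js = 0" if "\<not> (c \<in> \<A> \<and> p \<in> chart_dom c \<inter> U \<and> length is = r \<and> length js = s)" for c p "is" js
    using tensor_field_eq_0[OF assms(1) that] tensor_field_eq_0[OF assms(2) that] by (simp add: tdiff_def)
  fix c d p and "is" js :: "'n list"
  assume *: "c \<in> \<A>" "d \<in> \<A>" "p \<in> chart_dom c" "p \<in> chart_dom d" "p \<in> U" "length is = r" "length js = s"
  show "tdiff S T d p is js = (\<Sum>ks | length ks = r. \<Sum>ls | length ls = s.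
             jprod (jacobian c d p) is ks * jprod (jacobian d c p) ls js * tdiff S T c p ks ls)"
    unfolding tdiff_def using tensor_field_transform[OF assms(1) *(1,2)] tensor_field_transform[OF assms(2) *(1,2)] *
    by (simp add: right_diff_distrib sum_subtractf)
qed

lemma tensor_field_tprod:
  fixes S T :: "('m, 'n::finite) tfield"
  assumes S: "tensor_field \<A> U r s S" and T: "tensor_field \<A> U r' s' T"
  shows "tensor_field \<A> U (r + r') (s + s') (tprod r s S T)"
proof (rule tensor_fieldI)
  show "tprod r s S T c p is js = 0"
    if *: "\<not> (c \<in> \<A> \<and> p \<in> chart_dom c \<inter> U \<and> length is = r + r' \<and> length js = s + s')" for c p "is" js
  proof -
    have "\<not> (c \<in> \<A> \<and> p \<in> chart_dom c \<inter> U \<and> length (take r is) = r \<and> length (take s js) = s) \<or>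
       \<not> (c \<in> \<A> \<and> p \<in> chart_dom c \<inter> U \<and> length (drop r is) = r' \<and> length (drop s js) = s')"
      using * by (auto simp: min_def split: if_splits)
    then show ?thesis
      using tensor_field_eq_0[OF S] tensor_field_eq_0[OF T] unfolding tprod_def by (metis mult_zero_left mult_zero_right)
  qed
  fix c d p and "is" js :: "'n list"
  assume *: "c \<in> \<A>" "d \<in> \<A>" "p \<in> chart_dom c" "p \<in> chart_dom d" "p \<in> U" "length is = r + r'" "length js = s + s'"
  obtain i1 i2 j1 j2 where ij: "is = i1 @ i2" "js = j1 @ j2" "length i1 = r" "length i2 = r'" "length j1 = s" "length j2 = s'"
    by (rule that[of "take r is" "drop r is" "take s js" "drop s js"]) (use *(6,7) in auto)
  have p: "p \<in> chart_dom c \<inter> chart_dom d \<inter> U" using * by blast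
  let ?J = "jprod (jacobian c d p)" and ?J' = "jprod (jacobian d c p)"
  have "(\<Sum>ks | length ks = r + r'. \<Sum>ls | length ls = s + s'. ?J is ks * ?J' ls js * tprod r s S T c p ks ls)
    = (\<Sum>k1 | length k1 = r. \<Sum>k2 | length k2 = r'. \<Sum>l1 | length l1 = s. \<Sum>l2 | length l2 = s'.
        (?J i1 k1 * ?J' l1 j1 * S c p k1 l1) * (?J i2 k2 * ?J' l2 j2 * T c p k2 l2))"
    unfolding sum_lists_append
    by (intro sum.cong refl) (auto simp: tprod_def ij jprod_append)
  also have "\<dots> = (\<Sum>k1 | length k1 = r. \<Sum>l1 | length l1 = s. ?J i1 k1 * ?J' l1 j1 * S c p k1 l1) *
      (\<Sum>k2 | length k2 = r'. \<Sum>l2 | length l2 = s'. ?J i2 k2 * ?J' l2 j2 * T c p k2 l2)"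
    unfolding sum_product by (intro sum.cong refl sum.swap)
  also have "\<dots> = tprod r s S T d p is js"
    using tensor_field_transform[OF S *(1,2) p ij(3,5)] tensor_field_transform[OF T *(1,2) p ij(4,6)] ij
    by (simp add: tprod_def)
  finally show "tprod r s S T d p is js = (\<Sum>ks | length ks = r + r'. \<Sum>ls | length ls = s + s'.
       ?J is ks * ?J' ls js * tprod r s S T c p ks ls)" by simp
qed

text \<open>The contraction used throughout: in the product of a covector with a field having upper
  indices, or of a vector with a field having lower ones, the two indices to be paired come
  first.\<close>

lemma contract_0_0: "contract 0 0 T c p is js = (\<Sum>k\<in>UNIV. T c p (k # is) (k # js))"
  by (simp add: contract_def)

lemma Ck_tensor_field_imp_tensor_field: "Ck_tensor_field k \<A> U r s T \<Longrightarrow> tensor_field \<A> U r s T"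
  by (simp add: Ck_tensor_field_def)

lemma Ck_tensor_field_mono: "Ck_tensor_field k \<A> U r s T \<Longrightarrow> m \<le> k \<Longrightarrow> Ck_tensor_field m \<A> U r s T"
  unfolding Ck_tensor_field_def using Ck_on_mono by blast

lemma tensor_field_tzero: "tensor_field \<A> U r s tzero"
  by (simp add: tensor_field_def tzero_def)

lemma Ck_tensor_field_tzero: "Ck_tensor_field k \<A> U r s tzero"
  unfolding Ck_tensor_field_def by (simp add: tensor_field_tzero) (simp add: tzero_def)

section \<open>Charts, transition maps and Jacobians on a manifold of class
  \<open>C\<^sup>3\<close>\<close>

locale C3_manifold =
  fixes M :: "'m topology" and \<A> :: "('m, 'n::finite) chart set"
  assumes manifold: "Ck_manifold 3 M \<A>"
begin

lemma topspace_eq: "topspace M = (\<Union>c\<in>\<A>. chart_dom c)"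
  and Hausdorff: "Hausdorff_space M"
  and is_chart: "c \<in> \<A> \<Longrightarrow> is_chart M c"
  and Ck_transition: "c \<in> \<A> \<Longrightarrow> d \<in> \<A> \<Longrightarrow> Ck_on 3 (transition c d) (chart_map c ` (chart_dom c \<inter> chart_dom d))"
  using manifold unfolding Ck_manifold_def by blast+

lemma openin_chart_dom: "c \<in> \<A> \<Longrightarrow> openin M (chart_dom c)"
  using is_chart unfolding is_chart_def by blast

lemma dom_subset: "c \<in> \<A> \<Longrightarrow> chart_dom c \<subseteq> topspace M"
  by (simp add: openin_chart_dom openin_subset)

lemma homeo: "c \<in> \<A> \<Longrightarrow> homeomorphic_map (subtopology M (chart_dom c)) (top_of_set (chart_map c ` chart_dom c)) (chart_map c)"
  using is_chart unfolding is_chart_def by blast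

lemma chart_inj: "c \<in> \<A> \<Longrightarrow> inj_on (chart_map c) (chart_dom c)"
  using homeomorphic_imp_injective_map[OF homeo] dom_subset by (auto simp: inf.absorb2)

lemma chart_inv_map [simp]: "c \<in> \<A> \<Longrightarrow> p \<in> chart_dom c \<Longrightarrow> chart_inv c (chart_map c p) = p"
  by (simp add: chart_inj)

lemma open_chart_image:
  assumes "c \<in> \<A>" "openin M S" shows "open (chart_map c ` (chart_dom c \<inter> S))"
proof -
  have "openin (subtopology M (chart_dom c)) (chart_dom c \<inter> S)"
    using assms(2) by (simp add: openin_subtopology_Int2)
  then have "openin (top_of_set (chart_map c ` chart_dom c)) (chart_map c ` (chart_dom c \<inter> S))"
    using homeomorphic_imp_open_map[OF homeo[OF assms(1)]] unfolding open_map_def by blast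
  then show ?thesis
    using is_chart[OF assms(1)] unfolding is_chart_def by (meson openin_open_trans)
qed

lemma open_chart_image_dom: "c \<in> \<A> \<Longrightarrow> open (chart_map c ` chart_dom c)"
  using is_chart unfolding is_chart_def by blast

lemma openin_chart_vimage:
  assumes "c \<in> \<A>" "open V" shows "openin M {p \<in> chart_dom c. chart_map c p \<in> V}"
proof -
  have "continuous_map (subtopology M (chart_dom c)) euclidean (chart_map c)"
    using homeomorphic_imp_continuous_map[OF homeo[OF assms(1)]] by (simp add: continuous_map_in_subtopology)
  then have "openin (subtopology M (chart_dom c)) {p \<in> topspace (subtopology M (chart_dom c)). chart_map c p \<in> V}"
    using assms(2) by (intro openin_continuous_map_preimage) auto
  moreover have "{p \<in> topspace (subtopology M (chart_dom c)). chart_map c p \<in> V} = {p \<in> chart_dom c. chart_map c p \<in> V}"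
    using dom_subset[OF assms(1)] by auto
  ultimately show ?thesis using openin_trans_full[OF _ openin_chart_dom[OF assms(1)]] by simp
qed

text \<open>Here the Hausdorff axiom enters: a compact set inside a chart is closed in all of
  \<open>M\<close>, so that extension by zero beyond it is smooth.\<close>

lemma closedin_chart_inv_image:
  assumes c: "c \<in> \<A>" and "compact K" "K \<subseteq> chart_map c ` chart_dom c"
  shows "closedin M (chart_inv c ` K)"
proof -
  obtain g where g: "homeomorphic_maps (subtopology M (chart_dom c)) (top_of_set (chart_map c ` chart_dom c)) (chart_map c) g"
    using homeo[OF c] homeomorphic_map_maps by blast
  have "compactin (top_of_set (chart_map c ` chart_dom c)) K"
    using assms by (simp add: compactin_subtopology compactin_euclidean_iff)
  then have "compactin (subtopology M (chart_dom c)) (g ` K)"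
    using g image_compactin unfolding homeomorphic_maps_def by blast
  moreover have "g ` K = chart_inv c ` K"
  proof (rule image_cong[OF refl])
    fix x assume "x \<in> K"
    then obtain p where p: "p \<in> chart_dom c" "x = chart_map c p" using assms(3) by blast
    have "g (chart_map c p) = p" using g p dom_subset[OF c] unfolding homeomorphic_maps_def by auto
    then show "g x = chart_inv c x" using p c by simp
  qed
  ultimately have "compactin M (chart_inv c ` K)" by (simp add: compactin_subtopology)
  then show ?thesis using compactin_imp_closedin[OF Hausdorff] by blast
qed

lemma transition_eq: "c \<in> \<A> \<Longrightarrow> p \<in> chart_dom c \<Longrightarrow> transition c d (chart_map c p) = chart_map d p"
  by (simp add: transition_def)

lemma Ck_change_chart:
  fixes g :: "'m \<Rightarrow> real"
  assumes c: "c \<in> \<A>" and d: "d \<in> \<A>" and U: "openin M U" and "k \<le> 3"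
    and g: "Ck_on k (\<lambda>x. g (chart_inv c x)) (chart_map c ` (chart_dom c \<inter> U))"
  shows "Ck_on k (\<lambda>x. g (chart_inv d x)) (chart_map d ` (chart_dom d \<inter> (chart_dom c \<inter> U)))"
proof -
  let ?S = "chart_map d ` (chart_dom d \<inter> (chart_dom c \<inter> U))"
  have S: "open ?S" using U c d by (intro open_chart_image openin_Int openin_chart_dom)
  have "Ck_on k (\<lambda>x. g (chart_inv c (transition d c x))) ?S"
  proof (rule Ck_on_compose_real[OF S open_chart_image[OF c U] _ g])
    show "Ck_on k (transition d c) ?S"
      by (rule Ck_on_subset[OF Ck_on_mono[OF Ck_transition[OF d c] \<open>k \<le> 3\<close>]]) blast
    show "transition d c ` ?S \<subseteq> chart_map c ` (chart_dom c \<inter> U)"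
      by (auto simp: transition_eq[OF d])
  qed
  then show ?thesis
    by (subst Ck_on_cong[OF S]) (use c d in \<open>auto simp: transition_eq\<close>)
qed

lemma Ck_transition_Suc:
  "c \<in> \<A> \<Longrightarrow> d \<in> \<A> \<Longrightarrow> Ck_on (Suc 2) (transition c d) (chart_map c ` (chart_dom c \<inter> chart_dom d))"
  using Ck_transition by (simp only: numeral_3_eq_3 numeral_2_eq_2)

lemma transition_has_derivative:
  assumes "c \<in> \<A>" "d \<in> \<A>" "p \<in> chart_dom c" "p \<in> chart_dom d"
  shows "(transition c d has_derivative frechet_derivative (transition c d) (at (chart_map c p))) (at (chart_map c p))"
  using Ck_on_has_derivative[OF Ck_transition_Suc[OF assms(1,2)]] assms by blast

text \<open>The chain rule: near the point, \<open>transition c e\<close> is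
  \<open>transition d e\<close> after \<open>transition c d\<close>.\<close>

lemma jacobian_cocycle:
  assumes c: "c \<in> \<A>" "p \<in> chart_dom c" and d: "d \<in> \<A>" "p \<in> chart_dom d" and e: "e \<in> \<A>" "p \<in> chart_dom e"
  shows "jacobian c e p i k = (\<Sum>j\<in>UNIV. jacobian d e p i j * jacobian c d p j k)"
proof -
  let ?S = "chart_map c ` (chart_dom c \<inter> (chart_dom d \<inter> chart_dom e))"
  let ?cd = "frechet_derivative (transition c d) (at (chart_map c p))"
  let ?de = "frechet_derivative (transition d e) (at (chart_map d p))"
  have "((\<lambda>x. transition d e (transition c d x)) has_derivative (\<lambda>v. ?de (?cd v))) (at (chart_map c p))"
    using has_derivative_compose[OF transition_has_derivative[OF c(1) d(1) c(2) d(2)]]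
      transition_has_derivative[OF d(1) e(1) d(2) e(2)] transition_eq[OF c] by metis
  then have "(transition c e has_derivative (\<lambda>v. ?de (?cd v))) (at (chart_map c p))"
  proof (rule has_derivative_transform_within_open[of _ _ _ _ ?S])
    show "open ?S" using assms by (intro open_chart_image openin_Int openin_chart_dom)
  qed (use assms in \<open>auto simp: transition_eq\<close>)
  then have "jacobian c e p i k = ?de (?cd (axis k 1)) $ i"
    unfolding jacobian_def by (simp add: partial_deriv_eq)
  also have "\<dots> = (\<Sum>j\<in>UNIV. ?cd (axis k 1) $ j *\<^sub>R ?de (axis j 1)) $ i"
    using linear_axis_expansion[OF has_derivative_linear[OF transition_has_derivative[OF d(1) e(1) d(2) e(2)]]] by metis
  also have "\<dots> = (\<Sum>j\<in>UNIV. jacobian d e p i j * jacobian c d p j k)"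
    by (simp add: jacobian_def partial_deriv_def mult.commute)
  finally show ?thesis .
qed

lemma jacobian_refl:
  assumes c: "c \<in> \<A>" "p \<in> chart_dom c"
  shows "jacobian c c p i k = (if i = k then 1 else 0)"
proof -
  have "((\<lambda>x. x) has_derivative (\<lambda>v. v)) (at (chart_map c p))" by simp
  then have "(transition c c has_derivative (\<lambda>v. v)) (at (chart_map c p))"
    by (rule has_derivative_transform_within_open[OF _ open_chart_image_dom[OF c(1)]]) (use c in \<open>auto simp: transition_eq\<close>)
  then show ?thesis unfolding jacobian_def by (simp add: partial_deriv_eq axis_def)
qed

lemma jacobian_inverse:
  assumes c: "c \<in> \<A>" "p \<in> chart_dom c" and d: "d \<in> \<A>" "p \<in> chart_dom d"
  shows "(\<Sum>j\<in>UNIV. jacobian d c p i j * jacobian c d p j k) = (if i = k then 1 else 0)"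
  using jacobian_cocycle[OF c d c] jacobian_refl[OF c] by simp

text \<open>One derivative is lost from class 3. This is the source of the bound
  \<open>k \<le> 2\<close> wherever a field is built from its components in one chart.\<close>

lemma Ck_jacobian:
  assumes c: "c \<in> \<A>" and d: "d \<in> \<A>"
  shows "Ck_on 2 (\<lambda>x. jacobian c d (chart_inv c x) i k) (chart_map c ` (chart_dom c \<inter> chart_dom d))" (is "Ck_on 2 ?f ?S")
proof -
  have S: "open ?S" using c d by (intro open_chart_image openin_chart_dom)
  have "Ck_on (Suc 2) (transition c d) ?S" by (rule Ck_transition_Suc[OF assms])
  then have "Ck_on 2 (\<lambda>x. partial_deriv k (transition c d) x $ i) ?S"
    by (intro Ck_on_vec_nth[OF S] Ck_on_partial_deriv)
  then show ?thesis
    by (subst Ck_on_cong[OF S]) (use c in \<open>auto simp: jacobian_def\<close>)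
qed

text \<open>The Jacobian factors belonging to the contracted upper and lower index are inverse to
  each other. Once the sum over the contracted index is moved innermost, they collapse to a
  Kronecker delta.\<close>

lemma tensor_field_contract:
  assumes T: "tensor_field \<A> U (Suc r) (Suc s) T"
  shows "tensor_field \<A> U r s (contract 0 0 T)"
proof (rule tensor_fieldI)
  show "contract 0 0 T c p is js = 0" if "\<not> (c \<in> \<A> \<and> p \<in> chart_dom c \<inter> U \<and> length is = r \<and> length js = s)" for c p "is" js
    unfolding contract_0_0 using tensor_field_eq_0[OF T, of c p "_ # is" "_ # js"] that by simp
  fix c d p and "is" js :: "'n list"
  assume *: "c \<in> \<A>" "d \<in> \<A>" "p \<in> chart_dom c" "p \<in> chart_dom d" "p \<in> U" "length is = r" "length js = s"
  let ?J = "jprod (jacobian c d p)" and ?J' = "jprod (jacobian d c p)"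
  have "contract 0 0 T d p is js = (\<Sum>k\<in>UNIV. \<Sum>m\<in>UNIV. \<Sum>ks | length ks = r. \<Sum>n\<in>UNIV. \<Sum>ls | length ls = s.
      (jacobian d c p n k * jacobian c d p k m) * (?J is ks * ?J' ls js * T c p (m # ks) (n # ls)))"
    unfolding contract_0_0 using * 
    by (intro sum.cong refl) (subst tensor_field_transform[OF T *(1,2)], auto simp: sum_lists_Suc intro!: sum.cong)
  also have "\<dots> = (\<Sum>m\<in>UNIV. \<Sum>ks | length ks = r. \<Sum>n\<in>UNIV. \<Sum>ls | length ls = s.
      (\<Sum>k\<in>UNIV. jacobian d c p n k * jacobian c d p k m) * (?J is ks * ?J' ls js * T c p (m # ks) (n # ls)))"
    by (subst sum.swap, rule sum.cong[OF refl], subst sum.swap, rule sum.cong[OF refl], subst sum.swap, rule sum.cong[OF refl], subst sum.swap, rule sum.cong[OF refl])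
      (simp add: sum_distrib_right)
  also have "\<dots> = (\<Sum>m\<in>UNIV. \<Sum>ks | length ks = r. \<Sum>n\<in>UNIV. 
      if n = m then \<Sum>ls | length ls = s. ?J is ks * ?J' ls js * T c p (m # ks) (m # ls) else 0)"
    by (intro sum.cong refl) (auto simp: jacobian_inverse[OF *(1,3,2,4)])
  also have "\<dots> = (\<Sum>m\<in>UNIV. \<Sum>ks | length ks = r. \<Sum>ls | length ls = s. ?J is ks * ?J' ls js * T c p (m # ks) (m # ls))"
    by (intro sum.cong refl) simp
  also have "\<dots> = (\<Sum>ks | length ks = r. \<Sum>ls | length ls = s. ?J is ks * ?J' ls js * contract 0 0 T c p ks ls)"
    unfolding contract_0_0 sum_distrib_left by (subst sum.swap, rule sum.cong[OF refl], subst sum.swap) simp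
  finally show "contract 0 0 T d p is js = (\<Sum>ks | length ks = r. \<Sum>ls | length ls = s.
     ?J is ks * ?J' ls js * contract 0 0 T c p ks ls)" .
qed

lemma Ck_tensor_field_tprod:
  "openin M U \<Longrightarrow> Ck_tensor_field k \<A> U r s S \<Longrightarrow> Ck_tensor_field k \<A> U r' s' T \<Longrightarrow>
   Ck_tensor_field k \<A> U (r + r') (s + s') (tprod r s S T)"
  unfolding Ck_tensor_field_def using tensor_field_tprod by (auto simp: tprod_def intro!: Ck_on_mult open_chart_image)

lemma Ck_tensor_field_contract:
  "openin M U \<Longrightarrow> Ck_tensor_field k \<A> U (Suc r) (Suc s) T \<Longrightarrow> Ck_tensor_field k \<A> U r s (contract 0 0 T)"
  unfolding Ck_tensor_field_def using tensor_field_contract by (auto simp: contract_0_0 intro!: Ck_on_sum open_chart_image)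

text \<open>In any other chart the components are sums of products of the given ones with Jacobians,
  and these are of class \<open>C\<^sup>2\<close>.\<close>

lemma Ck_tensor_field_single_chart:
  assumes T: "tensor_field \<A> U r s T" and c: "c \<in> \<A>" and U: "openin M U" "U \<subseteq> chart_dom c" and k: "k \<le> 2"
    and Tc: "\<And>is js. Ck_on k (\<lambda>x. T c (chart_inv c x) is js) (chart_map c ` U)"
  shows "Ck_tensor_field k \<A> U r s T"
  unfolding Ck_tensor_field_def
proof (intro conjI ballI allI T)
  fix d and "is" js :: "'n list" assume d: "d \<in> \<A>"
  let ?S = "chart_map d ` (chart_dom d \<inter> U)"
  have S: "open ?S" using d U by (intro open_chart_image)
  have cU: "chart_dom c \<inter> U = U" using U by blast
  show "Ck_on k (\<lambda>x. T d (chart_inv d x) is js) ?S"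
  proof (cases "length is = r \<and> length js = s")
    case True
    have J: "Ck_on k (\<lambda>x. jacobian c d (chart_inv d x) i j) ?S" for i j
    proof -
      have "Ck_on k (\<lambda>x. jacobian c d (chart_inv c x) i j) (chart_map c ` (chart_dom c \<inter> (chart_dom d \<inter> U)))"
        by (rule Ck_on_subset[OF Ck_on_mono[OF Ck_jacobian[OF c d] k]]) blast
      from Ck_change_chart[OF c d openin_Int[OF openin_chart_dom[OF d] U(1)] _ this] show ?thesis
        using k U(2) by (auto simp: Int_absorb1 Int_assoc elim!: Ck_on_subset)
    qed
    have J': "Ck_on k (\<lambda>x. jacobian d c (chart_inv d x) i j) ?S" for i j
      by (rule Ck_on_subset[OF Ck_on_mono[OF Ck_jacobian[OF d c] k]]) (use U(2) in blast)
    have T': "Ck_on k (\<lambda>x. T c (chart_inv d x) ks ls) ?S" for ks ls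
    proof -
      have "Ck_on k (\<lambda>x. T c (chart_inv c x) ks ls) (chart_map c ` (chart_dom c \<inter> U))" using Tc by (simp only: cU)
      from Ck_change_chart[OF c d U(1) _ this] show ?thesis using k by (simp add: cU)
    qed
    have "Ck_on k (\<lambda>x. \<Sum>ks | length ks = r. \<Sum>ls | length ls = s.
       jprod (jacobian c d (chart_inv d x)) is ks * jprod (jacobian d c (chart_inv d x)) ls js * T c (chart_inv d x) ks ls) ?S"
      unfolding jprod_def by (intro Ck_on_sum Ck_on_mult Ck_on_prod S J J' T')
    then show ?thesis
      by (subst Ck_on_cong[OF S]) (use tensor_field_transform[OF T c d] True d U(2) in auto)
  next
    case False
    then show ?thesis using tensor_field_eq_0[OF T] by simp
  qed
qed

lemma tensor_field_restrict:
  assumes "tensor_field \<A> U r s T"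
  shows "tensor_field \<A> (U \<inter> V) r s (\<lambda>c p is js. if p \<in> V then T c p is js else 0)"
  by (rule tensor_fieldI) (use tensor_field_eq_0[OF assms] tensor_field_transform[OF assms] in auto)

text \<open>A tensor field is a family of components in all charts, so components \<open>v\<close>
  chosen in \<open>c\<close> alone have to be carried to every \<open>d\<close> by the
  transformation law. Local fields are constructed in this way.\<close>

definition vector_in_chart :: "('m, 'n) chart \<Rightarrow> 'm set \<Rightarrow> ('m \<Rightarrow> 'n \<Rightarrow> real) \<Rightarrow> ('m, 'n) tfield" where
  "vector_in_chart c U v = (\<lambda>d p is js. if d \<in> \<A> \<and> p \<in> chart_dom d \<inter> chart_dom c \<inter> U \<and> length is = 1 \<and> js = []
     then \<Sum>k\<in>UNIV. jacobian c d p (hd is) k * v p k else 0)"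

definition covector_in_chart :: "('m, 'n) chart \<Rightarrow> 'm set \<Rightarrow> ('m \<Rightarrow> 'n \<Rightarrow> real) \<Rightarrow> ('m, 'n) tfield" where
  "covector_in_chart c U w = (\<lambda>d p is js. if d \<in> \<A> \<and> p \<in> chart_dom d \<inter> chart_dom c \<inter> U \<and> is = [] \<and> length js = 1
     then \<Sum>k\<in>UNIV. jacobian d c p k (hd js) * w p k else 0)"

lemma tensor_field_vector_in_chart:
  assumes "c \<in> \<A>" "U \<subseteq> chart_dom c"
  shows "tensor_field \<A> U 1 0 (vector_in_chart c U v)"
proof (rule tensor_fieldI)
  fix d e p and "is" js :: "'n list"
  assume *: "d \<in> \<A>" "e \<in> \<A>" "p \<in> chart_dom d" "p \<in> chart_dom e" "p \<in> U" "length is = 1" "length js = 0"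
  then obtain i where i: "is = [i]" by (auto simp: length_Suc_conv)
  have pc: "p \<in> chart_dom c" using * assms by blast
  have "(\<Sum>k\<in>UNIV. jacobian c e p i k * v p k) = (\<Sum>k\<in>UNIV. \<Sum>j\<in>UNIV. jacobian d e p i j * jacobian c d p j k * v p k)"
    using jacobian_cocycle[OF assms(1) pc *(1,3,2,4)] by (simp add: sum_distrib_right)
  also have "\<dots> = (\<Sum>j\<in>UNIV. jacobian d e p i j * (\<Sum>k\<in>UNIV. jacobian c d p j k * v p k))"
    unfolding sum_distrib_left by (subst sum.swap) (simp add: mult.assoc)
  finally show "vector_in_chart c U v e p is js = (\<Sum>ks | length ks = 1. \<Sum>ls | length ls = 0.
      jprod (jacobian d e p) is ks * jprod (jacobian e d p) ls js * vector_in_chart c U v d p ks ls)"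
    using * pc i by (simp add: vector_in_chart_def sum_lists_Suc)
qed (auto simp: vector_in_chart_def)

lemma tensor_field_covector_in_chart:
  assumes "c \<in> \<A>" "U \<subseteq> chart_dom c"
  shows "tensor_field \<A> U 0 1 (covector_in_chart c U w)"
proof (rule tensor_fieldI)
  fix d e p and "is" js :: "'n list"
  assume *: "d \<in> \<A>" "e \<in> \<A>" "p \<in> chart_dom d" "p \<in> chart_dom e" "p \<in> U" "length is = 0" "length js = 1"
  then obtain i where i: "js = [i]" by (auto simp: length_Suc_conv)
  have pc: "p \<in> chart_dom c" using * assms by blast
  have "(\<Sum>k\<in>UNIV. jacobian e c p k i * w p k) = (\<Sum>k\<in>UNIV. \<Sum>j\<in>UNIV. jacobian e d p j i * (jacobian d c p k j * w p k))"
    using jacobian_cocycle[OF *(2,4,1,3) assms(1) pc] by (simp add: sum_distrib_left mult_ac)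
  also have "\<dots> = (\<Sum>j\<in>UNIV. jacobian e d p j i * (\<Sum>k\<in>UNIV. jacobian d c p k j * w p k))"
    unfolding sum_distrib_left by (subst sum.swap) simp
  finally show "covector_in_chart c U w e p is js = (\<Sum>ks | length ks = 0. \<Sum>ls | length ls = 1.
      jprod (jacobian d e p) is ks * jprod (jacobian e d p) ls js * covector_in_chart c U w d p ks ls)"
    using * pc i by (simp add: covector_in_chart_def sum_lists_Suc)
qed (auto simp: covector_in_chart_def)

lemma vector_in_chart_same:
  "c \<in> \<A> \<Longrightarrow> p \<in> chart_dom c \<Longrightarrow> p \<in> U \<Longrightarrow> vector_in_chart c U v c p [i] [] = v p i"
  by (simp add: vector_in_chart_def jacobian_refl if_distrib[of "\<lambda>x. x * _"] cong: if_cong)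

lemma covector_in_chart_same:
  "c \<in> \<A> \<Longrightarrow> p \<in> chart_dom c \<Longrightarrow> p \<in> U \<Longrightarrow> covector_in_chart c U w c p [] [i] = w p i"
  by (simp add: covector_in_chart_def jacobian_refl if_distrib[of "\<lambda>x. x * _"] cong: if_cong)

text \<open>Lets two vector fields be identified at a point, in all charts at once, by comparing
  their components in \<open>c\<close>.\<close>

lemma vector_in_chart_unique:
  assumes c: "c \<in> \<A>" "p \<in> chart_dom c" "p \<in> U" and V: "tensor_field \<A> U 1 0 V" and "\<And>i. V c p [i] [] = v p i"
  shows "V d p = vector_in_chart c U v d p"
proof (intro ext)
  fix "is" js :: "'n list"
  show "V d p is js = vector_in_chart c U v d p is js"
  proof (cases "d \<in> \<A> \<and> p \<in> chart_dom d \<and> length is = 1 \<and> js = []")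
    case True
    then obtain i where i: "is = [i]" by (auto simp: length_Suc_conv)
    have "V d p is js = (\<Sum>k\<in>UNIV. jacobian c d p i k * v p k)"
      using tensor_field_transform[OF V c(1), of d p "is" js] True c assms(5) i by (simp add: sum_lists_Suc)
    then show ?thesis using True c i by (simp add: vector_in_chart_def)
  next
    case False
    then show ?thesis using tensor_field_eq_0[OF V, of d p "is" js] by (auto simp: vector_in_chart_def)
  qed
qed

lemma Ck_vector_in_chart:
  assumes "c \<in> \<A>" "openin M U" "U \<subseteq> chart_dom c" "k \<le> 2"
    and v: "\<And>i. Ck_on k (\<lambda>x. v (chart_inv c x) i) (chart_map c ` U)"
  shows "Ck_tensor_field k \<A> U 1 0 (vector_in_chart c U v)"
proof (rule Ck_tensor_field_single_chart[OF tensor_field_vector_in_chart[OF assms(1,3)] assms(1-4)])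
  fix "is" js :: "'n list"
  have S: "open (chart_map c ` U)" using open_chart_image[OF assms(1,2)] assms(3) by (simp add: Int_absorb1)
  show "Ck_on k (\<lambda>x. vector_in_chart c U v c (chart_inv c x) is js) (chart_map c ` U)"
  proof (cases "length is = 1 \<and> js = []")
    case True
    then obtain i where "is = [i]" "js = []" by (auto simp: length_Suc_conv)
    then show ?thesis using v[of i] assms(1,3)
      by (subst Ck_on_cong[OF S, of _ "\<lambda>x. v (chart_inv c x) i"]) (auto intro!: vector_in_chart_same)
  next
    case False
    then have "(\<lambda>x. vector_in_chart c U v c (chart_inv c x) is js) = (\<lambda>_. 0)" by (auto simp: vector_in_chart_def)
    then show ?thesis by simp
  qed
qed

lemma Ck_covector_in_chart:
  assumes "c \<in> \<A>" "openin M U" "U \<subseteq> chart_dom c" "k \<le> 2"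
    and w: "\<And>i. Ck_on k (\<lambda>x. w (chart_inv c x) i) (chart_map c ` U)"
  shows "Ck_tensor_field k \<A> U 0 1 (covector_in_chart c U w)"
proof (rule Ck_tensor_field_single_chart[OF tensor_field_covector_in_chart[OF assms(1,3)] assms(1-4)])
  fix "is" js :: "'n list"
  have S: "open (chart_map c ` U)" using open_chart_image[OF assms(1,2)] assms(3) by (simp add: Int_absorb1)
  show "Ck_on k (\<lambda>x. covector_in_chart c U w c (chart_inv c x) is js) (chart_map c ` U)"
  proof (cases "is = [] \<and> length js = 1")
    case True
    then obtain i where "js = [i]" "is = []" by (auto simp: length_Suc_conv)
    then show ?thesis using w[of i] assms(1,3)
      by (subst Ck_on_cong[OF S, of _ "\<lambda>x. w (chart_inv c x) i"]) (auto intro!: covector_in_chart_same)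
  next
    case False
    then have "(\<lambda>x. covector_in_chart c U w c (chart_inv c x) is js) = (\<lambda>_. 0)" by (auto simp: covector_in_chart_def)
    then show ?thesis by simp
  qed
qed

definition tfun :: "('m \<Rightarrow> real) \<Rightarrow> ('m, 'n) tfield" where
  "tfun g = (\<lambda>c p is js. if c \<in> \<A> \<and> p \<in> chart_dom c \<and> is = [] \<and> js = [] then g p else 0)"

lemma tensor_field_tfun: "tensor_field \<A> (topspace M) 0 0 (tfun g)"
  by (rule tensor_fieldI) (use dom_subset in \<open>auto simp: tfun_def\<close>)

lemma tprod_tfun:
  assumes "tensor_field \<A> U r s T"
  shows "tprod 0 0 (tfun g) T = (\<lambda>c p is js. g p * T c p is js)"
  by (intro ext) (use tensor_field_eq_0[OF assms] in \<open>auto simp: tprod_def tfun_def\<close>)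

lemma dom_Int_topspace [simp]: "c \<in> \<A> \<Longrightarrow> chart_dom c \<inter> topspace M = chart_dom c"
  using dom_subset by blast

lemma Ck_tfun:
  assumes "\<And>c. c \<in> \<A> \<Longrightarrow> Ck_on k (\<lambda>x. g (chart_inv c x)) (chart_map c ` chart_dom c)"
  shows "Ck_tensor_field k \<A> (topspace M) 0 0 (tfun g)"
  unfolding Ck_tensor_field_def
proof (intro conjI ballI allI tensor_field_tfun)
  fix c and "is" js :: "'n list" assume c: "c \<in> \<A>"
  show "Ck_on k (\<lambda>x. tfun g c (chart_inv c x) is js) (chart_map c ` (chart_dom c \<inter> topspace M))"
  proof (cases "is = [] \<and> js = []")
    case True
    then show ?thesis using assms[OF c] c
      by (simp, subst Ck_on_cong[OF open_chart_image_dom[OF c], of _ "\<lambda>x. g (chart_inv c x)"]) (auto simp: tfun_def)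
  next
    case False
    then have "(\<lambda>x. tfun g c (chart_inv c x) is js) = (\<lambda>_. 0)" by (auto simp: tfun_def)
    then show ?thesis by simp
  qed
qed

section \<open>Cutting off local tensor fields\<close>

text \<open>A plateau function in a chart, extended by zero. Besides the plateau \<open>W\<close>,
  the closed set \<open>K\<close> is recorded because products with fields on \<open>U\<close> are
  extended across its complement.\<close>

lemma bump_function:
  assumes U: "openin M U" "p \<in> U"
  obtains \<beta> :: "'m \<Rightarrow> real" and W K where "openin M W" "p \<in> W" "W \<subseteq> U" "\<And>q. q \<in> W \<Longrightarrow> \<beta> q = 1"
    "closedin M K" "K \<subseteq> U" "\<And>q. q \<notin> K \<Longrightarrow> \<beta> q = 0"
    "\<And>d. d \<in> \<A> \<Longrightarrow> Ck_on 3 (\<lambda>x. \<beta> (chart_inv d x)) (chart_map d ` chart_dom d)"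
proof -
  obtain c where c: "c \<in> \<A>" "p \<in> chart_dom c" using U openin_subset[OF U(1)] topspace_eq by blast
  have "open (chart_map c ` (chart_dom c \<inter> U))" using open_chart_image[OF c(1) U(1)] .
  then obtain R where R: "R > 0" "cball (chart_map c p) R \<subseteq> chart_map c ` (chart_dom c \<inter> U)"
    using c U open_contains_cball by blast
  obtain \<phi> :: "real^'n \<Rightarrow> real" and r where \<phi>: "r > 0" "r < R" "\<And>S. open S \<Longrightarrow> Ck_on 3 \<phi> S"
    "\<And>x. x \<in> ball (chart_map c p) r \<Longrightarrow> \<phi> x = 1" "\<And>x. x \<notin> cball (chart_map c p) R \<Longrightarrow> \<phi> x = 0"
    using Ck_bump[OF R(1), where k = 3 and a = "chart_map c p"] by metis
  define K where "K = chart_inv c ` cball (chart_map c p) R"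
  define W where "W = {q \<in> chart_dom c. chart_map c q \<in> ball (chart_map c p) r}"
  define \<beta> where "\<beta> q = (if q \<in> chart_dom c then \<phi> (chart_map c q) else 0)" for q
  have KU: "K \<subseteq> chart_dom c \<inter> U"
  proof
    fix q assume "q \<in> K"
    then obtain x where x: "x \<in> cball (chart_map c p) R" "q = chart_inv c x" unfolding K_def by blast
    then obtain q' where "q' \<in> chart_dom c \<inter> U" "x = chart_map c q'" using R(2) by blast
    then show "q \<in> chart_dom c \<inter> U" using x(2) c by simp
  qed
  have \<beta>0: "\<beta> q = 0" if "q \<notin> K" for q
  proof (cases "q \<in> chart_dom c")
    case True
    then have "chart_map c q \<notin> cball (chart_map c p) R"
      using that c(1) unfolding K_def by (metis chart_inv_map image_eqI)
    then show ?thesis using \<phi>(5) True by (simp add: \<beta>_def)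
  qed (simp add: \<beta>_def)
  have closedK: "closedin M K" unfolding K_def
    by (rule closedin_chart_inv_image[OF c(1) compact_cball]) (use R(2) in blast)
  have WU: "W \<subseteq> U"
  proof
    fix q assume q: "q \<in> W"
    then have "chart_map c q \<in> cball (chart_map c p) R" using \<phi>(2) by (simp add: W_def)
    then have "q \<in> K" using q c(1) unfolding K_def W_def by (metis (mono_tags, lifting) chart_inv_map image_eqI mem_Collect_eq)
    then show "q \<in> U" using KU by blast
  qed
  show thesis
  proof (rule that[of W \<beta> K])
    show "openin M W" unfolding W_def by (rule openin_chart_vimage[OF c(1) open_ball])
    show "p \<in> W" using c \<phi>(1) by (simp add: W_def)
    show "\<beta> q = 1" if "q \<in> W" for q using that \<phi>(4) by (simp add: \<beta>_def W_def)
    fix d assume d: "d \<in> \<A>"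
    \<comment> \<open>On \<open>?A\<close> the function is a plateau function read through a change
      of chart, on \<open>?B\<close> it is zero; as \<open>K\<close> lies inside
      \<open>chart_dom c\<close>, nothing is left between them.\<close>
    let ?A = "chart_map d ` (chart_dom d \<inter> (chart_dom c \<inter> topspace M))" and ?B = "chart_map d ` (chart_dom d \<inter> (topspace M - K))"
    have oA: "open ?A" using c d by (intro open_chart_image openin_Int openin_chart_dom openin_topspace)
    have oB: "open ?B" by (intro open_chart_image d openin_diff openin_topspace closedK)
    have "Ck_on 3 (\<lambda>x. \<beta> (chart_inv c x)) (chart_map c ` (chart_dom c \<inter> topspace M))"
      using \<phi>(3)[OF open_chart_image_dom[OF c(1)]] c(1)
      by (simp, subst Ck_on_cong[OF open_chart_image_dom[OF c(1)], of _ \<phi>]) (auto simp: \<beta>_def)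
    from Ck_change_chart[OF c(1) d openin_topspace _ this] have A: "Ck_on 3 (\<lambda>x. \<beta> (chart_inv d x)) ?A" by simp
    have B: "Ck_on 3 (\<lambda>x. \<beta> (chart_inv d x)) ?B"
      by (subst Ck_on_cong[OF oB, of _ "\<lambda>_. 0"]) (use \<beta>0 d in auto)
    have "chart_map d ` chart_dom d \<subseteq> ?A \<union> ?B"
      using dom_subset[OF d] KU by auto
    then show "Ck_on 3 (\<lambda>x. \<beta> (chart_inv d x)) (chart_map d ` chart_dom d)"
      using Ck_on_Un[OF oA oB A B] Ck_on_subset by blast
  qed (use WU closedK KU \<beta>0 in auto)
qed

lemma Ck_tensor_field_cutoff:
  assumes T: "Ck_tensor_field k \<A> U r s T" and U: "openin M U" and K: "closedin M K" "K \<subseteq> U" and k: "k \<le> 3"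
    and \<beta>: "\<And>q. q \<notin> K \<Longrightarrow> \<beta> q = 0" "\<And>d. d \<in> \<A> \<Longrightarrow> Ck_on 3 (\<lambda>x. \<beta> (chart_inv d x)) (chart_map d ` chart_dom d)"
  shows "Ck_tensor_field k \<A> (topspace M) r s (\<lambda>c p is js. \<beta> p * T c p is js)"
proof -
  have TU: "tensor_field \<A> U r s T" using T by (simp add: Ck_tensor_field_def)
  then have Tt: "tensor_field \<A> (topspace M) r s T" using tensor_field_superset openin_subset[OF U] by blast
  have "tensor_field \<A> (topspace M) r s (tprod 0 0 (tfun \<beta>) T)"
    using tensor_field_tprod[OF tensor_field_tfun Tt] by simp
  then have 1: "tensor_field \<A> (topspace M) r s (\<lambda>c p is js. \<beta> p * T c p is js)" by (simp add: tprod_tfun[OF Tt])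
  have "Ck_on k (\<lambda>x. \<beta> (chart_inv d x) * T d (chart_inv d x) is js) (chart_map d ` chart_dom d)" if d: "d \<in> \<A>" for d "is" js
  proof -
    let ?A = "chart_map d ` (chart_dom d \<inter> U)" and ?B = "chart_map d ` (chart_dom d \<inter> (topspace M - K))"
    have oA: "open ?A" by (rule open_chart_image[OF d U])
    have oB: "open ?B" by (intro open_chart_image d openin_diff openin_topspace K)
    have A: "Ck_on k (\<lambda>x. \<beta> (chart_inv d x) * T d (chart_inv d x) is js) ?A"
    proof (rule Ck_on_mult[OF oA])
      show "Ck_on k (\<lambda>x. \<beta> (chart_inv d x)) ?A"
        by (rule Ck_on_subset[OF Ck_on_mono[OF \<beta>(2)[OF d] k]]) blast
      show "Ck_on k (\<lambda>x. T d (chart_inv d x) is js) ?A" using T d by (simp add: Ck_tensor_field_def)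
    qed
    have B: "Ck_on k (\<lambda>x. \<beta> (chart_inv d x) * T d (chart_inv d x) is js) ?B"
      by (subst Ck_on_cong[OF oB, of _ "\<lambda>_. 0"]) (use \<beta>(1) d in auto)
    have "chart_map d ` chart_dom d \<subseteq> ?A \<union> ?B" using dom_subset[OF d] K by auto
    then show ?thesis using Ck_on_Un[OF oA oB A B] Ck_on_subset by blast
  qed
  then show ?thesis using 1 unfolding Ck_tensor_field_def by simp
qed

end

lemma Ck_on_imp_differentiable: "Ck_on k f S \<Longrightarrow> 1 \<le> k \<Longrightarrow> x \<in> S \<Longrightarrow> f differentiable (at x)"
  by (cases k) auto

lemma partial_deriv_sum_mult:
  fixes g h :: "'i \<Rightarrow> real^'n \<Rightarrow> real"
  assumes "\<And>i. i \<in> I \<Longrightarrow> g i differentiable (at x)" "\<And>i. i \<in> I \<Longrightarrow> h i differentiable (at x)"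
  shows "partial_deriv j (\<lambda>x. \<Sum>i\<in>I. g i x * h i x) x =
    (\<Sum>i\<in>I. partial_deriv j (g i) x * h i x + g i x * partial_deriv j (h i) x)"
proof -
  have "((\<lambda>x. \<Sum>i\<in>I. g i x * h i x) has_derivative
      (\<lambda>v. \<Sum>i\<in>I. g i x * frechet_derivative (h i) (at x) v + frechet_derivative (g i) (at x) v * h i x)) (at x)"
    using assms by (intro has_derivative_sum has_derivative_mult) (simp_all add: frechet_derivative_works)
  from partial_deriv_eq[OF this] show ?thesis by (simp add: partial_deriv_def add.commute)
qed

lemma partial_deriv_commute:
  fixes f :: "real^'n \<Rightarrow> real"
  assumes "open S" "x \<in> S" "Ck_on 2 f S"
  shows "partial_deriv i (partial_deriv j f) x = partial_deriv j (partial_deriv i f) x"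
  unfolding partial_deriv_def[abs_def] by (rule frechet_derivative_symmetric[OF assms])

section \<open>Global functions and frames adapted to a point\<close>

context C3_manifold begin

abbreviation tensor :: "nat \<Rightarrow> nat \<Rightarrow> ('m, 'n) tfield \<Rightarrow> bool" where
  "tensor \<equiv> tensor_field \<A> (topspace M)"

abbreviation Ck_tensor :: "nat \<Rightarrow> nat \<Rightarrow> nat \<Rightarrow> ('m, 'n) tfield \<Rightarrow> bool" where
  "Ck_tensor k \<equiv> Ck_tensor_field k \<A> (topspace M)"

lemma Ck_tensor_imp_tensor: "Ck_tensor k r s T \<Longrightarrow> tensor r s T"
  by (rule Ck_tensor_field_imp_tensor_field)

lemma Ck_component: "Ck_tensor k r s T \<Longrightarrow> c \<in> \<A> \<Longrightarrow> Ck_on k (\<lambda>x. T c (chart_inv c x) is js) (chart_map c ` chart_dom c)"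
  unfolding Ck_tensor_field_def by (metis dom_Int_topspace)

lemma vector_in_chart_cong: "p \<in> U \<Longrightarrow> p \<in> U' \<Longrightarrow> (\<And>k. v p k = v' p k) \<Longrightarrow> vector_in_chart c U v d p = vector_in_chart c U' v' d p"
  by (simp add: vector_in_chart_def fun_eq_iff)

text \<open>Exactly what makes the product with a field on \<open>U\<close> a global field of the
  same class; the plateau is recorded separately in \<open>cutoff_at\<close>.\<close>

definition cutoff :: "('m \<Rightarrow> real) \<Rightarrow> 'm set \<Rightarrow> bool" where
  "cutoff \<beta> U \<longleftrightarrow> (\<exists>K. closedin M K \<and> K \<subseteq> U \<and> (\<forall>q. q \<notin> K \<longrightarrow> \<beta> q = 0)) \<and>
     (\<forall>d\<in>\<A>. Ck_on 3 (\<lambda>x. \<beta> (chart_inv d x)) (chart_map d ` chart_dom d))"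

lemma Ck_tensor_cutoff:
  assumes "cutoff \<beta> U" "openin M U" "Ck_tensor_field k \<A> U r s T" "k \<le> 3"
  shows "Ck_tensor k r s (\<lambda>c p is js. \<beta> p * T c p is js)"
proof -
  obtain K where K: "closedin M K" "K \<subseteq> U" "\<forall>q. q \<notin> K \<longrightarrow> \<beta> q = 0"
    using assms(1) unfolding cutoff_def by blast
  show ?thesis
  proof (rule Ck_tensor_field_cutoff[OF assms(3,2) K(1,2) assms(4)])
    show "\<beta> q = 0" if "q \<notin> K" for q using K(3) that by blast
    show "Ck_on 3 (\<lambda>x. \<beta> (chart_inv d x)) (chart_map d ` chart_dom d)" if "d \<in> \<A>" for d
      using assms(1) that unfolding cutoff_def by blast
  qed
qed

lemma cutoff_at:
  assumes "openin M U" "p \<in> U"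
  shows "\<exists>\<beta> W. openin M W \<and> p \<in> W \<and> W \<subseteq> U \<and> (\<forall>q\<in>W. \<beta> q = 1) \<and> cutoff \<beta> U"
proof -
  obtain \<beta> :: "'m \<Rightarrow> real" and W K where W: "openin M W" "p \<in> W" "W \<subseteq> U" "\<And>q. q \<in> W \<Longrightarrow> \<beta> q = 1"
    and K: "closedin M K" "K \<subseteq> U" "\<And>q. q \<notin> K \<Longrightarrow> \<beta> q = 0"
    "\<And>d. d \<in> \<A> \<Longrightarrow> Ck_on 3 (\<lambda>x. \<beta> (chart_inv d x)) (chart_map d ` chart_dom d)"
    using bump_function[OF assms] by metis
  have "cutoff \<beta> U" unfolding cutoff_def using K by (intro conjI exI[of _ K]) simp_all
  then show ?thesis using W by (intro exI[of _ \<beta>] exI[of _ W]) simp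
qed

text \<open>A cut-off coordinate of \<open>d\<close> serves as a global test function: a vector
  field applied to it at \<open>p\<close> yields the component \<open>j\<close> in \<open>d\<close>,
  expressed from any chart \<open>c\<close> by a row of the Jacobian. This gives both tensoriality
  and uniqueness of the Lie bracket.\<close>

lemma coordinate_function:
  assumes d: "d \<in> \<A>" "p \<in> chart_dom d"
  shows "\<exists>f. Ck_tensor 2 0 0 f \<and> (\<forall>c i. c \<in> \<A> \<longrightarrow> p \<in> chart_dom c \<longrightarrow>
     partial_deriv i (\<lambda>x. f c (chart_inv c x) [] []) (chart_map c p) = jacobian c d p j i)"
proof -
  obtain \<beta> W where W: "openin M W" "p \<in> W" "W \<subseteq> chart_dom d" "\<And>q. q \<in> W \<Longrightarrow> \<beta> q = 1"
    and \<beta>: "cutoff \<beta> (chart_dom d)"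
    using cutoff_at[OF openin_chart_dom[OF d(1)] d(2)] by blast
  note cut = Ck_tensor_cutoff[OF \<beta> openin_chart_dom[OF d(1)]]
  define T where "T = (\<lambda>c q is js. if q \<in> chart_dom d then tfun (\<lambda>q. chart_map d q $ j) c q is js else 0)"
  have T: "tensor_field \<A> (chart_dom d) 0 0 T"
    using tensor_field_restrict[OF tensor_field_tfun, of "chart_dom d" "\<lambda>q. chart_map d q $ j"] dom_subset[OF d(1)]
    by (simp add: T_def Int_absorb1)
  have "Ck_tensor_field 2 \<A> (chart_dom d) 0 0 T"
  proof (rule Ck_tensor_field_single_chart[OF T d(1) openin_chart_dom[OF d(1)] subset_refl order_refl])
    fix "is" js :: "'n list"
    note S = open_chart_image_dom[OF d(1)]
    show "Ck_on 2 (\<lambda>x. T d (chart_inv d x) is js) (chart_map d ` chart_dom d)"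
    proof (cases "is = [] \<and> js = []")
      case True
      then show ?thesis
        using Ck_on_bounded_linear[OF bounded_linear_vec_nth S, of 2 j]
        by (subst Ck_on_cong[OF S, of _ "\<lambda>x. x $ j"]) (use d in \<open>auto simp: T_def tfun_def\<close>)
    next
      case False
      then have "(\<lambda>x. T d (chart_inv d x) is js) = (\<lambda>_. 0)" by (auto simp: T_def tfun_def)
      then show ?thesis by simp
    qed
  qed
  from cut[OF this] have f: "Ck_tensor 2 0 0 (\<lambda>c p is js. \<beta> p * T c p is js)" by simp
  show ?thesis
  proof (intro exI conjI allI impI)
    show "Ck_tensor 2 0 0 (\<lambda>c p is js. \<beta> p * T c p is js)" by (rule f)
    fix c i assume c: "c \<in> \<A>" "p \<in> chart_dom c"
    have "partial_deriv i (\<lambda>x. \<beta> (chart_inv c x) * T c (chart_inv c x) [] []) (chart_map c p)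
      = partial_deriv i (\<lambda>x. transition c d x $ j) (chart_map c p)"
      by (rule partial_deriv_cong[OF open_chart_image[OF c(1) W(1)]])
        (use c W in \<open>auto simp: T_def tfun_def transition_eq\<close>)
    also have "\<dots> = jacobian c d p j i"
      unfolding jacobian_def using transition_has_derivative[OF c(1) d(1) c(2) d(2)]
      by (intro partial_deriv_vec_nth) (auto simp: differentiable_def)
    finally show "partial_deriv i (\<lambda>x. \<beta> (chart_inv c x) * T c (chart_inv c x) [] []) (chart_map c p) = jacobian c d p j i" .
  qed
qed

text \<open>Class 2 rather than 1 is what makes the covariant derivatives of \<open>X i\<close> and
  \<open>\<theta> l\<close> along the frame fields themselves of class 1, so that \<open>D\<close>
  can be applied again.\<close>

lemma coordinate_frame:
  assumes "p \<in> topspace M"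
  obtains c W X \<theta> where "c \<in> \<A>" "openin M W" "p \<in> W" "W \<subseteq> chart_dom c"
    "\<And>i. Ck_tensor 2 1 0 (X i)" "\<And>l. Ck_tensor 2 0 1 (\<theta> l)"
    "\<And>q i j. q \<in> W \<Longrightarrow> X i c q [j] [] = (if j = i then 1 else 0)"
    "\<And>q l k. q \<in> W \<Longrightarrow> \<theta> l c q [] [k] = (if k = l then 1 else 0)"
proof -
  obtain c where c: "c \<in> \<A>" "p \<in> chart_dom c" using assms topspace_eq by blast
  obtain \<beta> W where W: "openin M W" "p \<in> W" "W \<subseteq> chart_dom c" "\<And>q. q \<in> W \<Longrightarrow> \<beta> q = 1"
    and \<beta>: "cutoff \<beta> (chart_dom c)"
    using cutoff_at[OF openin_chart_dom[OF c(1)] c(2)] by blast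
  note cut = Ck_tensor_cutoff[OF \<beta> openin_chart_dom[OF c(1)]]
  let ?e = "\<lambda>i (q::'m) j. if j = i then 1 else (0::real)"
  let ?X = "\<lambda>i d q is js. \<beta> q * vector_in_chart c (chart_dom c) (?e i) d q is js"
  let ?\<theta> = "\<lambda>i d q is js. \<beta> q * covector_in_chart c (chart_dom c) (?e i) d q is js"
  show thesis
  proof (rule that[OF c(1) W(1-3), of ?X ?\<theta>])
    show "Ck_tensor 2 1 0 (?X i)" "Ck_tensor 2 0 1 (?\<theta> i)" for i
      using cut[OF Ck_vector_in_chart[OF c(1) openin_chart_dom[OF c(1)] subset_refl order_refl, of "?e i"]]
        cut[OF Ck_covector_in_chart[OF c(1) openin_chart_dom[OF c(1)] subset_refl order_refl, of "?e i"]] by simp_all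
    show "?X i c q [j] [] = (if j = i then 1 else 0)" "?\<theta> i c q [] [j] = (if j = i then 1 else 0)" if "q \<in> W" for q i j
      using that W c(1) vector_in_chart_same[of c q "chart_dom c" "?e i" j] covector_in_chart_same[of c q "chart_dom c" "?e i" j] by auto
  qed
qed

end

section \<open>Linear connections\<close>

locale C1_connection = C3_manifold M \<A> for M :: "'m topology" and \<A> :: "('m, 'n::finite) chart set" +
  fixes D :: "('m, 'n) connection"
  assumes linear_connection: "linear_connection M \<A> D" and C1: "Ck_connection 1 M \<A> D"
begin

lemmas D_axioms = linear_connection[unfolded linear_connection_def, THEN conjunct1, THEN spec, THEN mp]

lemma D_tensor: "tensor 1 0 V \<Longrightarrow> Ck_tensor 1 r s T \<Longrightarrow> tensor r s (D V T)"
  using D_axioms[THEN conjunct1, of V] by blast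

lemma D_tadd: "tensor 1 0 V \<Longrightarrow> Ck_tensor 1 r s S \<Longrightarrow> Ck_tensor 1 r s T \<Longrightarrow> D V (tadd S T) = tadd (D V S) (D V T)"
  using D_axioms[THEN conjunct2, THEN conjunct1, of V] by blast

lemma D_contract: "tensor 1 0 V \<Longrightarrow> Ck_tensor 1 (Suc r) (Suc s) T \<Longrightarrow> D V (contract 0 0 T) = contract 0 0 (D V T)"
  using D_axioms[THEN conjunct2, THEN conjunct2, THEN conjunct1, of V] by blast

lemma D_tprod: "tensor 1 0 V \<Longrightarrow> Ck_tensor 1 r s S \<Longrightarrow> Ck_tensor 1 r' s' T \<Longrightarrow>
    D V (tprod r s S T) = tadd (tprod r s (D V S) T) (tprod r s S (D V T))"
  using D_axioms[THEN conjunct2, THEN conjunct2, THEN conjunct2, THEN conjunct1, of V] by blast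

lemma D_fun: "tensor 1 0 V \<Longrightarrow> Ck_tensor 1 0 0 f \<Longrightarrow> D V f = vf_apply V f"
  using linear_connection unfolding linear_connection_def by blast

lemma D_tadd_left: "tensor 1 0 V \<Longrightarrow> tensor 1 0 W \<Longrightarrow> Ck_tensor 1 r s T \<Longrightarrow> D (tadd V W) T = tadd (D V T) (D W T)"
  using linear_connection unfolding linear_connection_def by blast

lemma D_tprod_left: "tensor 0 0 f \<Longrightarrow> tensor 1 0 V \<Longrightarrow> Ck_tensor 1 r s T \<Longrightarrow> D (tprod 0 0 f V) T = tprod 0 0 f (D V T)"
  using linear_connection unfolding linear_connection_def by blast

lemma D_C1: "Ck_tensor 1 1 0 V \<Longrightarrow> Ck_tensor 2 r s T \<Longrightarrow> Ck_tensor 1 r s (D V T)"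
  using C1 unfolding Ck_connection_def by (metis Suc_1)

lemma C2_imp_C1: "Ck_tensor 2 r s T \<Longrightarrow> Ck_tensor 1 r s T"
  by (erule Ck_tensor_field_mono) simp

text \<open>No regularity is asked of the functions in the first argument, so indicator functions
  of points are allowed there.\<close>

lemma D_cong_left:
  assumes V: "tensor 1 0 V" "tensor 1 0 V'" and T: "Ck_tensor 1 r s T" and eq: "\<And>d. V d q = V' d q"
  shows "D V T d q = D V' T d q"
proof -
  let ?f = "tfun (\<lambda>p. if p = q then 1 else 0)"
  have "tprod 0 0 ?f V = tprod 0 0 ?f V'"
    unfolding tprod_tfun[OF V(1)] tprod_tfun[OF V(2)] using eq by (auto simp: fun_eq_iff)
  then have "tprod 0 0 ?f (D V T) = tprod 0 0 ?f (D V' T)"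
    using D_tprod_left[OF tensor_field_tfun V(1) T] D_tprod_left[OF tensor_field_tfun V(2) T] by metis
  then have "tprod 0 0 ?f (D V T) d q = tprod 0 0 ?f (D V' T) d q" by simp
  then show ?thesis
    unfolding tprod_tfun[OF D_tensor[OF V(1) T]] tprod_tfun[OF D_tensor[OF V(2) T]] by simp
qed

text \<open>Only the vector at \<open>q\<close> matters, so a vector \<open>v\<close> may be
  represented by the field \<open>P v\<close> supported at the single point \<open>q\<close>,
  discontinuous as it is; linearity of \<open>P\<close> then passes to \<open>D\<close>.\<close>

lemma D_pointwise_linear:
  assumes c: "c \<in> \<A>" "q \<in> chart_dom c" and T: "Ck_tensor 1 r s T"
  shows "\<exists>L. linear L \<and> (\<forall>V. tensor 1 0 V \<longrightarrow> D V T d q is js = L (\<chi> i. V c q [i] []))"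
proof -
  define P where "P v = vector_in_chart c {q} (\<lambda>_ i. v $ i)" for v :: "real^'n"
  have P: "tensor 1 0 (P v)" for v
    unfolding P_def
    by (rule tensor_field_superset[OF tensor_field_vector_in_chart]) (use c dom_subset[OF c(1)] in auto)
  define L where "L v = D (P v) T d q is js" for v
  have "linear L"
  proof (rule linearI)
    fix v w :: "real^'n" and a :: real
    have "P (v + w) = tadd (P v) (P w)"
      by (intro ext) (auto simp: P_def vector_in_chart_def tadd_def distrib_left sum.distrib)
    then show "L (v + w) = L v + L w" using D_tadd_left[OF P P T] by (simp add: L_def tadd_def)
    have "P (a *\<^sub>R v) = tprod 0 0 (tfun (\<lambda>_. a)) (P v)"
      unfolding tprod_tfun[OF P] by (intro ext) (auto simp: P_def vector_in_chart_def sum_distrib_left mult_ac)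
    then show "L (a *\<^sub>R v) = a *\<^sub>R L v"
      using D_tprod_left[OF tensor_field_tfun P T] tprod_tfun[OF D_tensor[OF P T]] by (simp add: L_def)
  qed
  moreover have "D V T d q is js = L (\<chi> i. V c q [i] [])" if V: "tensor 1 0 V" for V
  proof -
    have "V e q = P (\<chi> i. V c q [i] []) e q" for e
    proof -
      have q: "q \<in> topspace M" using c dom_subset by blast
      have "V e q = vector_in_chart c (topspace M) (\<lambda>p i. V c q [i] []) e q"
        by (rule vector_in_chart_unique[OF c q V]) simp
      also have "\<dots> = P (\<chi> i. V c q [i] []) e q"
        unfolding P_def by (rule vector_in_chart_cong[OF q]) simp_all
      finally show ?thesis .
    qed
    then show ?thesis unfolding L_def by (rule D_cong_left[OF V P T, THEN fun_cong, THEN fun_cong])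
  qed
  ultimately show ?thesis by blast
qed

lemma D_frame_expansion:
  assumes c: "c \<in> \<A>" "q \<in> chart_dom c" and T: "Ck_tensor 1 r s T" and V: "tensor 1 0 V"
    and X: "\<And>i. tensor 1 0 (X i)" "\<And>i j. X i c q [j] [] = (if j = i then 1 else 0)"
  shows "D V T d q is js = (\<Sum>i\<in>UNIV. V c q [i] [] * D (X i) T d q is js)"
proof -
  obtain L where L: "linear L" "\<And>V. tensor 1 0 V \<Longrightarrow> D V T d q is js = L (\<chi> i. V c q [i] [])"
    using D_pointwise_linear[OF c T] by blast
  have "(\<chi> j. X i c q [j] []) = axis i 1" for i
    by (simp add: vec_eq_iff X(2) axis_def)
  then have "L (axis i 1) = D (X i) T d q is js" for i using L(2)[OF X(1)] by simp
  then show ?thesis using linear_axis_expansion[OF L(1), of "\<chi> i. V c q [i] []"] L(2)[OF V] by simp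
qed

lemma D_zero_left:
  assumes "c \<in> \<A>" "q \<in> chart_dom c" "Ck_tensor 1 r s T" "tensor 1 0 V" "\<And>i. V c q [i] [] = 0"
  shows "D V T d q is js = 0"
proof -
  obtain L where L: "linear L" "\<And>V. tensor 1 0 V \<Longrightarrow> D V T d q is js = L (\<chi> i. V c q [i] [])"
    using D_pointwise_linear[OF assms(1-3)] by blast
  have "(\<chi> i. V c q [i] []) = 0" by (simp add: vec_eq_iff assms(5))
  then show ?thesis using L(2)[OF assms(4)] linear_0[OF L(1)] by simp
qed

text \<open>With a plateau function \<beta> supported in \<open>W\<close>, the products of \<beta>
  with \<open>T\<close> and \<open>T'\<close> coincide globally. In the Leibniz rule the terms with
  the derivative of \<beta> agree at \<open>q\<close>, since \<open>T\<close> and \<open>T'\<close>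
  do, and \<beta> is 1 there.\<close>

lemma D_local:
  assumes V: "tensor 1 0 V" and T: "Ck_tensor 1 r s T" "Ck_tensor 1 r s T'"
    and W: "openin M W" "q \<in> W" and eq: "\<And>d p. p \<in> W \<Longrightarrow> T d p = T' d p"
  shows "D V T d q = D V T' d q"
proof -
  obtain \<beta> :: "'m \<Rightarrow> real" and W' K where \<beta>: "q \<in> W'" "\<And>q. q \<in> W' \<Longrightarrow> \<beta> q = 1"
    "K \<subseteq> W" "\<And>q. q \<notin> K \<Longrightarrow> \<beta> q = 0"
    "\<And>d. d \<in> \<A> \<Longrightarrow> Ck_on 3 (\<lambda>x. \<beta> (chart_inv d x)) (chart_map d ` chart_dom d)"
    using bump_function[OF W] by metis
  let ?f = "tfun \<beta>"
  have f: "Ck_tensor 1 0 0 ?f" by (intro Ck_tfun Ck_on_mono[OF \<beta>(5)]) auto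
  have tT: "tensor r s T" "tensor r s T'" using T Ck_tensor_imp_tensor by auto
  have eqT: "tprod 0 0 ?f T = tprod 0 0 ?f T'"
  proof -
    have "\<beta> p * T d p is js = \<beta> p * T' d p is js" for d p "is" js
      using eq[of p d] \<beta>(3,4) by (cases "p \<in> K") auto
    then show ?thesis unfolding tprod_tfun[OF tT(1)] tprod_tfun[OF tT(2)] by (intro ext)
  qed
  have "tadd (tprod 0 0 (D V ?f) T) (tprod 0 0 ?f (D V T)) = tadd (tprod 0 0 (D V ?f) T') (tprod 0 0 ?f (D V T'))"
    using D_tprod[OF V f T(1)] D_tprod[OF V f T(2)] eqT by simp
  then have "tadd (tprod 0 0 (D V ?f) T) (tprod 0 0 ?f (D V T)) d q is js
    = tadd (tprod 0 0 (D V ?f) T') (tprod 0 0 ?f (D V T')) d q is js" for "is" js by simp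
  then have "D V ?f d q [] [] * T d q is js + \<beta> q * D V T d q is js = D V ?f d q [] [] * T' d q is js + \<beta> q * D V T' d q is js" for "is" js
    unfolding tprod_tfun[OF D_tensor[OF V T(1)]] tprod_tfun[OF D_tensor[OF V T(2)]] by (simp add: tadd_def tprod_def)
  then have "D V T d q is js = D V T' d q is js" for "is" js
    using eq[OF W(2), of d] \<beta>(1,2) by simp
  then show ?thesis by blast
qed

lemma D_local_zero:
  assumes V: "tensor 1 0 V" and T: "Ck_tensor 1 r s T"
    and W: "openin M W" "q \<in> W" and z: "\<And>d p is js. p \<in> W \<Longrightarrow> T d p is js = 0"
  shows "D V T d q is js = 0"
proof -
  have z0: "Ck_tensor 1 r s tzero" by (rule Ck_tensor_field_tzero)
  have "tadd tzero tzero = (tzero :: ('m, 'n) tfield)" by (simp add: tadd_def tzero_def)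
  then have "D V tzero = tadd (D V tzero) (D V tzero)" using D_tadd[OF V z0 z0] by simp
  then have "D V tzero d q is js = D V tzero d q is js + D V tzero d q is js" unfolding tadd_def by metis
  then have "D V tzero d q is js = 0" by simp
  moreover have "T d p = tzero d p" if "p \<in> W" for d p
    by (intro ext) (simp add: tzero_def z[OF that])
  ultimately show ?thesis using D_local[OF V T z0 W] by simp
qed

text \<open>Pairing with \<open>\<theta>\<close> isolates the component \<open>l\<close> of
  \<open>T\<close> near \<open>q\<close>. The connection coefficients thus enter as components of
  \<open>D V \<theta>\<close>, for a covector field fixed in advance and independent of
  \<open>T\<close>.\<close>

lemma covariant_derivative_formula:
  assumes c: "c \<in> \<A>" and W: "openin M W" "W \<subseteq> chart_dom c" "q \<in> W"
    and \<theta>: "Ck_tensor 1 0 1 \<theta>" "\<And>p k. p \<in> W \<Longrightarrow> \<theta> c p [] [k] = (if k = l then 1 else 0)"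
    and T: "Ck_tensor 1 1 0 T" and V: "tensor 1 0 V"
  shows "D V T c q [l] [] = (\<Sum>i\<in>UNIV. V c q [i] [] * partial_deriv i (\<lambda>x. T c (chart_inv c x) [l] []) (chart_map c q))
    - (\<Sum>k\<in>UNIV. D V \<theta> c q [] [k] * T c q [k] [])"
proof -
  let ?P = "tprod 0 1 \<theta> T"
  have P: "Ck_tensor 1 (Suc 0) (Suc 0) ?P"
    using Ck_tensor_field_tprod[OF openin_topspace \<theta>(1) T] by simp
  have eval: "contract 0 0 (tprod 0 1 \<omega> S) c p [] [] = (\<Sum>k\<in>UNIV. \<omega> c p [] [k] * S c p [k] [])" for \<omega> S :: "('m, 'n) tfield" and p
    by (simp add: contract_0_0 tprod_def)
  have diag: "(\<Sum>k\<in>UNIV. \<theta> c p [] [k] * S k) = S l" if "p \<in> W" for S and p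
    by (simp add: \<theta>(2)[OF that] if_distrib[of "\<lambda>x. x * _"] cong: if_cong)
  have S: "open (chart_map c ` W)" using open_chart_image[OF c W(1)] W(2) by (simp add: Int_absorb1)
  have "vf_apply V (contract 0 0 ?P) = contract 0 0 (tadd (tprod 0 1 (D V \<theta>) T) (tprod 0 1 \<theta> (D V T)))"
    using D_fun[OF V Ck_tensor_field_contract[OF openin_topspace P]] D_contract[OF V P] D_tprod[OF V \<theta>(1) T] by simp
  then have "vf_apply V (contract 0 0 ?P) c q [] [] = contract 0 0 (tprod 0 1 (D V \<theta>) T) c q [] [] + contract 0 0 (tprod 0 1 \<theta> (D V T)) c q [] []"
    by (simp add: contract_0_0 tadd_def sum.distrib)
  also have "\<dots> = (\<Sum>k\<in>UNIV. D V \<theta> c q [] [k] * T c q [k] []) + D V T c q [l] []"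
    unfolding eval using diag[OF W(3), of "\<lambda>k. D V T c q [k] []"] by simp
  also have "vf_apply V (contract 0 0 ?P) c q [] [] = (\<Sum>i\<in>UNIV. V c q [i] [] * partial_deriv i (\<lambda>x. T c (chart_inv c x) [l] []) (chart_map c q))"
  proof -
    have "partial_deriv i (\<lambda>x. contract 0 0 ?P c (chart_inv c x) [] []) (chart_map c q)
      = partial_deriv i (\<lambda>x. T c (chart_inv c x) [l] []) (chart_map c q)" for i
    proof (rule partial_deriv_cong[OF S])
      fix x assume "x \<in> chart_map c ` W"
      then obtain p where p: "p \<in> W" "x = chart_map c p" by blast
      then have "chart_inv c x = p" using c W(2) by auto
      then show "contract 0 0 ?P c (chart_inv c x) [] [] = T c (chart_inv c x) [l] []"
        unfolding eval using diag[OF p(1), of "\<lambda>k. T c p [k] []"] by simp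
    qed (use W in blast)
    then show ?thesis by (simp add: vf_apply_def)
  qed
  finally show ?thesis by simp
qed

section \<open>Lie brackets and curvature\<close>

text \<open>The coordinate expression of the Lie bracket. It is kept apart from
  \<open>lie_bracket\<close>, which is described by its action on functions; that the expression
  transforms as a vector is still to be shown.\<close>

definition bracket :: "('m, 'n) tfield \<Rightarrow> ('m, 'n) tfield \<Rightarrow> ('m, 'n) chart \<Rightarrow> 'm \<Rightarrow> 'n \<Rightarrow> real" where
  "bracket X Y c p i = (\<Sum>j\<in>UNIV.
     X c p [j] [] * partial_deriv j (\<lambda>x. Y c (chart_inv c x) [i] []) (chart_map c p) -
     Y c p [j] [] * partial_deriv j (\<lambda>x. X c (chart_inv c x) [i] []) (chart_map c p))"

text \<open>The second derivatives of \<open>f\<close> cancel by symmetry, which leaves a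
  first-order operator.\<close>

lemma commutator_in_chart:
  assumes X: "Ck_tensor 1 1 0 X" and Y: "Ck_tensor 1 1 0 Y" and f: "Ck_tensor 2 0 0 f" and c: "c \<in> \<A>" "p \<in> chart_dom c"
  shows "tdiff (vf_apply X (vf_apply Y f)) (vf_apply Y (vf_apply X f)) c p [] [] =
    (\<Sum>i\<in>UNIV. bracket X Y c p i * partial_deriv i (\<lambda>x. f c (chart_inv c x) [] []) (chart_map c p))"
proof -
  let ?S = "chart_map c ` chart_dom c" and ?x = "chart_map c p"
  let ?f = "\<lambda>x. f c (chart_inv c x) [] []"
  have S: "open ?S" "?x \<in> ?S" using c open_chart_image_dom by auto
  have f2: "Ck_on 2 ?f ?S" using Ck_component[OF f c(1)] .
  then have f2': "Ck_on (Suc 1) ?f ?S" by (simp only: numeral_2_eq_2 One_nat_def)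
  have df: "partial_deriv i ?f differentiable at ?x" for i
    by (rule Ck_on_imp_differentiable[OF Ck_on_partial_deriv[OF f2'] order_refl S(2)])
  have second: "vf_apply A (vf_apply B f) c p [] [] =
     (\<Sum>j\<in>UNIV. \<Sum>i\<in>UNIV. A c p [j] [] * partial_deriv j (\<lambda>x. B c (chart_inv c x) [i] []) ?x * partial_deriv i ?f ?x)
     + (\<Sum>j\<in>UNIV. \<Sum>i\<in>UNIV. A c p [j] [] * B c p [i] [] * partial_deriv j (partial_deriv i ?f) ?x)"
    if B: "Ck_tensor 1 1 0 B" for A B
  proof -
    have dB: "(\<lambda>x. B c (chart_inv c x) [i] []) differentiable at ?x" for i
      by (rule Ck_on_imp_differentiable[OF Ck_component[OF B c(1)] order_refl S(2)])
    have "partial_deriv j (\<lambda>x. vf_apply B f c (chart_inv c x) [] []) ?x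
      = partial_deriv j (\<lambda>x. \<Sum>i\<in>UNIV. B c (chart_inv c x) [i] [] * partial_deriv i ?f x) ?x" for j
      by (rule partial_deriv_cong[OF S]) (use c in \<open>auto simp: vf_apply_def\<close>)
    also have "\<dots> j = (\<Sum>i\<in>UNIV. partial_deriv j (\<lambda>x. B c (chart_inv c x) [i] []) ?x * partial_deriv i ?f ?x
       + B c p [i] [] * partial_deriv j (partial_deriv i ?f) ?x)" for j
      using partial_deriv_sum_mult[of UNIV "\<lambda>i x. B c (chart_inv c x) [i] []" ?x "\<lambda>i. partial_deriv i ?f" j] dB df c by simp
    finally show ?thesis
      unfolding vf_apply_def[of A] by (simp add: sum_distrib_left sum.distrib distrib_left mult.assoc)
  qed
  have sym: "(\<Sum>j\<in>UNIV. \<Sum>i\<in>UNIV. Y c p [j] [] * X c p [i] [] * partial_deriv j (partial_deriv i ?f) ?x)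
    = (\<Sum>j\<in>UNIV. \<Sum>i\<in>UNIV. X c p [j] [] * Y c p [i] [] * partial_deriv j (partial_deriv i ?f) ?x)"
    by (subst sum.swap) (simp add: partial_deriv_commute[OF S f2] mult_ac)
  have "tdiff (vf_apply X (vf_apply Y f)) (vf_apply Y (vf_apply X f)) c p [] [] =
    (\<Sum>j\<in>UNIV. \<Sum>i\<in>UNIV. X c p [j] [] * partial_deriv j (\<lambda>x. Y c (chart_inv c x) [i] []) ?x * partial_deriv i ?f ?x)
    - (\<Sum>j\<in>UNIV. \<Sum>i\<in>UNIV. Y c p [j] [] * partial_deriv j (\<lambda>x. X c (chart_inv c x) [i] []) ?x * partial_deriv i ?f ?x)"
    unfolding tdiff_def second[OF X] second[OF Y] sym by simp
  also have "\<dots> = (\<Sum>i\<in>UNIV. bracket X Y c p i * partial_deriv i ?f ?x)"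
    unfolding bracket_def sum_distrib_right left_diff_distrib sum_subtractf by (subst (1 2) sum.swap) (rule refl)
  finally show ?thesis .
qed

text \<open>The definite description is proper: the coordinate expression satisfies it, and cut-off
  coordinates as test functions determine a vector field from its action on functions.\<close>

lemma lie_bracket:
  assumes X: "Ck_tensor 1 1 0 X" and Y: "Ck_tensor 1 1 0 Y"
  shows tensor_lie_bracket: "tensor 1 0 (lie_bracket M \<A> X Y)"
    and lie_bracket_apply: "\<And>f. Ck_tensor 2 0 0 f \<Longrightarrow>
       vf_apply (lie_bracket M \<A> X Y) f = tdiff (vf_apply X (vf_apply Y f)) (vf_apply Y (vf_apply X f))"
    and lie_bracket_in_chart: "\<And>c p i. c \<in> \<A> \<Longrightarrow> p \<in> chart_dom c \<Longrightarrow> lie_bracket M \<A> X Y c p [i] [] = bracket X Y c p i"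
proof -
  let ?C = "\<lambda>f. tdiff (vf_apply X (vf_apply Y f)) (vf_apply Y (vf_apply X f))"
  define Q where "Q Z \<longleftrightarrow> tensor 1 0 Z \<and> (\<forall>f. Ck_tensor 2 0 0 f \<longrightarrow> vf_apply Z f = ?C f)" for Z
  have tX: "tensor 1 0 X" "tensor 1 0 Y" using X Y Ck_tensor_imp_tensor by blast+
  \<comment> \<open>The connection does this work: on functions \<open>D\<close> is
    \<open>vf_apply\<close>, it keeps the tensor type, and \<open>D_C1\<close> makes the first
    derivative regular enough for the second.\<close>
  have tC: "tensor 0 0 (?C f)" if f: "Ck_tensor 2 0 0 f" for f
    using tensor_field_tdiff[OF D_tensor[OF tX(1) D_C1[OF Y f]] D_tensor[OF tX(2) D_C1[OF X f]]]
      D_fun[OF tX(1) D_C1[OF Y f]] D_fun[OF tX(2) D_C1[OF X f]] D_fun[OF tX(1) C2_imp_C1[OF f]] D_fun[OF tX(2) C2_imp_C1[OF f]]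
    by simp
  define Z :: "('m, 'n) tfield" where "Z = (\<lambda>c p is js. if c \<in> \<A> \<and> p \<in> chart_dom c \<and> length is = 1 \<and> js = [] then bracket X Y c p (hd is) else 0)"
  have Z_chart: "Z c p [i] [] = bracket X Y c p i" if "c \<in> \<A>" "p \<in> chart_dom c" for c p i
    using that by (simp add: Z_def)
  have Z_tensor: "tensor 1 0 Z"
  proof (rule tensor_fieldI)
    fix c d p and "is" js :: "'n list"
    assume *: "c \<in> \<A>" "d \<in> \<A>" "p \<in> chart_dom c" "p \<in> chart_dom d" "p \<in> topspace M" "length is = 1" "length js = 0"
    then obtain i where i: "is = [i]" by (auto simp: length_Suc_conv)
    obtain f where f: "Ck_tensor 2 0 0 f" "\<And>c k. c \<in> \<A> \<Longrightarrow> p \<in> chart_dom c \<Longrightarrow>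
       partial_deriv k (\<lambda>x. f c (chart_inv c x) [] []) (chart_map c p) = jacobian c d p i k"
      using coordinate_function[OF *(2,4), where j = i] by blast
    \<comment> \<open>The commutator applied to the coordinate \<open>i\<close> of \<open>d\<close>
      is a scalar. Evaluated in \<open>d\<close> it gives one component of the bracket, evaluated in
      \<open>c\<close> the transformed components.\<close>
    have "bracket X Y d p i = ?C f d p [] []"
      unfolding commutator_in_chart[OF X Y f(1) *(2,4)] f(2)[OF *(2,4)] jacobian_refl[OF *(2,4)]
      by (simp add: if_distrib[of "\<lambda>x. _ * x"] cong: if_cong)
    also have "\<dots> = ?C f c p [] []"
      using tensor_field_transform[OF tC[OF f(1)] *(1,2), of p "[]" "[]"] * by simp
    also have "\<dots> = (\<Sum>k\<in>UNIV. jacobian c d p i k * bracket X Y c p k)"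
      unfolding commutator_in_chart[OF X Y f(1) *(1,3)] f(2)[OF *(1,3)] by (simp add: mult.commute)
    finally show "Z d p is js = (\<Sum>ks | length ks = 1. \<Sum>ls | length ls = 0.
      jprod (jacobian c d p) is ks * jprod (jacobian d c p) ls js * Z c p ks ls)"
      using * i by (simp add: Z_def sum_lists_Suc)
  qed (use dom_subset in \<open>auto simp: Z_def\<close>)
  have Z_apply: "vf_apply Z f = ?C f" if f: "Ck_tensor 2 0 0 f" for f
  proof (intro ext)
    fix c p and "is" js :: "'n list"
    show "vf_apply Z f c p is js = ?C f c p is js"
    proof (cases "c \<in> \<A> \<and> p \<in> chart_dom c \<and> is = [] \<and> js = []")
      case True
      then show ?thesis using commutator_in_chart[OF X Y f, of c p] by (simp add: vf_apply_def Z_chart)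
    next
      case False
      then have "?C f c p is js = 0" using tensor_field_eq_0[OF tC[OF f], of c p "is" js] by auto
      moreover have "vf_apply Z f c p is js = 0" using False by (auto simp: vf_apply_def Z_def)
      ultimately show ?thesis by simp
    qed
  qed
  have unique: "Z' = Z" if "Q Z'" for Z'
  proof (intro ext)
    fix c p and "is" js :: "'n list"
    show "Z' c p is js = Z c p is js"
    proof (cases "c \<in> \<A> \<and> p \<in> chart_dom c \<and> length is = 1 \<and> js = []")
      case True
      then obtain i where i: "is = [i]" "js = []" and c: "c \<in> \<A>" "p \<in> chart_dom c" by (auto simp: length_Suc_conv)
      obtain f where f: "Ck_tensor 2 0 0 f" "\<And>c' k. c' \<in> \<A> \<Longrightarrow> p \<in> chart_dom c' \<Longrightarrow>
         partial_deriv k (\<lambda>x. f c' (chart_inv c' x) [] []) (chart_map c' p) = jacobian c' c p i k"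
        using coordinate_function[OF c, where j = i] by blast
      have ev: "vf_apply V f c p [] [] = V c p [i] []" for V
        unfolding vf_apply_def f(2)[OF c] jacobian_refl[OF c] by (simp add: if_distrib[of "\<lambda>x. _ * x"] cong: if_cong)
      have "vf_apply Z' f = vf_apply Z f" using that f(1) Z_apply by (simp add: Q_def)
      then show ?thesis using ev[of Z'] ev[of Z] i by simp
    next
      case False
      then have "Z' c p is js = 0" using tensor_field_eq_0[of \<A> "topspace M" 1 0 Z' c p "is" js] that unfolding Q_def by auto
      moreover have "Z c p is js = 0" using tensor_field_eq_0[OF Z_tensor, of c p "is" js] False by auto
      ultimately show ?thesis by simp
    qed
  qed
  have "lie_bracket M \<A> X Y = (THE Z. Q Z)" unfolding lie_bracket_def Q_def ..
  also have "\<dots> = Z" by (rule the_equality) (use Z_tensor Z_apply unique in \<open>auto simp: Q_def\<close>)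
  finally have eq: "lie_bracket M \<A> X Y = Z" .
  show "tensor 1 0 (lie_bracket M \<A> X Y)" unfolding eq by (rule Z_tensor)
  show "vf_apply (lie_bracket M \<A> X Y) f = ?C f" if "Ck_tensor 2 0 0 f" for f unfolding eq by (rule Z_apply[OF that])
  show "lie_bracket M \<A> X Y c p [i] [] = bracket X Y c p i" if "c \<in> \<A>" "p \<in> chart_dom c" for c p i
    unfolding eq by (rule Z_chart[OF that])
qed

end

section \<open>The curvature operator as a derivation of the tensor algebra\<close>

locale C1_connection_with_fields = C1_connection M \<A> D
  for M :: "'m topology" and \<A> :: "('m, 'n::finite) chart set" and D :: "('m, 'n) connection" +
  fixes X Y :: "('m, 'n) tfield"
  assumes X: "Ck_tensor 1 1 0 X" and Y: "Ck_tensor 1 1 0 Y"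
begin

abbreviation R :: "('m, 'n) tfield \<Rightarrow> ('m, 'n) tfield" where
  "R \<equiv> curvature M \<A> D X Y"

lemma tensor_X: "tensor 1 0 X" and tensor_Y: "tensor 1 0 Y"
  using X Y Ck_tensor_imp_tensor by blast+

lemma tensor_bracket: "tensor 1 0 (lie_bracket M \<A> X Y)"
  by (rule tensor_lie_bracket[OF X Y])

lemma tensor_R: "Ck_tensor 2 r s T \<Longrightarrow> tensor r s (R T)"
  unfolding curvature_def
  by (intro tensor_field_tdiff D_tensor tensor_X tensor_Y tensor_bracket D_C1 X Y C2_imp_C1)

text \<open>On functions \<open>D\<close> acts as \<open>vf_apply\<close>, so this is the property
  that characterizes the bracket.\<close>

lemma R_fun: "Ck_tensor 2 0 0 f \<Longrightarrow> R f = tzero"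
  unfolding curvature_def
  using D_fun[OF tensor_X D_C1[OF Y]] D_fun[OF tensor_Y D_C1[OF X]] D_fun[OF tensor_X C2_imp_C1] D_fun[OF tensor_Y C2_imp_C1]
    D_fun[OF tensor_bracket C2_imp_C1] lie_bracket_apply[OF X Y]
  by (simp add: tdiff_def tzero_def)

lemma R_contract:
  assumes T: "Ck_tensor 2 (Suc r) (Suc s) T" shows "R (contract 0 0 T) = contract 0 0 (R T)"
proof -
  note c = D_contract[OF tensor_X C2_imp_C1[OF T]] D_contract[OF tensor_Y C2_imp_C1[OF T]]
    D_contract[OF tensor_bracket C2_imp_C1[OF T]] D_contract[OF tensor_X D_C1[OF Y T]] D_contract[OF tensor_Y D_C1[OF X T]]
  show ?thesis unfolding curvature_def c by (simp add: tdiff_def contract_0_0 fun_eq_iff sum_subtractf)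
qed

text \<open>A second derivative of a product has mixed terms symmetric in \<open>X\<close> and
  \<open>Y\<close>; they cancel in the commutator.\<close>

lemma R_tprod:
  assumes S: "Ck_tensor 2 r s S" and T: "Ck_tensor 2 r' s' T"
  shows "R (tprod r s S T) = tadd (tprod r s (R S) T) (tprod r s S (R T))"
proof -
  note S1 = C2_imp_C1[OF S] and T1 = C2_imp_C1[OF T]
  have p: "Ck_tensor 1 (r + r') (s + s') (tprod r s A B)" if "Ck_tensor 1 r s A" "Ck_tensor 1 r' s' B" for A B
    using Ck_tensor_field_tprod[OF openin_topspace that] .
  have DD: "D V (D V' (tprod r s S T)) =
     tadd (tadd (tprod r s (D V (D V' S)) T) (tprod r s (D V' S) (D V T))) (tadd (tprod r s (D V S) (D V' T)) (tprod r s S (D V (D V' T))))"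
    if V: "tensor 1 0 V" and V': "Ck_tensor 1 1 0 V'" for V V'
  proof -
    note 1 = D_C1[OF V' S] and 2 = D_C1[OF V' T]
    show ?thesis
      unfolding D_tprod[OF Ck_tensor_imp_tensor[OF V'] S1 T1] D_tadd[OF V p[OF 1 T1] p[OF S1 2]] D_tprod[OF V 1 T1] D_tprod[OF V S1 2] ..
  qed
  show ?thesis
    unfolding curvature_def DD[OF tensor_X Y] DD[OF tensor_Y X] D_tprod[OF tensor_bracket S1 T1]
    by (simp add: tadd_def tdiff_def tprod_def fun_eq_iff algebra_simps)
qed

text \<open>The contraction of \<omega> with \<open>T\<close> has one upper index less, so
  \<open>R\<close> kills it by hypothesis. As a derivation commuting with contractions,
  \<open>R\<close> splits this into a term with \<open>R \<omega>\<close>, which is 0, and the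
  pairing of \<omega> with \<open>R T\<close>.\<close>

lemma R_contract_tprod_covector:
  assumes \<omega>: "Ck_tensor 2 0 1 \<omega>" and T: "Ck_tensor 2 (Suc r) s T"
    and z: "\<And>js. R \<omega> c p [] js = 0" and IH: "\<And>T is js. Ck_tensor 2 r s T \<Longrightarrow> R T c p is js = 0"
  shows "(\<Sum>k\<in>UNIV. \<omega> c p [] [k] * R T c p (k # is) js) = 0"
proof -
  have P: "Ck_tensor 2 (Suc r) (Suc s) (tprod 0 1 \<omega> T)"
    using Ck_tensor_field_tprod[OF openin_topspace \<omega> T] by simp
  have "0 = contract 0 0 (R (tprod 0 1 \<omega> T)) c p is js"
    using IH[OF Ck_tensor_field_contract[OF openin_topspace P]] R_contract[OF P] by simp
  also have "\<dots> = (\<Sum>k\<in>UNIV. \<omega> c p [] [k] * R T c p (k # is) js)"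
    unfolding R_tprod[OF \<omega> T] by (simp add: contract_0_0 tadd_def tprod_def z)
  finally show ?thesis by simp
qed

lemma R_contract_tprod_vector:
  assumes V: "Ck_tensor 2 1 0 V" and T: "Ck_tensor 2 r (Suc s) T"
    and z: "\<And>is. R V c p is [] = 0" and IH: "\<And>T is js. Ck_tensor 2 r s T \<Longrightarrow> R T c p is js = 0"
  shows "(\<Sum>k\<in>UNIV. V c p [k] [] * R T c p is (k # js)) = 0"
proof -
  have P: "Ck_tensor 2 (Suc r) (Suc s) (tprod 1 0 V T)"
    using Ck_tensor_field_tprod[OF openin_topspace V T] by simp
  have "0 = contract 0 0 (R (tprod 1 0 V T)) c p is js"
    using IH[OF Ck_tensor_field_contract[OF openin_topspace P]] R_contract[OF P] by simp
  also have "\<dots> = (\<Sum>k\<in>UNIV. V c p [k] [] * R T c p is (k # js))"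
    unfolding R_tprod[OF V T] by (simp add: contract_0_0 tadd_def tprod_def z)
  finally show ?thesis by simp
qed

text \<open>Contracting with the basis \<open>F\<close> gives the covectors by duality; contracting with vectors and
  covectors then lowers the type of a tensor down to a function.\<close>

lemma R_eq_0:
  assumes c: "c \<in> \<A>" "p \<in> chart_dom c"
    and F: "\<And>j. Ck_tensor 2 1 0 (F j)" "\<And>j is. R (F j) c p is [] = 0"
    and span: "span (range (\<lambda>j. \<chi> k. F j c p [k] [])) = (UNIV :: (real^'n) set)"
    and \<theta>: "\<And>l. Ck_tensor 2 0 1 (\<theta> l)" "\<And>l k. \<theta> l c p [] [k] = (if k = l then 1 else 0)"
    and T: "Ck_tensor 2 r s T"
  shows "R T c p is js = 0"
proof -
  \<comment> \<open>Lower indices come first: they are removed by the vectors \<open>F j\<close>,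
    while upper ones are removed by the covectors \<open>\<theta> l\<close>, for which the vanishing
    of \<open>R\<close> is an instance of this step.\<close>
  have lower: "R T c p is js = 0" if "Ck_tensor 2 0 s T" for s T "is" js
    using that
  proof (induction s arbitrary: T "is" js)
    case 0
    then show ?case using R_fun by (simp add: tzero_def)
  next
    case (Suc s)
    show ?case
    proof (cases js)
      case Nil
      then show ?thesis using tensor_field_eq_0[OF tensor_R[OF Suc.prems], of c p "is" js] by simp
    next
      case (Cons k js')
      \<comment> \<open>The first lower index of \<open>R T\<close> as a linear form on vectors: it
        vanishes on the spanning vectors \<open>F j\<close>, hence on each axis vector.\<close>
      define L where "L v = (\<Sum>k\<in>UNIV. v $ k * R T c p is (k # js'))" for v :: "real^'n"
      have "linear L" by (rule linearI) (simp_all add: L_def algebra_simps sum.distrib sum_distrib_left)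
      moreover have "L (\<chi> k. F j c p [k] []) = 0" for j
        using R_contract_tprod_vector[OF F(1) Suc.prems F(2) Suc.IH] by (simp add: L_def)
      ultimately have "L (axis k 1) = 0"
        using linear_eq_0_on_span[of L "range (\<lambda>j. \<chi> k. F j c p [k] [])" "axis k 1"] span by auto
      then show ?thesis by (simp add: L_def axis_def Cons if_distrib[of "\<lambda>x. x * _"] cong: if_cong)
    qed
  qed
  show ?thesis
    using T
  proof (induction r arbitrary: T "is" js)
    case 0
    then show ?case by (rule lower)
  next
    case (Suc r)
    show ?case
    proof (cases "is")
      case Nil
      then show ?thesis using tensor_field_eq_0[OF tensor_R[OF Suc.prems], of c p "is" js] by simp
    next
      case (Cons k is')
      have "(\<Sum>m\<in>UNIV. \<theta> k c p [] [m] * R T c p (m # is') js) = 0"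
        by (rule R_contract_tprod_covector[OF \<theta>(1) Suc.prems lower[OF \<theta>(1)] Suc.IH])
      then show ?thesis by (simp add: \<theta>(2) Cons if_distrib[of "\<lambda>x. x * _"] cong: if_cong)
    qed
  qed
qed

end

section \<open>Parallel bases\<close>

lemma linear_eq_0_on_axes:
  fixes f :: "real^'n \<Rightarrow> 'b::real_vector"
  assumes "linear f" "\<And>i. f (axis i 1) = 0" shows "f v = 0"
  using linear_axis_expansion[OF assms(1), of v] assms(2) by simp

lemma basis_of_invertible:
  fixes P :: "real^'n^'n"
  assumes "invertible P"
  shows "inj (\<lambda>i. column i P)" "independent (range (\<lambda>i. column i P))" "span (range (\<lambda>i. column i P)) = UNIV"
proof -
  have P: "inj ((*v) P)" using inj_matrix_vector_mult[OF assms] .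
  have col: "(\<lambda>i. column i P) = (*v) P \<circ> (\<lambda>i. axis i 1)" by (simp add: fun_eq_iff matrix_vector_mult_basis)
  have basis: "range (\<lambda>i. axis i 1) = (Basis :: (real^'n) set)" by (auto simp: Basis_vec_def)
  then have r: "range (\<lambda>i. column i P) = (*v) P ` Basis" unfolding col by (metis image_comp)
  show "inj (\<lambda>i. column i P)"
    unfolding col by (rule inj_compose[OF P]) (simp add: inj_def axis_eq_axis)
  show "independent (range (\<lambda>i. column i P))"
    unfolding r by (rule linear_independent_injective_image[OF matrix_vector_mul_linear independent_Basis inj_on_subset[OF P subset_UNIV]])
  have "surj ((*v) P)" by (rule linear_injective_imp_surjective[OF matrix_vector_mul_linear P]) (rule refl)
  then show "span (range (\<lambda>i. column i P)) = UNIV"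
    unfolding r by (simp add: linear_span_image[OF matrix_vector_mul_linear])
qed

text \<open>Nested twice, these are the elementary tensors in which the coefficient \<open>G\<close>
  of the linear system is expanded.\<close>

definition coordinate_blinfun :: "'n \<Rightarrow> 'b::real_normed_vector \<Rightarrow> (real^'n) \<Rightarrow>\<^sub>L 'b" where
  "coordinate_blinfun i a = Blinfun (\<lambda>v. v $ i *\<^sub>R a)"

lemma coordinate_blinfun_apply [simp]: "blinfun_apply (coordinate_blinfun i a) v = v $ i *\<^sub>R a"
  unfolding coordinate_blinfun_def
  by (simp add: bounded_linear_Blinfun_apply bounded_linear_scaleR_const[OF bounded_linear_vec_nth])

context C3_manifold begin

lemma cutoff_mono: "cutoff \<beta> U \<Longrightarrow> U \<subseteq> U' \<Longrightarrow> cutoff \<beta> U'"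
  unfolding cutoff_def by blast

end

context C1_connection begin

text \<open>The arbitrary extensions chosen by \<open>SOME\<close> may be replaced by any others:
  the value at \<open>q\<close> depends on \<open>V\<close> at \<open>q\<close> and on the germ of
  \<open>T\<close> only.\<close>

lemma local_cov_deriv_eq:
  assumes q: "q \<in> U" and V: "extends_germ M \<A> 1 0 q V V'" and T: "extends_germ M \<A> r s q T T'"
  shows "local_cov_deriv M \<A> D r s U V T c q = D V' T' c q"
proof -
  define V1 where "V1 = (SOME V'. extends_germ M \<A> 1 0 q V V')"
  define T1 where "T1 = (SOME T'. extends_germ M \<A> r s q T T')"
  have V1: "extends_germ M \<A> 1 0 q V V1" unfolding V1_def by (rule someI[of "extends_germ M \<A> 1 0 q V", OF V])
  have T1: "extends_germ M \<A> r s q T T1" unfolding T1_def by (rule someI[of "extends_germ M \<A> r s q T", OF T])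
  have tV: "tensor 1 0 V'" "tensor 1 0 V1" using V V1 Ck_tensor_imp_tensor unfolding extends_germ_def by blast+
  have cT: "Ck_tensor 1 r s T'" "Ck_tensor 1 r s T1" using T T1 unfolding extends_germ_def by blast+
  have eV: "V1 d q = V' d q" for d using V V1 unfolding extends_germ_def by metis
  obtain W W1 where W: "openin M W" "q \<in> W" "\<And>d p. p \<in> W \<Longrightarrow> T' d p = T d p" "openin M W1" "q \<in> W1" "\<And>d p. p \<in> W1 \<Longrightarrow> T1 d p = T d p"
    using T T1 unfolding extends_germ_def by metis
  have "local_cov_deriv M \<A> D r s U V T c q = D V1 T1 c q"
    using q by (simp add: local_cov_deriv_def V1_def T1_def)
  also have "\<dots> = D V' T1 c q" by (rule D_cong_left[OF tV(2,1) cT(2) eV])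
  also have "\<dots> = D V' T' c q"
    by (rule D_local[OF tV(1) cT(2,1) openin_Int[OF W(4,1)]]) (use W in auto)
  finally show ?thesis .
qed

text \<open>A parallel field is smoother than assumed: its components satisfy
  \<open>\<partial>\<^sub>i F\<^sup>l = (D\<^sub>i \<theta>\<^sup>l)\<^sub>k F\<^sup>k\<close>, and the right-hand side is of class \<open>C\<^sup>1\<close>.\<close>

lemma parallel_field_C2:
  assumes c: "c \<in> \<A>" and W: "openin M W" "W \<subseteq> chart_dom c"
    and X: "\<And>i. Ck_tensor 2 1 0 (X i)" "\<And>q i j. q \<in> W \<Longrightarrow> X i c q [j] [] = (if j = i then 1 else 0)"
    and \<theta>: "\<And>l. Ck_tensor 2 0 1 (\<theta> l)" "\<And>q l k. q \<in> W \<Longrightarrow> \<theta> l c q [] [k] = (if k = l then 1 else 0)"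
    and F: "Ck_tensor 1 1 0 F" and par: "\<And>q i l. q \<in> W \<Longrightarrow> D (X i) F c q [l] [] = 0"
  shows "Ck_on 2 (\<lambda>x. F c (chart_inv c x) [l] []) (chart_map c ` W)"
proof -
  let ?S = "chart_map c ` W" and ?u = "\<lambda>l x. F c (chart_inv c x) [l] []"
  have S: "open ?S" using open_chart_image[OF c W(1)] W(2) by (simp add: Int_absorb1)
  have sub: "?S \<subseteq> chart_map c ` chart_dom c" using W(2) by blast
  have u1: "Ck_on 1 (?u l) ?S" for l by (rule Ck_on_subset[OF Ck_component[OF F c] sub])
  have pd: "partial_deriv i (?u l) x = (\<Sum>k\<in>UNIV. D (X i) (\<theta> l) c (chart_inv c x) [] [k] * ?u k x)" if x: "x \<in> ?S" for i x
  proof -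
    obtain q where q: "q \<in> W" "x = chart_map c q" using x by blast
    then have inv: "chart_inv c x = q" using c W(2) by auto
    have "0 = (\<Sum>j\<in>UNIV. X i c q [j] [] * partial_deriv j (?u l) (chart_map c q)) - (\<Sum>k\<in>UNIV. D (X i) (\<theta> l) c q [] [k] * F c q [k] [])"
      using covariant_derivative_formula[OF c W q(1) C2_imp_C1[OF \<theta>(1)] \<theta>(2) F Ck_tensor_imp_tensor[OF X(1)], of i l] par[OF q(1)] by simp
    then show ?thesis unfolding inv X(2)[OF q(1)] q(2)[symmetric]
      by (simp add: if_distrib[of "\<lambda>x. x * _"] cong: if_cong)
  qed
  have D\<theta>: "Ck_on 1 (\<lambda>x. D (X i) (\<theta> l) c (chart_inv c x) [] [k]) ?S" for i k
    by (rule Ck_on_subset[OF Ck_component[OF D_C1[OF C2_imp_C1[OF X(1)] \<theta>(1)] c] sub])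
  have "Ck_on (Suc 1) (?u l) ?S"
  proof (rule Ck_on_SucI[OF S])
    fix x assume x: "x \<in> ?S"
    show "(?u l has_derivative (\<lambda>v. \<Sum>i\<in>UNIV. v $ i * (\<Sum>k\<in>UNIV. D (X i) (\<theta> l) c (chart_inv c x) [] [k] * ?u k x))) (at x)"
    proof (rule has_derivative_eq_rhs)
      have d: "?u l differentiable at x" by (rule Ck_on_imp_differentiable[OF u1 order_refl x])
      then show "(?u l has_derivative frechet_derivative (?u l) (at x)) (at x)" by (simp add: frechet_derivative_works)
      show "frechet_derivative (?u l) (at x) = (\<lambda>v. \<Sum>i\<in>UNIV. v $ i * (\<Sum>k\<in>UNIV. D (X i) (\<theta> l) c (chart_inv c x) [] [k] * ?u k x))"
        by (rule ext) (simp add: frechet_derivative_partial_deriv[OF d] pd[OF x])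
    qed
  next
    show "Ck_on 1 (\<lambda>x. \<Sum>i\<in>UNIV. v $ i * (\<Sum>k\<in>UNIV. D (X i) (\<theta> l) c (chart_inv c x) [] [k] * ?u k x)) ?S" for v
      by (intro Ck_on_sum Ck_on_mult S D\<theta> u1 Ck_on_const)
  qed
  then show ?thesis by (simp only: numeral_2_eq_2 One_nat_def)
qed

text \<open>Two cut-offs are made. The first yields global fields \<open>F j\<close> of class
  \<open>C\<^sup>1\<close>, to which \<open>D\<close> applies; their higher regularity is then known
  near \<open>p\<close> only, and a second one yields global fields \<open>H j\<close> of class
  \<open>C\<^sup>2\<close>, to which \<open>R\<close> applies.\<close>

lemma curvature_free_if_parallel_basis:
  assumes basis: "\<And>p. p \<in> topspace M \<Longrightarrow> \<exists>U E. p \<in> U \<and> local_basis M \<A> U E \<and>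
      (\<forall>i k. \<forall>q\<in>U. \<forall>c is js. local_cov_deriv M \<A> D 1 0 U (E i) (E k) c q is js = 0)"
  shows "curvature_free M \<A> D"
proof -
  have "curvature M \<A> D A B T d p is js = 0"
    if A: "Ck_tensor 1 1 0 A" and B: "Ck_tensor 1 1 0 B" and T: "Ck_tensor 2 r s T" for A B r s T d p "is" js
  proof (cases "p \<in> topspace M")
    case False
    interpret C1_connection_with_fields M \<A> D A B by unfold_locales (fact A B)+
    show ?thesis using tensor_field_eq_0[OF tensor_R[OF T]] False by blast
  next
    case True
    interpret C1_connection_with_fields M \<A> D A B by unfold_locales (fact A B)+
    obtain U E where U: "p \<in> U" and lb: "local_basis M \<A> U E"
      and par: "\<And>i k q c is js. q \<in> U \<Longrightarrow> local_cov_deriv M \<A> D 1 0 U (E i) (E k) c q is js = 0"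
      using basis[OF True] by blast
    have oU: "openin M U" and E: "\<And>i. Ck_tensor_field 1 \<A> U 1 0 (E i)"
      and span_E: "\<And>c q. c \<in> \<A> \<Longrightarrow> q \<in> chart_dom c \<Longrightarrow> q \<in> U \<Longrightarrow> span (range (\<lambda>i. \<chi> j. E i c q [j] [])) = UNIV"
      using lb unfolding local_basis_def Let_def by blast+
    obtain c W X \<theta> where c: "c \<in> \<A>" and W: "openin M W" "p \<in> W" "W \<subseteq> chart_dom c"
      and X: "\<And>i. Ck_tensor 2 1 0 (X i)" "\<And>q i j. q \<in> W \<Longrightarrow> X i c q [j] [] = (if j = i then 1 else 0)"
      and \<theta>: "\<And>l. Ck_tensor 2 0 1 (\<theta> l)" "\<And>q l k. q \<in> W \<Longrightarrow> \<theta> l c q [] [k] = (if k = l then 1 else 0)"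
      using coordinate_frame[OF True] by metis
    obtain \<beta> W1 where W1: "openin M W1" "p \<in> W1" "W1 \<subseteq> U \<inter> W" "\<And>q. q \<in> W1 \<Longrightarrow> \<beta> q = 1" and \<beta>: "cutoff \<beta> (U \<inter> W)"
      using cutoff_at[OF openin_Int[OF oU W(1)], of p] U W(2) by blast
    have W1c: "W1 \<subseteq> chart_dom c" using W1(3) W(3) by blast
    define F where "F j = (\<lambda>c p is js. \<beta> p * E j c p is js)" for j
    have F1: "Ck_tensor 1 1 0 (F j)" for j
      unfolding F_def by (rule Ck_tensor_cutoff[OF cutoff_mono[OF \<beta>] oU E]) auto
    have FE: "F j d q = E j d q" if "q \<in> W1" for j d q using W1(4)[OF that] by (simp add: F_def)
    have germ: "extends_germ M \<A> 1 0 q (E j) (F j)" if "q \<in> W1" for j q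
      unfolding extends_germ_def using F1 FE W1(1) that by blast
    \<comment> \<open>The hypothesis covers the directions \<open>E i\<close> only; these span, and
      \<open>D\<close> is linear in its direction at the point.\<close>
    have parF: "D V (F k) d q is js = 0" if q: "q \<in> W1" and V: "tensor 1 0 V" for V k d q "is" js
    proof -
      have qc: "q \<in> chart_dom c" "q \<in> U" using q W1(3) W(3) by auto
      obtain L where L: "linear L" "\<And>V. tensor 1 0 V \<Longrightarrow> D V (F k) d q is js = L (\<chi> i. V c q [i] [])"
        using D_pointwise_linear[OF c qc(1) F1] by blast
      have "L (\<chi> j. E i c q [j] []) = 0" for i
      proof -
        have "local_cov_deriv M \<A> D 1 0 U (E i) (E k) d q = D (F i) (F k) d q"
          by (rule local_cov_deriv_eq[OF qc(2) germ[OF q] germ[OF q]])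
        then have "D (F i) (F k) d q is js = 0" using par[OF qc(2), of i k d "is" js] by simp
        then show ?thesis using L(2)[OF Ck_tensor_imp_tensor[OF F1], of i] by (simp add: FE[OF q])
      qed
      then have "L v = 0" for v
        using linear_eq_0_on_span[OF L(1), of "range (\<lambda>i. \<chi> j. E i c q [j] [])" v] span_E[OF c qc] by auto
      then show ?thesis using L(2)[OF V] by simp
    qed
    have F2: "Ck_on 2 (\<lambda>x. F j c (chart_inv c x) [l] []) (chart_map c ` W1)" for j l
      by (rule parallel_field_C2[OF c W1(1) W1c X(1) _ \<theta>(1) _ F1 parF[OF _ Ck_tensor_imp_tensor[OF X(1)]]])
        (use X(2) \<theta>(2) W1(3) in auto)
    obtain \<gamma> W2 where W2: "openin M W2" "p \<in> W2" "W2 \<subseteq> W1" "\<And>q. q \<in> W2 \<Longrightarrow> \<gamma> q = 1" and \<gamma>: "cutoff \<gamma> W1"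
      using cutoff_at[OF W1(1,2)] by blast
    \<comment> \<open>Class \<open>C\<^sup>2\<close> is known for the components of
      \<open>F j\<close> in \<open>c\<close>; rebuilding the field from them secures it in all
      charts.\<close>
    define H where "H j = (\<lambda>d p is js. \<gamma> p * vector_in_chart c W1 (\<lambda>q l. F j c q [l] []) d p is js)" for j
    have H2: "Ck_tensor 2 1 0 (H j)" for j
      unfolding H_def
      by (rule Ck_tensor_cutoff[OF \<gamma> W1(1) Ck_vector_in_chart[OF c W1(1) W1c order_refl F2]]) simp
    have HF: "H j d q = F j d q" if q: "q \<in> W2" for j d q
    proof -
      have q1: "q \<in> W1" "q \<in> chart_dom c" "q \<in> topspace M" using q W2(3) W1c openin_subset[OF W1(1)] by auto
      have "F j d q = vector_in_chart c (topspace M) (\<lambda>q l. F j c q [l] []) d q"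
        by (rule vector_in_chart_unique[OF c q1(2,3) Ck_tensor_imp_tensor[OF F1]]) simp
      also have "\<dots> = vector_in_chart c W1 (\<lambda>q l. F j c q [l] []) d q"
        by (rule vector_in_chart_cong[OF q1(3,1)]) simp
      finally show ?thesis using W2(4)[OF q] by (simp add: H_def)
    qed
    have parH: "D V (H j) d q is js = 0" if q: "q \<in> W2" and V: "tensor 1 0 V" for V j d q "is" js
      using D_local[OF V C2_imp_C1[OF H2] F1 W2(1) q HF, of j d] parF[OF _ V, of q j d "is" js] q W2(3) by auto
    \<comment> \<open>In the two second-order terms the inner derivative vanishes on all of
      \<open>W2\<close>, so locality makes the outer one vanish at \<open>p\<close>.\<close>
    have RH: "R (H j) c p is [] = 0" for j "is"
      unfolding curvature_def tdiff_def
      using D_local_zero[OF tensor_X D_C1[OF B H2] W2(1,2) parH[OF _ tensor_Y], of j c "is" "[]"]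
        D_local_zero[OF tensor_Y D_C1[OF A H2] W2(1,2) parH[OF _ tensor_X], of j c "is" "[]"]
        parH[OF W2(2) tensor_bracket, of j c "is" "[]"] by simp
    have pc: "p \<in> chart_dom c" using W by blast
    have span_H: "span (range (\<lambda>j. \<chi> k. H j c p [k] [])) = UNIV"
      using span_E[OF c pc U] by (simp add: HF[OF W2(2)] FE[OF W1(2)])
    have "R T c p is js = 0" for "is" js
      by (rule R_eq_0[OF c pc H2 RH span_H \<theta>(1) \<theta>(2)[OF W(2)] T])
    then show ?thesis by (rule tensor_field_zero_transfer[OF tensor_R[OF T] c pc])
  qed
  then have "curvature M \<A> D A B T = tzero"
    if "Ck_tensor 1 1 0 A" "Ck_tensor 1 1 0 B" "Ck_tensor 2 r s T" for A B r s T
    using that by (simp add: tzero_def fun_eq_iff)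
  then show ?thesis unfolding curvature_free_def by blast
qed

text \<open>Curvature is evaluated on the coordinate fields only. Their brackets vanish near the
  point, so its components are precisely the integrability conditions for the system of parallel
  fields.\<close>

lemma parallel_basis_if_curvature_free:
  assumes flat: "curvature_free M \<A> D" and p: "p \<in> topspace M"
  shows "\<exists>U E. p \<in> U \<and> local_basis M \<A> U E \<and>
      (\<forall>i k. \<forall>q\<in>U. \<forall>c is js. local_cov_deriv M \<A> D 1 0 U (E i) (E k) c q is js = 0)"
proof -
  obtain c W X \<theta> where c: "c \<in> \<A>" and W: "openin M W" "p \<in> W" "W \<subseteq> chart_dom c"
    and X: "\<And>i. Ck_tensor 2 1 0 (X i)" "\<And>q i j. q \<in> W \<Longrightarrow> X i c q [j] [] = (if j = i then 1 else 0)"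
    and \<theta>: "\<And>l. Ck_tensor 2 0 1 (\<theta> l)" "\<And>q l k. q \<in> W \<Longrightarrow> \<theta> l c q [] [k] = (if k = l then 1 else 0)"
    using coordinate_frame[OF p] by metis
  define S where "S = chart_map c ` W"
  have S: "open S" using open_chart_image[OF c W(1)] W(3) by (simp add: Int_absorb1 S_def)
  have sub: "S \<subseteq> chart_map c ` chart_dom c" using W(3) by (auto simp: S_def)
  have inv: "chart_inv c (chart_map c q) = q" "chart_map c q \<in> S" if "q \<in> W" for q
    using that c W(3) by (auto simp: S_def)
  have tX: "tensor 1 0 (X i)" and X1: "Ck_tensor 1 1 0 (X i)" for i using X(1) Ck_tensor_imp_tensor C2_imp_C1 by blast+
  note formula = covariant_derivative_formula[OF c W(1,3) _ C2_imp_C1[OF \<theta>(1)] \<theta>(2)]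
  \<comment> \<open>The minus sign makes these the usual connection coefficients; \<open>DX\<close>
    confirms that they are the components of \<open>D (X i) (X k)\<close>.\<close>
  define \<Gamma> where "\<Gamma> l k i x = - D (X i) (\<theta> l) c (chart_inv c x) [] [k]" for l k i x
  have \<Gamma>1: "Ck_on 1 (\<Gamma> l k i) S" for l k i
    unfolding \<Gamma>_def[abs_def]
    by (rule Ck_on_uminus[OF S Ck_on_subset[OF Ck_component[OF D_C1[OF X1 \<theta>(1)] c] sub]])
  have cov: "D (X i) T c q [l] [] = partial_deriv i (\<lambda>x. T c (chart_inv c x) [l] []) (chart_map c q)
      + (\<Sum>k\<in>UNIV. \<Gamma> l k i (chart_map c q) * T c q [k] [])"
    if q: "q \<in> W" and T: "Ck_tensor 1 1 0 T" for q T i l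
    using formula[OF q _ T tX, of i l] X(2)[OF q] inv[OF q] q
    by (simp add: \<Gamma>_def sum_negf if_distrib[of "\<lambda>x. x * _"] cong: if_cong)
  have pd_const: "partial_deriv j (\<lambda>x. X i c (chart_inv c x) [l] []) (chart_map c q) = 0" if "q \<in> W" for i j l q
  proof -
    have "partial_deriv j (\<lambda>x. X i c (chart_inv c x) [l] []) (chart_map c q) = partial_deriv j (\<lambda>x. if l = i then 1 else 0) (chart_map c q)"
      by (rule partial_deriv_cong[OF S]) (use inv that in \<open>auto simp: S_def X(2)\<close>)
    then show ?thesis by (simp add: partial_deriv_def)
  qed
  have DX: "D (X i) (X k) c q [l] [] = \<Gamma> l k i (chart_map c q)" if "q \<in> W" for i k l q
    using cov[OF that X1] pd_const[OF that] X(2)[OF that] by (simp add: if_distrib[of "\<lambda>x. _ * x"] cong: if_cong)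
  have DDX: "D (X j) (D (X i) (X k)) c q [l] [] = partial_deriv j (\<Gamma> l k i) (chart_map c q)
      + (\<Sum>m\<in>UNIV. \<Gamma> l m j (chart_map c q) * \<Gamma> m k i (chart_map c q))" if q: "q \<in> W" for i j k l q
  proof -
    have "partial_deriv j (\<lambda>x. D (X i) (X k) c (chart_inv c x) [l] []) (chart_map c q) = partial_deriv j (\<Gamma> l k i) (chart_map c q)"
      by (rule partial_deriv_cong[OF S]) (use inv q in \<open>auto simp: S_def DX\<close>)
    then show ?thesis using cov[OF q D_C1[OF X1 X(1)]] DX[OF q] by simp
  qed
  \<comment> \<open>The component \<open>l\<close> of the curvature of \<open>X j\<close> and
    \<open>X i\<close> applied to \<open>X k\<close>.\<close>
  have flat\<Gamma>: "partial_deriv j (\<Gamma> l k i) x - partial_deriv i (\<Gamma> l k j) x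
      + (\<Sum>m\<in>UNIV. \<Gamma> l m j x * \<Gamma> m k i x) - (\<Sum>m\<in>UNIV. \<Gamma> l m i x * \<Gamma> m k j x) = 0" if x: "x \<in> S" for i j k l x
  proof -
    obtain q where q: "q \<in> W" "x = chart_map c q" using x by (auto simp: S_def)
    have qc: "q \<in> chart_dom c" using q W(3) by blast
    have "lie_bracket M \<A> (X j) (X i) c q [m] [] = 0" for m
      unfolding lie_bracket_in_chart[OF X1 X1 c qc] bracket_def by (simp add: pd_const[OF q(1)])
    then have z: "D (lie_bracket M \<A> (X j) (X i)) (X k) c q [l] [] = 0"
      by (rule D_zero_left[OF c qc X1 tensor_lie_bracket[OF X1 X1]])
    have "curvature M \<A> D (X j) (X i) (X k) c q [l] [] = 0"
      using flat X(1) X1 unfolding curvature_free_def by (metis tzero_def)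
    then show ?thesis unfolding curvature_def tdiff_def z DDX[OF q(1)] q(2) by simp
  qed

  have "\<exists>g. (\<forall>x\<in>S. (\<Gamma> l k i has_derivative blinfun_apply (g x)) (at x)) \<and> continuous_on S g" for l k i
    using Ck_on_1_blinfun[OF \<Gamma>1, of l k i] by metis
  then obtain \<Gamma>' where \<Gamma>': "\<And>l k i x. x \<in> S \<Longrightarrow> (\<Gamma> l k i has_derivative blinfun_apply (\<Gamma>' l k i x)) (at x)"
      "\<And>l k i. continuous_on S (\<Gamma>' l k i)" by metis
  \<comment> \<open>The bilinear map that multiplies coordinate \<open>i\<close> of the direction by
    coordinate \<open>k\<close> of the unknown and puts the product in place
    \<open>l\<close>.\<close>
  define e where "e i k l = coordinate_blinfun i (coordinate_blinfun k (axis l (1::real)))" for i k l :: 'n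
  define G where "G x = (\<Sum>i\<in>UNIV. \<Sum>k\<in>UNIV. \<Sum>l\<in>UNIV. \<Gamma> l k i x *\<^sub>R e i k l)" for x
  define G' where "G' x = Blinfun (\<lambda>v. \<Sum>i\<in>UNIV. \<Sum>k\<in>UNIV. \<Sum>l\<in>UNIV. \<Gamma>' l k i x v *\<^sub>R e i k l)" for x
  have G'_apply: "blinfun_apply (G' x) = (\<lambda>v. \<Sum>i\<in>UNIV. \<Sum>k\<in>UNIV. \<Sum>l\<in>UNIV. \<Gamma>' l k i x v *\<^sub>R e i k l)" for x
    unfolding G'_def by (intro bounded_linear_Blinfun_apply bounded_linear_sum bounded_linear_scaleR_const blinfun.bounded_linear_right)
  have dG: "(G has_derivative blinfun_apply (G' x)) (at x)" if "x \<in> S" for x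
    unfolding G_def[abs_def] G'_apply by (intro has_derivative_sum has_derivative_scaleR_left \<Gamma>' that)
  have cG': "continuous_on S G'"
    by (rule continuous_on_blinfun_componentwise)
      (unfold G'_apply, intro continuous_intros \<Gamma>')
  have e_nth: "e i k l v z $ m = (if m = l then v $ i * z $ k else 0)" for i k l m v z
    by (simp add: e_def axis_def blinfun.scaleR_left)
  have G_nth: "G x v z $ l = (\<Sum>i\<in>UNIV. \<Sum>k\<in>UNIV. \<Gamma> l k i x * (v $ i * z $ k))" for x v z l
    unfolding G_def
    by (simp add: blinfun.sum_left blinfun.scaleR_left e_nth if_distrib[of "\<lambda>x. _ * x"] cong: if_cong)
  have G'_nth: "G' x u v z $ l = (\<Sum>i\<in>UNIV. \<Sum>k\<in>UNIV. \<Gamma>' l k i x u * (v $ i * z $ k))" for x u v z l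
    unfolding G'_apply
    by (simp add: blinfun.sum_left blinfun.scaleR_left e_nth if_distrib[of "\<lambda>x. _ * x"] cong: if_cong)
  have axis_sum: "(\<Sum>i\<in>UNIV. \<Sum>k\<in>UNIV. f i k * ((axis a 1 :: real^'n) $ i * h k)) = (\<Sum>k\<in>UNIV. f a k * h k)"
    for f :: "'n \<Rightarrow> 'n \<Rightarrow> real" and h a
    by (subst sum.swap) (simp add: axis_def if_distrib[of "\<lambda>x. x * _"] if_distrib[of "\<lambda>x. _ * x"] cong: if_cong)
  have axis_sum1: "(\<Sum>k\<in>UNIV. f k * (axis a 1 :: real^'n) $ k) = f a" for f :: "'n \<Rightarrow> real" and a
    by (simp add: axis_def if_distrib[of "\<lambda>x. _ * x"] cong: if_cong)
  have flatG: "G' x v w z - G' x w v z + G x v (G x w z) - G x w (G x v z) = 0" if x: "x \<in> S" for x v w z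
  proof -
    \<comment> \<open>The expression is linear in each of its three arguments, so it has to be
      checked on axis vectors only, where it reduces to \<open>flat\<Gamma>\<close>.\<close>
    define F where "F v w z = G' x v w z - G' x w v z + G x v (G x w z) - G x w (G x v z)" for v w z
    have lin: "linear (\<lambda>v. F v w z)" "linear (\<lambda>w. F v w z)" "linear (\<lambda>z. F v w z)" for v w z
      by (rule linearI; simp add: F_def blinfun.add_left blinfun.add_right blinfun.scaleR_left blinfun.scaleR_right algebra_simps)+
    have pd: "\<Gamma>' l k i x (axis j 1) = partial_deriv j (\<Gamma> l k i) x" for l k i j
      using partial_deriv_eq[OF \<Gamma>'(1)[OF x]] by simp
    have "F (axis j 1) (axis i 1) (axis k 1) = 0" for i j k
    proof -
      have "F (axis j 1) (axis i 1) (axis k 1) $ l = 0" for l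
        using flat\<Gamma>[OF x, of j l k i]
        by (simp add: F_def G'_nth G_nth axis_sum axis_sum1 pd)
      then show ?thesis by (simp add: vec_eq_iff)
    qed
    then have "F (axis j 1) (axis i 1) z = 0" for i j z by (rule linear_eq_0_on_axes[OF lin(3)])
    then have "F (axis j 1) w z = 0" for j w z by (rule linear_eq_0_on_axes[OF lin(2)])
    then have "F v w z = 0" by (rule linear_eq_0_on_axes[OF lin(1)])
    then show ?thesis by (simp add: F_def)
  qed
  define a where "a = chart_map c p"
  have a: "a \<in> S" using inv(2)[OF W(2)] by (simp add: a_def)
  \<comment> \<open>One solution for each axis vector as initial value, so that the solutions form a
    basis at \<open>a\<close>.\<close>
  have "\<exists>r y. r > 0 \<and> ball a r \<subseteq> S \<and> y a = axis m 1 \<and> (\<forall>x\<in>ball a r. (y has_derivative (\<lambda>v. - G x v (y x))) (at x))" for m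
    using flat_total_differential_equation[OF S a dG cG' flatG, of "axis m 1"] by metis
  then obtain r y where y: "\<And>m. r m > 0" "\<And>m. ball a (r m) \<subseteq> S" "\<And>m. y m a = axis m 1"
      "\<And>m x. x \<in> ball a (r m) \<Longrightarrow> (y m has_derivative (\<lambda>v. - G x v (y m x))) (at x)" by metis
  define \<rho> where "\<rho> = Min (range r)"
  have \<rho>: "\<rho> > 0" "\<rho> \<le> r m" for m using y(1) by (auto simp: \<rho>_def)
  have dy: "(y m has_derivative (\<lambda>v. - G x v (y m x))) (at x)" if "x \<in> ball a \<rho>" for m x
    using y(4) that \<rho>(2)[of m] by auto
  have cy: "continuous_on (ball a \<rho>) (y m)" for m
    using dy by (meson continuous_at_imp_continuous_on has_derivative_continuous)
  have ball_S: "ball a \<rho> \<subseteq> S" using y(2) subset_ball[OF \<rho>(2)] by blast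
  \<comment> \<open>The fundamental matrix, with the solutions as columns.\<close>
  define Y where "Y x = (\<chi> k m. y m x $ k)" for x
  have cdet: "continuous_on (ball a \<rho>) (\<lambda>x. det (Y x))"
    unfolding det_def Y_def by (simp, intro continuous_intros cy)
  \<comment> \<open>A nonzero determinant is an open condition that holds at \<open>a\<close>, where
    \<open>Y\<close> is the identity; on \<open>N\<close> the solutions remain a basis.\<close>
  define N where "N = ball a \<rho> \<inter> (\<lambda>x. det (Y x)) -` (- {0})"
  have N: "open N" unfolding N_def by (rule continuous_open_preimage[OF cdet]) auto
  have Ya: "Y a = mat 1" by (simp add: Y_def y(3) mat_def axis_def vec_eq_iff eq_commute)
  have aN: "a \<in> N" using \<rho>(1) by (simp add: N_def Ya)
  have NS: "N \<subseteq> S" using ball_S by (auto simp: N_def)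
  define U where "U = {q \<in> chart_dom c. chart_map c q \<in> N}"
  have U: "openin M U" unfolding U_def by (rule openin_chart_vimage[OF c N])
  have pU: "p \<in> U" using aN W by (auto simp: U_def a_def)
  have Uc: "U \<subseteq> chart_dom c" by (auto simp: U_def)
  have UW: "U \<subseteq> W"
  proof
    fix q assume q: "q \<in> U"
    then obtain q' where "q' \<in> W" "chart_map c q = chart_map c q'" using NS by (auto simp: U_def S_def)
    then show "q \<in> W" using inj_onD[OF chart_inj[OF c]] q Uc W(3) by (metis subsetD)
  qed
  have UN: "chart_map c ` U = N"
  proof
    show "N \<subseteq> chart_map c ` U"
    proof
      fix x assume x: "x \<in> N"
      then obtain q where "q \<in> W" "x = chart_map c q" using NS by (auto simp: S_def)
      then show "x \<in> chart_map c ` U" using x W(3) by (auto simp: U_def)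
    qed
  qed (auto simp: U_def)
  define E where "E m = vector_in_chart c U (\<lambda>q k. y m (chart_map c q) $ k)" for m
  have E_c: "E m c q [k] [] = y m (chart_map c q) $ k" if "q \<in> U" for m q k
    unfolding E_def by (rule vector_in_chart_same[OF c _ that]) (use that Uc in blast)
  have E1: "Ck_tensor_field 1 \<A> U 1 0 (E m)" for m
    unfolding E_def
  proof (rule Ck_vector_in_chart[OF c U Uc])
    fix k
    have "Ck_on (Suc 0) (\<lambda>x. y m x $ k) N"
    proof (rule Ck_on_SucI[OF N])
      show "((\<lambda>x. y m x $ k) has_derivative (\<lambda>v. (- G x v (y m x)) $ k)) (at x)" if "x \<in> N" for x
        by (rule bounded_linear.has_derivative[OF bounded_linear_vec_nth dy]) (use that in \<open>auto simp: N_def\<close>)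
      have "continuous_on N G"
        using dG NS by (meson continuous_at_imp_continuous_on has_derivative_continuous subsetD)
      moreover have "continuous_on N (y m)" using cy by (rule continuous_on_subset) (auto simp: N_def)
      ultimately show "Ck_on 0 (\<lambda>x. (- G x v (y m x)) $ k) N" for v
        unfolding Ck_on.simps(1) by (intro continuous_intros)
    qed
    then have "Ck_on 1 (\<lambda>x. y m x $ k) N" by (simp only: One_nat_def)
    then show "Ck_on 1 (\<lambda>x. y m (chart_map c (chart_inv c x)) $ k) (chart_map c ` U)"
      unfolding UN by (subst Ck_on_cong[OF N, of _ "\<lambda>x. y m x $ k"]) (use c Uc in \<open>auto simp: UN[symmetric]\<close>)
  qed simp
  have basis: "inj (\<lambda>i. \<chi> j. E i d q [j] []) \<and> independent (range (\<lambda>i. \<chi> j. E i d q [j] []))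
     \<and> span (range (\<lambda>i. \<chi> j. E i d q [j] [])) = (UNIV :: (real^'n) set)"
    if d: "d \<in> \<A>" "q \<in> chart_dom d" and q: "q \<in> U" for d q
  proof -
    have qc: "q \<in> chart_dom c" using q Uc by blast
    define J where "J = (\<chi> j k. jacobian c d q j k)"
    define J' where "J' = (\<chi> j k. jacobian d c q j k)"
    have "J ** J' = mat 1"
      using jacobian_inverse[OF d c qc] by (simp add: J_def J'_def matrix_matrix_mult_def mat_def vec_eq_iff)
    then have "invertible J" using matrix_left_right_inverse invertible_def by metis
    moreover have "invertible (Y (chart_map c q))"
      using q by (auto simp: U_def N_def invertible_det_nz)
    ultimately have inv: "invertible (J ** Y (chart_map c q))" by (rule invertible_mult)
    \<comment> \<open>In a chart \<open>d\<close> the basis matrix is the Jacobian times the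
      fundamental matrix, both invertible.\<close>
    have eq: "(\<lambda>i. \<chi> j. E i d q [j] []) = (\<lambda>i. column i (J ** Y (chart_map c q)))"
      using d q qc by (simp add: fun_eq_iff vec_eq_iff column_def matrix_matrix_mult_def J_def Y_def E_def vector_in_chart_def)
    show ?thesis unfolding eq using basis_of_invertible[OF inv] by blast
  qed
  have lb: "local_basis M \<A> U E"
    unfolding local_basis_def Let_def using U E1 basis by blast
  have "local_cov_deriv M \<A> D 1 0 U (E i) (E k) d q is js = 0" if q: "q \<in> U" for i k q d "is" js
  proof -
    obtain \<beta> V where V: "openin M V" "q \<in> V" "V \<subseteq> U" "\<And>q. q \<in> V \<Longrightarrow> \<beta> q = 1" and \<beta>: "cutoff \<beta> U"
      using cutoff_at[OF U q] by blast
    define F where "F j = (\<lambda>c p is js. \<beta> p * E j c p is js)" for j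
    have F1: "Ck_tensor 1 1 0 (F j)" for j
      unfolding F_def by (rule Ck_tensor_cutoff[OF \<beta> U E1]) auto
    have FE: "F j d q = E j d q" if "q \<in> V" for j d q using V(4)[OF that] by (simp add: F_def)
    have germ: "extends_germ M \<A> 1 0 q (E j) (F j)" for j
      unfolding extends_germ_def using F1 FE V(1,2) by blast
    have qc: "q \<in> chart_dom c" and qW: "q \<in> W" using q Uc UW by auto
    have tF: "tensor 1 0 (F j)" for j by (rule Ck_tensor_imp_tensor[OF F1])
    have "D (X m) (F k) c q [l] [] = 0" for m l
    proof -
      let ?x = "chart_map c q"
      have oV: "open (chart_map c ` V)" using open_chart_image[OF c V(1)] V(3) Uc by (simp add: Int_absorb1 subset_trans)
      have xN: "?x \<in> ball a \<rho>" using q by (auto simp: U_def N_def)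
      \<comment> \<open>The differential equation turns this derivative into minus the connection
        term of \<open>cov\<close>, and the two cancel.\<close>
      have "partial_deriv m (\<lambda>x. F k c (chart_inv c x) [l] []) ?x = partial_deriv m (\<lambda>x. y k x $ l) ?x"
        by (rule partial_deriv_cong[OF oV]) (use V c Uc in \<open>auto simp: FE E_c subset_iff\<close>)
      also have "\<dots> = (- G ?x (axis m 1) (y k ?x)) $ l"
        by (rule partial_deriv_eq[OF bounded_linear.has_derivative[OF bounded_linear_vec_nth dy[OF xN]]])
      also have "\<dots> = - (\<Sum>j\<in>UNIV. \<Gamma> l j m ?x * y k ?x $ j)" by (simp add: G_nth axis_sum)
      finally show ?thesis unfolding cov[OF qW F1] by (simp add: FE[OF V(2)] E_c[OF q])
    qed
    \<comment> \<open>Directions \<open>F i\<close> are combinations of the coordinate fields at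
      \<open>q\<close>, along which the derivative has just been shown to vanish.\<close>
    then have "D (F i) (F k) c q [l] [] = 0" for l
      using D_frame_expansion[OF c qc F1 tF tX X(2)[OF qW]] by simp
    moreover have "D (F i) (F k) c q is js = 0" if "\<not> (length is = 1 \<and> length js = 0)" for "is" js
      using tensor_field_eq_0[OF D_tensor[OF tF F1]] that by blast
    ultimately have "D (F i) (F k) c q is js = 0" for "is" js
      by (cases "length is = 1 \<and> length js = 0") (auto simp: length_Suc_conv)
    then have "D (F i) (F k) d q is js = 0" by (rule tensor_field_zero_transfer[OF D_tensor[OF tF F1] c qc])
    then show ?thesis using local_cov_deriv_eq[OF q germ germ, THEN fun_cong, THEN fun_cong] by metis
  qed
  then show ?thesis using pU lb by blast
qed

end

theorem corollary4p3:
  fixes M :: "'m topology" and \<A> :: "('m, 'n::finite) chart set"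
    and D :: "('m, 'n) connection"
  assumes "Ck_manifold 3 M \<A>"
    and "linear_connection M \<A> D"
    and "Ck_connection 1 M \<A> D"
  shows "curvature_free M \<A> D \<longleftrightarrow>
    (\<forall>p \<in> topspace M. \<exists>U E. p \<in> U \<and> local_basis M \<A> U E \<and>
       (\<exists>\<Gamma>. has_components M \<A> D U E \<Gamma> \<and> (\<forall>j k i. \<forall>q\<in>U. \<Gamma> j k i q = 0)))"
proof -
  interpret C1_connection M \<A> D by unfold_locales (fact assms)+
  \<comment> \<open>With all coefficients zero on \<open>U\<close>, the component equation says just
    that the covariant derivatives of the basis along itself vanish; conversely the zero
    coefficients are the witness.\<close>
  have components: "(\<exists>\<Gamma>. has_components M \<A> D U E \<Gamma> \<and> (\<forall>j k i. \<forall>q\<in>U. \<Gamma> j k i q = 0)) \<longleftrightarrow>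
      (\<forall>i k. \<forall>q\<in>U. \<forall>c is js. local_cov_deriv M \<A> D 1 0 U (E i) (E k) c q is js = 0)" for U E
  proof
    assume "\<forall>i k. \<forall>q\<in>U. \<forall>c is js. local_cov_deriv M \<A> D 1 0 U (E i) (E k) c q is js = 0"
    then show "\<exists>\<Gamma>. has_components M \<A> D U E \<Gamma> \<and> (\<forall>j k i. \<forall>q\<in>U. \<Gamma> j k i q = 0)"
      by (intro exI[of _ "\<lambda>_ _ _ _. 0"]) (simp add: has_components_def)
  qed (auto simp: has_components_def)
  show ?thesis
    unfolding components using curvature_free_if_parallel_basis parallel_basis_if_curvature_free by blast
qed

end
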